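(* Assume $p_{\mathbf{x}}$ is regular enough that all quantities below are finite and that differentiation, expectation and integration over $\gamma$ may be interchanged. For $\boldsymbol{x}\in\mathbb{R}^d$ and $\Gamma\in(0,\infty]$, define $$\boldsymbol G(\boldsymbol{x},\Gamma)=\int_0^\Gamma\gamma^2\,\mathbb{E}\Big[\big(\nabla^2\log p_{\mathbf{y}_\gamma}(\gamma\boldsymbol{x}+\mathbf{w}_\gamma)\big)^2\Big]\,d\gamma .$$ Then: (a) $\mathrm{IEM}^2(\boldsymbol{x},\boldsymbol{x}+\boldsymbol\epsilon,\Gamma)=\boldsymbol\epsilon^\top\boldsymbol G(\boldsymbol{x},\Gamma)\boldsymbol\epsilon+o(\|\boldsymbol\epsilon\|^2)$ as $\boldsymbol\epsilon\to\mathbf 0$; (b) equivalently, $\boldsymbol G(\boldsymbol{x},\Gamma)=\int_0^\Gamma\mathbb{E}\Big[\big(\boldsymbol I-\gamma\,\mathrm{Cov}[\mathbf{x}\mid\mathbf{y}_\gamma=\gamma\boldsymbol{x}+\mathbf{w}_\gamma]\big)^2\Big]\,d\gamma$; (c) writing $\boldsymbol G(\boldsymbol{x})=\boldsymbol G(\boldsymbol{x},\infty)$, $$\mathbb{E}[\boldsymbol G(\mathbf{x})]=\mathbb{E}[-\nabla^2\log p_{\mathbf{x}}(\mathbf{x})]=\mathbb{E}[\nabla\log p_{\mathbf{x}}(\mathbf{x})\nabla\log p_{\mathbf{x}}(\mathbf{x})^\top],$$ where these expectations are over $\mathbf{x}\sim p_{\mathbf{x}}$.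
   Context: Let $\mathbf{x}$ be a random vector in $\mathbb{R}^d$ with (twice differentiable) probability density $p_{\mathbf{x}}$. For $\gamma\ge 0$ define $\mathbf{y}_\gamma=\gamma\mathbf{x}+\mathbf{w}_\gamma$, where $(\mathbf{w}_\gamma)_{\gamma\ge0}$ is a standard Wiener process in $\mathbb{R}^d$ ($\mathbf{w}_\gamma\sim\mathcal N(\mathbf{0},\gamma \boldsymbol I)$) independent of $\mathbf{x}$; $p_{\mathbf{y}_\gamma}$ is the density of $\mathbf{y}_\gamma$, and $\nabla$, $\nabla^2$ denote gradient and Hessian with respect to its argument. In (a),(b) expectations are over $\mathbf{w}_\gamma\sim\mathcal N(\mathbf 0,\gamma\boldsymbol I)$ for each $\gamma$, and $\mathrm{Cov}[\mathbf{x}\mid\mathbf{y}_\gamma=\boldsymbol y]$ is the posterior covariance of $\mathbf{x}$ given $\mathbf{y}_\gamma=\boldsymbol y$. The Information-Estimation Metric is $$\mathrm{IEM}(\boldsymbol{x}_1,\boldsymbol{x}_2,\Gamma)=\Big(\int_0^{\Gamma}\mathbb{E}\big[\|\nabla\log p_{\mathbf{y}_\gamma}(\gamma\boldsymbol{x}_1+\mathbf{w}_\gamma)-\nabla\log p_{\mathbf{y}_\gamma}(\gamma\boldsymbol{x}_2+\mathbf{w}_\gamma)\|^2\big]\,d\gamma\Big)^{1/2}.$$ *)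

theory Defs
  imports "HOL-Analysis.Analysis" "HOL-Library.Landau_Symbols"
begin

definition gradient :: "(real^'n \<Rightarrow> real) \<Rightarrow> real^'n \<Rightarrow> real^'n" where
  "gradient f x = (THE D. GDERIV f x :> D)"

definition hessian :: "(real^'n \<Rightarrow> real) \<Rightarrow> real^'n \<Rightarrow> real^'n^'n" where
  "hessian f x = (THE H. ((gradient f) has_derivative (\<lambda>h. H *v h)) (at x))"

definition outer :: "real^'n \<Rightarrow> real^'n \<Rightarrow> real^'n^'n" where
  "outer u v = (\<chi> i j. u $ i * v $ j)"

definition gauss_dens :: "real \<Rightarrow> real^'n \<Rightarrow> real" where
  "gauss_dens \<gamma> w = (2 * pi * \<gamma>) powr (- real CARD('n) / 2) * exp (- (norm w)\<^sup>2 / (2 * \<gamma>))"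

definition gexp :: "real \<Rightarrow> (real^'n \<Rightarrow> 'b::{banach, second_countable_topology}) \<Rightarrow> 'b" where
  "gexp \<gamma> f = (\<integral>w. gauss_dens \<gamma> w *\<^sub>R f w \<partial>lborel)"

text \<open>Density of y_gamma = gamma x + w_gamma, x with density p.\<close>
definition py :: "(real^'n \<Rightarrow> real) \<Rightarrow> real \<Rightarrow> real^'n \<Rightarrow> real" where
  "py p \<gamma> y = (\<integral>x. p x * gauss_dens \<gamma> (y - \<gamma> *\<^sub>R x) \<partial>lborel)"

definition score :: "(real^'n \<Rightarrow> real) \<Rightarrow> real \<Rightarrow> real^'n \<Rightarrow> real^'n" where
  "score p \<gamma> y = gradient (\<lambda>u. ln (py p \<gamma> u)) y"

definition hess_log :: "(real^'n \<Rightarrow> real) \<Rightarrow> real \<Rightarrow> real^'n \<Rightarrow> real^'n^'n" where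
  "hess_log p \<gamma> y = hessian (\<lambda>u. ln (py p \<gamma> u)) y"

definition post_mean :: "(real^'n \<Rightarrow> real) \<Rightarrow> real \<Rightarrow> real^'n \<Rightarrow> real^'n" where
  "post_mean p \<gamma> y = (1 / py p \<gamma> y) *\<^sub>R
     (\<integral>x. (p x * gauss_dens \<gamma> (y - \<gamma> *\<^sub>R x)) *\<^sub>R x \<partial>lborel)"

definition post_cov :: "(real^'n \<Rightarrow> real) \<Rightarrow> real \<Rightarrow> real^'n \<Rightarrow> real^'n^'n" where
  "post_cov p \<gamma> y = (1 / py p \<gamma> y) *\<^sub>R
     (\<integral>x. (p x * gauss_dens \<gamma> (y - \<gamma> *\<^sub>R x)) *\<^sub>R
            outer (x - post_mean p \<gamma> y) (x - post_mean p \<gamma> y) \<partial>lborel)"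

definition gam_range :: "ereal \<Rightarrow> real set" where
  "gam_range \<Gamma> = {\<gamma>. 0 < \<gamma> \<and> ereal \<gamma> < \<Gamma>}"

definition IEM :: "(real^'n \<Rightarrow> real) \<Rightarrow> real^'n \<Rightarrow> real^'n \<Rightarrow> ereal \<Rightarrow> real" where
  "IEM p x1 x2 \<Gamma> = sqrt (\<integral>\<gamma>. indicator (gam_range \<Gamma>) \<gamma> *
      gexp \<gamma> (\<lambda>w. (norm (score p \<gamma> (\<gamma> *\<^sub>R x1 + w) - score p \<gamma> (\<gamma> *\<^sub>R x2 + w)))\<^sup>2) \<partial>lborel)"

definition Gmat :: "(real^'n \<Rightarrow> real) \<Rightarrow> real^'n \<Rightarrow> ereal \<Rightarrow> real^'n^'n" where
  "Gmat p x \<Gamma> = (\<integral>\<gamma>. indicator (gam_range \<Gamma>) \<gamma> *\<^sub>R (\<gamma>\<^sup>2 *\<^sub>R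
      gexp \<gamma> (\<lambda>w. hess_log p \<gamma> (\<gamma> *\<^sub>R x + w) ** hess_log p \<gamma> (\<gamma> *\<^sub>R x + w))) \<partial>lborel)"

end

theory Submission
  imports Defs "HOL-Probability.Distributions"
begin

text \<open>
  In the coordinate \<open>u = y / \<gamma>\<close>, the observation is \<open>\<^bold>x\<close> plus Gaussian noise of precision \<open>\<gamma>\<close>. Its density
  \<open>q\<close> is a Gaussian convolution of \<open>p\<close>, and all derivatives of \<open>log q\<close> are polynomials in the posterior
  moments of the noise \<open>z = u - x\<close>. The second-order case of this is the Tweedie identity
  \<open>\<nabla>\<^sup>2 log p\<^sub>y = Cov - I / \<gamma>\<close>, which is (b). For a fixed \<open>\<gamma>\<close> the posterior moments grow at most exponentially
  in \<open>u\<close>, so that the expectation over the noise can be expanded by dominated convergence. The average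
  of the squared score difference is at most the average over the segment of the squared Hessian times \<open>\<parallel>\<epsilon>\<parallel>\<^sup>2\<close>, so the
  hypothesis dominates the integrand in \<open>\<gamma>\<close>, which gives (a).

  For (c), let \<open>J(\<gamma>) = \<integral> q (\<partial>\<^sub>v log q)\<^sup>2\<close>. The heat equation gives the de Bruijn-type identity
  \<open>J'(\<gamma>) = \<gamma>\<^sup>-\<^sup>2 \<integral> q \<parallel>\<nabla> \<partial>\<^sub>v log q\<parallel>\<^sup>2\<close>, and the right-hand side is the integrand of \<open>v\<^sup>T E[G] v\<close>. Moreover
  \<open>J(0+) = 0\<close>, whereas \<open>J(\<infinity>)\<close> is the Fisher information of \<open>p\<close>: the Cauchy-Schwarz inequality bounds it from above
  and Fatou's lemma from below.
\<close>


section \<open>Integrals depending on a parameter\<close>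

text \<open>Every derivative is put on the Gaussian kernel, so at finite precision \<open>p\<close>
  enters only as a positive probability density; \<open>gradient p\<close> and its derivative come
  in when the limit of infinite precision is identified. With noise of precision \<gamma>,
  \<open>q\<close> solves the heat equation in time \<open>1 / \<gamma>\<close>, whence the factor
  \<open>1 / \<gamma>^2\<close> in the evolution of \<open>J\<close>; it fits the weight
  \<open>\<gamma>^2\<close> in \<open>G\<close> because a Hessian in \<open>y\<close> is
  \<open>1 / \<gamma>^2\<close> times a Hessian in \<open>u\<close>. The evolution is proved
  pointwise in \<open>u\<close>: with \<open>S = dscore v\<close>, the \<gamma>-derivative of
  \<open>q S^2\<close> is \<open>1 / \<gamma>^2\<close> times
  \<open>q |grad S|^2 - Laplacian (q S^2) / 2\<close>, and the Laplacian integrates to zero. The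
  obstacle is integrability, since posterior moments are quotients by \<open>q\<close>, which may
  decay very fast. Against \<open>q\<close> itself the quotient is harmless; a lower bound on
  \<open>q\<close> is used only for growth in \<open>u\<close>. In (c) all work is done on quadratic
  forms: their integrands are nonnegative, so changes of order are Tonelli's theorem and the passage
  to all of \<open>{0<..}\<close> is monotone convergence.\<close>

lemma integral_cauchy_schwarz_ratio:
  fixes f g :: "'a \<Rightarrow> real"
  assumes f: "integrable M f" and g: "integrable M g"
    and fg: "integrable M (\<lambda>x. (f x)\<^sup>2 / g x)"
    and gpos: "\<And>x. x \<in> space M \<Longrightarrow> g x > 0"
    and ipos: "integral\<^sup>L M g > 0"
  shows "(integral\<^sup>L M f)\<^sup>2 / integral\<^sup>L M g \<le> (\<integral>x. (f x)\<^sup>2 / g x \<partial>M)"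
proof -
  \<comment> \<open>This \<open>c\<close> minimises the integral of
    \<open>(f x - c * g x)\<^sup>2 / g x\<close>, which is nonnegative for every \<open>c\<close>;
    at the minimiser its expansion is the claim.\<close>
  define c where "c = integral\<^sup>L M f / integral\<^sup>L M g"
  have "0 \<le> (\<integral>x. (f x)\<^sup>2 / g x - 2 * c * f x + c\<^sup>2 * g x \<partial>M)"
  proof (rule integral_nonneg_AE, rule AE_I2)
    fix x assume "x \<in> space M"
    then have "g x > 0" by (rule gpos)
    then have "(f x)\<^sup>2 / g x - 2 * c * f x + c\<^sup>2 * g x = (f x - c * g x)\<^sup>2 / g x"
      by (simp add: field_simps power2_eq_square)
    then show "0 \<le> (f x)\<^sup>2 / g x - 2 * c * f x + c\<^sup>2 * g x"
      using \<open>g x > 0\<close> by simp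
  qed
  also have "\<dots> = (\<integral>x. (f x)\<^sup>2 / g x \<partial>M) - 2 * c * integral\<^sup>L M f + c\<^sup>2 * integral\<^sup>L M g"
    using f g fg by simp
  also have "\<dots> = (\<integral>x. (f x)\<^sup>2 / g x \<partial>M) - (integral\<^sup>L M f)\<^sup>2 / integral\<^sup>L M g"
    using ipos by (simp add: c_def field_simps power2_eq_square)
  finally show ?thesis by simp
qed

lemma integral_derivative_eq_diff:
  fixes f :: "real \<Rightarrow> real"
  assumes "a \<le> b"
    and deriv: "\<And>t. t \<in> {a..b} \<Longrightarrow> (f has_real_derivative f' t) (at t)"
    and int: "integrable lborel (\<lambda>t. indicator {a..b} t * f' t)"
  shows "(LBINT t. indicator {a..b} t * f' t) = f b - f a"
proof -
  have "(f' has_integral (f b - f a)) {a..b}"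
    using \<open>a \<le> b\<close> deriv
    by (intro fundamental_theorem_of_calculus)
      (auto simp: has_real_derivative_iff_has_vector_derivative[symmetric] intro: has_field_derivative_at_within)
  then have "((\<lambda>t. indicator {a..b} t * f' t) has_integral (f b - f a)) UNIV"
    by (subst (asm) has_integral_restrict_UNIV[symmetric])
      (simp add: indicator_def of_bool_def if_distrib[of "\<lambda>c. c * _"] cong: if_cong)
  with has_integral_integral_lborel[OF int] show ?thesis
    by (rule has_integral_unique)
qed

text \<open>The fundamental theorem of calculus in \<open>t\<close> for almost every
  \<open>u\<close>, followed by Fubini. Joint integrability of \<open>F'\<close> takes the place of
  a bound on \<open>F'\<close> uniform in \<open>t\<close>, so the same lemma serves for
  translations and for the precision.\<close>

lemma parametric_fundamental_theorem:
  fixes F :: "real \<Rightarrow> 'a::euclidean_space \<Rightarrow> real"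
  assumes "a \<le> b"
    and deriv: "\<And>t u. t \<in> {a..b} \<Longrightarrow> ((\<lambda>t. F t u) has_real_derivative F' t u) (at t)"
    and int: "integrable (lborel \<Otimes>\<^sub>M lborel) (\<lambda>(t, u). indicator {a..b} t * F' t u)"
    and Fa: "integrable lborel (F a)" and Fb: "integrable lborel (F b)"
  shows "integral\<^sup>L lborel (F b) - integral\<^sup>L lborel (F a)
      = (LBINT t. indicator {a..b} t * integral\<^sup>L lborel (F' t))"
    and "integrable lborel (\<lambda>t. indicator {a..b} t * integral\<^sup>L lborel (F' t))"
proof -
  have "AE u in lborel. integrable lborel (\<lambda>t. indicator {a..b} t * F' t u)"
    using lborel_pair.AE_integrable_snd[OF int] by simp
  then have ae: "AE u in lborel. (LBINT t. indicator {a..b} t * F' t u) = F b u - F a u"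
    by eventually_elim (rule integral_derivative_eq_diff[OF \<open>a \<le> b\<close> deriv])
  have m: "(\<lambda>u. (LBINT t. indicator {a..b} t * F' t u)) \<in> borel_measurable lborel"
    using lborel_pair.integrable_snd[OF int] by (rule borel_measurable_integrable)
  have "integral\<^sup>L lborel (F b) - integral\<^sup>L lborel (F a) = (LBINT u. F b u - F a u)"
    using Fa Fb by simp
  also have "\<dots> = (LBINT u. (LBINT t. indicator {a..b} t * F' t u))"
    using Fa Fb m ae by (intro integral_cong_AE) (auto elim!: eventually_mono)
  also have "\<dots> = (LBINT t. (LBINT u. indicator {a..b} t * F' t u))"
    using int by (rule lborel_pair.Fubini_integral)
  finally show "integral\<^sup>L lborel (F b) - integral\<^sup>L lborel (F a)
      = (LBINT t. indicator {a..b} t * integral\<^sup>L lborel (F' t))"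
    by simp
  show "integrable lborel (\<lambda>t. indicator {a..b} t * integral\<^sup>L lborel (F' t))"
    using lborel_pair.integrable_fst[OF int] by simp
qed

lemma integrable_translate_iff:
  fixes f :: "'a::euclidean_space \<Rightarrow> real"
  assumes [measurable]: "f \<in> borel_measurable borel"
  shows "integrable lborel (\<lambda>u. f (c + u)) \<longleftrightarrow> integrable lborel f"
  by (subst (2) lborel_distr_plus[of c, symmetric], subst integrable_distr_eq) auto

lemma integral_translate:
  fixes f :: "'a::euclidean_space \<Rightarrow> real"
  assumes [measurable]: "f \<in> borel_measurable borel"
  shows "(LBINT u. f (c + u)) = integral\<^sup>L lborel f"
  by (subst (2) lborel_distr_plus[of c, symmetric], subst integral_distr) auto

text \<open>Integration by parts without boundary terms. The integral of \<open>f\<close> translated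
  by \<open>t *\<^sub>R e\<close> does not depend on \<open>t\<close>, so its increment from 0 to 1
  vanishes; by translation invariance that increment is also the integral of \<open>f'\<close>. No
  decay of \<open>f\<close> at infinity has to be shown.\<close>

lemma integral_directional_derivative_eq_0:
  fixes f :: "'a::euclidean_space \<Rightarrow> real"
  assumes f: "integrable lborel f" and f': "integrable lborel f'"
    and deriv: "\<And>u. ((\<lambda>t. f (u + t *\<^sub>R e)) has_real_derivative f' u) (at 0)"
  shows "integral\<^sup>L lborel f' = 0"
proof -
  have [measurable]: "f \<in> borel_measurable borel" "f' \<in> borel_measurable borel"
    using f f' by (auto dest: borel_measurable_integrable)
  define F where "F t u = f (t *\<^sub>R e + u)" for t u
  define F' where "F' t u = f' (t *\<^sub>R e + u)" for t u
  have d: "((\<lambda>t. F t u) has_real_derivative F' t u) (at t)" for t u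
  proof -
    have "((\<lambda>s. f ((u + t *\<^sub>R e) + s *\<^sub>R e)) has_real_derivative f' (u + t *\<^sub>R e)) (at (t - t))"
      using deriv[of "u + t *\<^sub>R e"] by simp
    then have "((\<lambda>s. f ((u + t *\<^sub>R e) + (s - t) *\<^sub>R e)) has_real_derivative f' (u + t *\<^sub>R e)) (at t)"
      using DERIV_shift[of "\<lambda>s. f ((u + t *\<^sub>R e) + s *\<^sub>R e)" _ t "-t"] by simp
    then show ?thesis
      unfolding F_def F'_def by (simp add: algebra_simps)
  qed
  have i: "integrable lborel (F t)" "integrable lborel (F' t)" "integrable lborel (\<lambda>u. norm (F' t u))"
      "integral\<^sup>L lborel (F t) = integral\<^sup>L lborel f" "integral\<^sup>L lborel (F' t) = integral\<^sup>L lborel f'"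
      "(LBINT u. norm (F' t u)) = (LBINT u. norm (f' u))" for t
    using f f' integral_translate[of "\<lambda>u. \<bar>f' u\<bar>" "t *\<^sub>R e"]
    by (auto simp: F_def[abs_def] F'_def[abs_def] integrable_translate_iff integral_translate)
  have "integrable (lborel \<Otimes>\<^sub>M lborel) (\<lambda>(t, u). indicator {0..1} t * F' t u)"
  proof (rule lborel_pair.Fubini_integrable)
    show "(\<lambda>(t, u). indicator {0..1} t * F' t u) \<in> borel_measurable (lborel \<Otimes>\<^sub>M lborel)"
      unfolding F'_def by measurable
    show "integrable lborel (\<lambda>t. (LBINT u. norm (case (t, u) of (t, u) \<Rightarrow> indicator {0..1} t * F' t u)))"
      using i(6) by (simp add: abs_mult)
    show "AE t in lborel. integrable lborel (\<lambda>u. case (t, u) of (t, u) \<Rightarrow> indicator {0..1} t * F' t u)"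
      using i(2) by simp
  qed
  from parametric_fundamental_theorem(1)[OF _ d this i(1) i(1)]
  show ?thesis by (simp add: i)
qed

text \<open>The mean value inequality turns the bound on \<open>F'\<close> into a Lipschitz bound
  with constant \<open>g x\<close>, so the normalised remainder is dominated by
  \<open>2 * g x\<close>. Stated for a normed space, to cover both the position \<open>u\<close> and
  the scalar precision.\<close>

lemma has_derivative_integral_dominated:
  fixes F :: "'a::real_normed_vector \<Rightarrow> 'b \<Rightarrow> real"
  assumes "r > 0"
    and deriv: "\<And>y x. y \<in> ball u r \<Longrightarrow> ((\<lambda>y. F y x) has_derivative F' y x) (at y)"
    and bound: "\<And>y x h. y \<in> ball u r \<Longrightarrow> \<bar>F' y x h\<bar> \<le> g x * norm h"
    and g: "integrable M g" and g0: "\<And>x. 0 \<le> g x"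
    and F: "\<And>y. y \<in> ball u r \<Longrightarrow> integrable M (F y)"
    and meas: "\<And>h. (\<lambda>x. F' u x h) \<in> borel_measurable M"
  shows "((\<lambda>y. \<integral>x. F y x \<partial>M) has_derivative (\<lambda>h. \<integral>x. F' u x h \<partial>M)) (at u)"
proof -
  have u: "u \<in> ball u r" using \<open>r > 0\<close> by simp
  have int': "integrable M (\<lambda>x. F' u x h)" for h
    using integrable_mult_left[OF g, of "norm h"] meas
    by (rule Bochner_Integration.integrable_bound) (use bound[OF u] in \<open>auto intro: order_trans[OF _ abs_ge_self]\<close>)
  have lin: "linear (F' u x)" for x
    using has_derivative_linear[OF deriv[OF u]] .
  have bl: "bounded_linear (\<lambda>h. \<integral>x. F' u x h \<partial>M)"
  proof (rule bounded_linear_intro[where K = "integral\<^sup>L M g"])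
    show "(\<integral>x. F' u x (h + k) \<partial>M) = (\<integral>x. F' u x h \<partial>M) + (\<integral>x. F' u x k \<partial>M)" for h k
      using int' by (simp add: linear_add[OF lin])
    show "(\<integral>x. F' u x (c *\<^sub>R h) \<partial>M) = c *\<^sub>R (\<integral>x. F' u x h \<partial>M)" for c h
      by (simp add: linear_scale[OF lin])
    show "norm (\<integral>x. F' u x h \<partial>M) \<le> norm h * integral\<^sup>L M g" for h
    proof -
      have "norm (\<integral>x. F' u x h \<partial>M) \<le> (\<integral>x. norm (F' u x h) \<partial>M)" by (rule integral_norm_bound)
      also have "\<dots> \<le> (\<integral>x. g x * norm h \<partial>M)"
        using int' g bound[OF u] by (intro integral_mono) auto
      finally show ?thesis by (simp add: mult.commute)
    qed
  qed
  have lip: "\<bar>F y x - F u x\<bar> \<le> g x * norm (y - u)" if "y \<in> ball u r" for x y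
  proof -
    have "norm (F y x - F u x) \<le> g x * norm (y - u)"
    proof (rule differentiable_bound[where S = "ball u r" and f' = "\<lambda>y. F' y x"])
      show "((\<lambda>y. F y x) has_derivative F' z x) (at z within ball u r)" if "z \<in> ball u r" for z
        using deriv[OF that] by (rule has_derivative_at_withinI)
      show "onorm (F' z x) \<le> g x" if "z \<in> ball u r" for z
        using bound[OF that] by (intro onorm_bound g0) simp
    qed (use that u in simp_all)
    then show ?thesis by simp
  qed
  have "((\<lambda>h. ((\<integral>x. F (u + h) x \<partial>M) - (\<integral>x. F u x \<partial>M) - (\<integral>x. F' u x h \<partial>M)) /\<^sub>R norm h) \<longlongrightarrow> 0) (at 0)"
    unfolding tendsto_at_iff_sequentially
  proof (intro allI impI)
    fix X :: "nat \<Rightarrow> 'a" assume X: "\<forall>i. X i \<in> UNIV - {0}" "X \<longlonglongrightarrow> 0"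
    obtain N where N: "\<And>n. n \<ge> N \<Longrightarrow> norm (X n) < r"
      using X(2) \<open>r > 0\<close> unfolding LIMSEQ_def by (metis dist_0_norm dist_commute)
    \<comment> \<open>The tail stays in the ball where the bounds hold, and dropping finitely many
      terms does not affect the limit.\<close>
    define Y where "Y n = X (n + N)" for n
    have Y: "Y n \<noteq> 0" "u + Y n \<in> ball u r" for n
      using X(1) N[of "n + N"] by (auto simp: Y_def dist_norm)
    have Y0: "Y \<longlonglongrightarrow> 0" unfolding Y_def using X(2) by (rule LIMSEQ_ignore_initial_segment)
    then have Yat: "filterlim Y (at 0) sequentially"
      using Y(1) by (auto simp: filterlim_at)
    have "(\<lambda>n. \<integral>x. (F (u + Y n) x - F u x - F' u x (Y n)) /\<^sub>R norm (Y n) \<partial>M) \<longlonglongrightarrow> (\<integral>x. 0 \<partial>M)"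
    proof (rule integral_dominated_convergence)
      show "integrable M (\<lambda>x. 2 * g x)" using g by simp
      show "AE x in M. (\<lambda>n. (F (u + Y n) x - F u x - F' u x (Y n)) /\<^sub>R norm (Y n)) \<longlonglongrightarrow> 0"
      proof (rule AE_I2)
        fix x
        have "((\<lambda>h. (F (u + h) x - F u x - F' u x h) /\<^sub>R norm h) \<longlongrightarrow> 0) (at 0)"
        proof (rule tendsto_norm_zero_cancel)
          show "((\<lambda>h. norm ((F (u + h) x - F u x - F' u x h) /\<^sub>R norm h)) \<longlongrightarrow> 0) (at 0)"
            using deriv[OF u, of x] unfolding has_derivative_at by (simp add: divide_inverse mult.commute abs_mult)
        qed
        then show "(\<lambda>n. (F (u + Y n) x - F u x - F' u x (Y n)) /\<^sub>R norm (Y n)) \<longlonglongrightarrow> 0"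
          using Yat by (rule filterlim_compose)
      qed
      show "AE x in M. norm ((F (u + Y n) x - F u x - F' u x (Y n)) /\<^sub>R norm (Y n)) \<le> 2 * g x" for n
      proof (rule AE_I2)
        fix x
        have "\<bar>F (u + Y n) x - F u x - F' u x (Y n)\<bar> \<le> 2 * g x * norm (Y n)"
          using lip[OF Y(2)[of n], of x] bound[OF u, of x "Y n"] by simp
        then show "norm ((F (u + Y n) x - F u x - F' u x (Y n)) /\<^sub>R norm (Y n)) \<le> 2 * g x"
          using Y(1)[of n] by (simp add: field_simps)
      qed
      show "(\<lambda>x. (F (u + Y n) x - F u x - F' u x (Y n)) /\<^sub>R norm (Y n)) \<in> borel_measurable M" for n
        using F[OF Y(2)] F[OF u] meas by (auto intro!: borel_measurable_scaleR borel_measurable_diff)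
    qed simp
    then have "(\<lambda>n. ((\<integral>x. F (u + Y n) x \<partial>M) - (\<integral>x. F u x \<partial>M) - (\<integral>x. F' u x (Y n) \<partial>M)) /\<^sub>R norm (Y n)) \<longlonglongrightarrow> 0"
      using F[OF Y(2)] F[OF u] int' by (simp add: Bochner_Integration.integral_diff)
    then show "((\<lambda>h. ((\<integral>x. F (u + h) x \<partial>M) - (\<integral>x. F u x \<partial>M) - (\<integral>x. F' u x h \<partial>M)) /\<^sub>R norm h) \<circ> X) \<longlonglongrightarrow> 0"
      unfolding Y_def o_def
      by (rule LIMSEQ_offset[where k = N and f = "\<lambda>n. ((\<integral>x. F (u + X n) x \<partial>M) - (\<integral>x. F u x \<partial>M) - (\<integral>x. F' u x (X n) \<partial>M)) /\<^sub>R norm (X n)"])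
  qed
  from tendsto_norm_zero[OF this] bl show ?thesis
    unfolding has_derivative_at by (simp add: divide_inverse mult.commute abs_mult)
qed


section \<open>The Gaussian kernel\<close>

text \<open>Density of N(0, I / g). Dividing the observation by \<open>g\<close> turns noise of
  variance \<open>g\<close> into noise of variance \<open>1 / g\<close>, so here \<open>g\<close> is
  a precision.\<close>

definition kern :: "real \<Rightarrow> real^'n \<Rightarrow> real" where
  "kern g z = (g / (2 * pi)) powr (real CARD('n) / 2) * exp (- (g * (norm z)\<^sup>2 / 2))"

lemma kern_pos: "g > 0 \<Longrightarrow> kern g z > 0"
  by (simp add: kern_def)

lemma kern_nonneg: "0 \<le> kern g z"
  by (simp add: kern_def)

lemma kern_measurable [measurable (raw)]:
  assumes "f \<in> borel_measurable M" "h \<in> borel_measurable M"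
  shows "(\<lambda>x. kern (f x) (h x)) \<in> borel_measurable M"
  using assms unfolding kern_def by measurable

text \<open>The factor \<open>g powr (- real CARD('n))\<close> is the Jacobian of the scaling. It is
  constant in space, hence invisible to posterior weights and to derivatives of logarithms.\<close>

lemma gauss_dens_scaleR:
  fixes z :: "real^'n"
  assumes "g > 0"
  shows "gauss_dens g (g *\<^sub>R z) = g powr (- real CARD('n)) * kern g z"
proof -
  have "g powr (- real CARD('n)) * (g / (2 * pi)) powr (real CARD('n) / 2) = (2 * pi * g) powr (- real CARD('n) / 2)"
    using assms
    by (simp add: powr_def ln_div ln_mult exp_add[symmetric]) (simp add: field_simps)
  moreover have "(norm (g *\<^sub>R z))\<^sup>2 / (2 * g) = g * (norm z)\<^sup>2 / 2"
    using assms by (simp add: power_mult_distrib power2_eq_square)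
  ultimately show ?thesis
    by (simp add: gauss_dens_def kern_def mult.assoc[symmetric])
qed

lemma kern_integral:
  assumes "g > 0"
  shows "integrable lborel (kern g :: real^'n \<Rightarrow> real)"
    and "(\<integral>z. kern g z \<partial>(lborel :: (real^'n) measure)) = 1"
proof -
  define s where "s = 1 / sqrt g"
  have s: "s > 0" "s\<^sup>2 = 1 / g" using assms by (simp_all add: s_def power_divide)
  have eq: "kern g z = (\<Prod>b\<in>Basis. normal_density 0 s (z \<bullet> b))" for z :: "real^'n"
  proof -
    have "(\<Prod>b\<in>Basis. normal_density 0 s (z \<bullet> b))
        = (1 / sqrt (2 * pi * s\<^sup>2)) ^ CARD('n) * exp (\<Sum>b\<in>Basis. - (z \<bullet> b)\<^sup>2 / (2 * s\<^sup>2))"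
      by (simp add: normal_density_def prod_dividef exp_sum power_divide)
    also have "(\<Sum>b\<in>Basis. - (z \<bullet> b)\<^sup>2 / (2 * s\<^sup>2)) = - (g * (norm z)\<^sup>2 / 2)"
      unfolding sum_divide_distrib[symmetric] sum_negf norm_eq_sqrt_inner euclidean_inner[of z z]
      using s by (simp add: power2_eq_square sum_nonneg)
    also have "1 / sqrt (2 * pi * s\<^sup>2) = (g / (2 * pi)) powr (1 / 2)"
      using assms by (simp add: s powr_half_sqrt real_sqrt_divide)
    also have "((g / (2 * pi)) powr (1 / 2)) ^ CARD('n) = (g / (2 * pi)) powr (real CARD('n) / 2)"
      using assms by (simp add: powr_realpow[symmetric] powr_powr)
    finally show ?thesis by (simp add: kern_def)
  qed
  have "(\<integral>\<^sup>+z. ennreal (kern g (z :: real^'n)) \<partial>lborel)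
      = (\<integral>\<^sup>+z. (\<Prod>b\<in>Basis. ennreal (normal_density 0 s ((z :: real^'n) \<bullet> b))) \<partial>lborel)"
    by (simp add: eq prod_ennreal)
  also have "\<dots> = (\<Prod>b\<in>(Basis :: (real^'n) set). (\<integral>\<^sup>+x. ennreal (normal_density 0 s x) \<partial>lborel))"
    by (rule nn_integral_lborel_prod) auto
  also have "(\<integral>\<^sup>+x. ennreal (normal_density 0 s x) \<partial>lborel) = 1"
    using s by (subst nn_integral_eq_integral) auto
  finally have *: "(\<integral>\<^sup>+z. ennreal (kern g (z :: real^'n)) \<partial>lborel) = 1" by simp
  show "integrable lborel (kern g :: real^'n \<Rightarrow> real)"
    by (rule integrableI_nonneg) (auto simp: * kern_nonneg)
  show "(\<integral>z. kern g z \<partial>(lborel :: (real^'n) measure)) = 1"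
    by (subst integral_eq_nn_integral) (auto simp: * kern_nonneg)
qed

text \<open>Half of the Gaussian exponent absorbs \<open>exp (k * norm z)\<close> by completing a
  square; what remains is a kernel of half the precision, and
  \<open>2 powr (real CARD('n) / 2)\<close> corrects its normalisation. The lower bound
  \<open>g1\<close> makes the constant uniform in \<open>g\<close>.\<close>

lemma exp_kern_le:
  fixes z :: "real^'n"
  assumes "0 < g1" "g1 \<le> g"
  shows "exp (k * norm z) * kern g z \<le> exp (k\<^sup>2 / g1) * 2 powr (real CARD('n) / 2) * kern (g / 2) z"
proof -
  have "0 \<le> (k / sqrt g - sqrt g * norm z / 2)\<^sup>2" by simp
  also have "\<dots> = k\<^sup>2 / g - k * norm z + g * (norm z)\<^sup>2 / 4"
    using assms by (simp add: power2_diff power_divide power_mult_distrib)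
  finally have 1: "k * norm z - g * (norm z)\<^sup>2 / 2 \<le> k\<^sup>2 / g1 + - (g / 2 * (norm z)\<^sup>2 / 2)"
    using assms frac_le[of "k\<^sup>2" "k\<^sup>2" g1 g] by simp
  have 2: "(g / (2 * pi)) powr (real CARD('n) / 2) = 2 powr (real CARD('n) / 2) * ((g / 2) / (2 * pi)) powr (real CARD('n) / 2)"
    using assms by (subst powr_mult[symmetric]) auto
  have "exp (k * norm z) * kern g z = (g / (2 * pi)) powr (real CARD('n) / 2) * exp (k * norm z - g * (norm z)\<^sup>2 / 2)"
    by (simp add: kern_def exp_add[symmetric] mult.left_commute)
  also have "\<dots> \<le> (g / (2 * pi)) powr (real CARD('n) / 2) * exp (k\<^sup>2 / g1 + - (g / 2 * (norm z)\<^sup>2 / 2))"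
    using 1 by (intro mult_left_mono) auto
  also have "\<dots> = exp (k\<^sup>2 / g1) * 2 powr (real CARD('n) / 2) * kern (g / 2) z"
    unfolding 2 kern_def by (simp only: exp_add mult_ac)
  finally show ?thesis .
qed

lemma kern_le:
  fixes z :: "real^'n"
  assumes "0 < g" "g \<le> g2"
  shows "kern g z \<le> (g2 / (2 * pi)) powr (real CARD('n) / 2)"
proof -
  have "kern g z \<le> (g / (2 * pi)) powr (real CARD('n) / 2) * 1"
    unfolding kern_def using assms by (intro mult_left_mono) auto
  also have "\<dots> \<le> (g2 / (2 * pi)) powr (real CARD('n) / 2)"
    using assms by (auto intro!: powr_mono2 divide_right_mono)
  finally show ?thesis .
qed

lemma exp_kern_bounded:
  assumes "0 < g1"
  shows "\<exists>B\<ge>0. \<forall>g\<in>{g1..g2}. \<forall>z::real^'n. exp (k * norm z) * kern g z \<le> B"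
proof (intro exI conjI ballI allI)
  let ?B = "exp (k\<^sup>2 / g1) * 2 powr (real CARD('n) / 2) * (g2 / 2 / (2 * pi)) powr (real CARD('n) / 2)"
  show "0 \<le> ?B" by simp
  fix g and z :: "real^'n" assume g: "g \<in> {g1..g2}"
  have "exp (k * norm z) * kern g z \<le> exp (k\<^sup>2 / g1) * 2 powr (real CARD('n) / 2) * kern (g / 2) z"
    using g assms by (intro exp_kern_le) auto
  also have "\<dots> \<le> ?B"
    using g assms by (intro mult_left_mono kern_le) auto
  finally show "exp (k * norm z) * kern g z \<le> ?B" .
qed

lemma exp_kern_integrable:
  assumes "0 < g"
  shows "integrable lborel (\<lambda>z::real^'n. exp (k * norm z) * kern g z)"
proof (rule Bochner_Integration.integrable_bound)
  show "integrable lborel (\<lambda>z::real^'n. exp (k\<^sup>2 / g) * 2 powr (real CARD('n) / 2) * kern (g / 2) z)"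
    using assms by (intro integrable_mult_right kern_integral) auto
  show "AE z::real^'n in lborel. norm (exp (k * norm z) * kern g z)
      \<le> norm (exp (k\<^sup>2 / g) * 2 powr (real CARD('n) / 2) * kern (g / 2) z)"
    using exp_kern_le[OF assms order_refl, of k, where 'n = 'n] by (simp add: kern_nonneg abs_mult)
qed measurable

lemma integrable_mult_kern:
  fixes f :: "real^'n \<Rightarrow> real"
  assumes "0 < g" "integrable lborel f"
  shows "integrable lborel (\<lambda>x. f x * kern g (u - x))"
proof (rule Bochner_Integration.integrable_bound)
  have [measurable]: "f \<in> borel_measurable borel" using assms(2) by (auto dest: borel_measurable_integrable)
  show "integrable lborel (\<lambda>x. f x * (g / (2 * pi)) powr (real CARD('n) / 2))" using assms(2) by simp
  show "AE x in lborel. norm (f x * kern g (u - x)) \<le> norm (f x * (g / (2 * pi)) powr (real CARD('n) / 2))"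
    using kern_le[OF assms(1) order_refl, where 'n = 'n]
    by (intro AE_I2) (auto simp: abs_mult kern_nonneg intro!: mult_left_mono)
  show "(\<lambda>x. f x * kern g (u - x)) \<in> borel_measurable lborel" by measurable
qed

lemma exp_kern_integral_le:
  assumes "0 < g1" "g1 \<le> g"
  shows "(\<integral>z. exp (k * norm z) * kern g z \<partial>(lborel :: (real^'n) measure))
    \<le> exp (k\<^sup>2 / g1) * 2 powr (real CARD('n) / 2)"
proof -
  have "(\<integral>z. exp (k * norm z) * kern g z \<partial>(lborel :: (real^'n) measure))
    \<le> (\<integral>z. exp (k\<^sup>2 / g1) * 2 powr (real CARD('n) / 2) * kern (g / 2) z \<partial>(lborel :: (real^'n) measure))"
    using assms exp_kern_le[OF assms] by (intro integral_mono exp_kern_integrable integrable_mult_right kern_integral) auto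
  also have "\<dots> = exp (k\<^sup>2 / g1) * 2 powr (real CARD('n) / 2)"
    using assms kern_integral(2)[of "g / 2", where 'n = 'n] by simp
  finally show ?thesis .
qed

lemma kern_has_derivative:
  "(kern g has_derivative (\<lambda>h. - g * (z \<bullet> h) * kern g z)) (at z)"
proof -
  have eq: "kern g = (\<lambda>z::real^'n. (g / (2 * pi)) powr (real CARD('n) / 2) * exp (- (g * (z \<bullet> z) / 2)))"
    by (simp add: kern_def fun_eq_iff power2_norm_eq_inner)
  show ?thesis
    unfolding eq by (rule derivative_eq_intros refl | simp add: fun_eq_iff inner_commute algebra_simps)+
qed

lemma kern_has_real_derivative:
  assumes "g > 0"
  shows "((\<lambda>g. kern g (z::real^'n)) has_real_derivative
    (real CARD('n) / (2 * g) - (norm z)\<^sup>2 / 2) * kern g z) (at g)"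
proof -
  have p: "((\<lambda>g. (g / (2 * pi)) powr r) has_real_derivative r / g * (g / (2 * pi)) powr r) (at g)" for r
    using assms by (auto intro!: derivative_eq_intros simp: powr_diff)
  show ?thesis
    unfolding kern_def
    by (rule derivative_eq_intros p refl | simp add: algebra_simps)+
qed

text \<open>Exponential instead of polynomial growth: one rate \<open>k\<close> covers polynomials
  of all degrees, products add rates, and the square of a bound is again a bound with rate
  \<open>2 * k\<close>, which is the shape of \<open>post_exp_square_le\<close>.\<close>

definition egrow :: "(real^'n \<Rightarrow> real) \<Rightarrow> bool" where
  "egrow \<phi> \<longleftrightarrow> \<phi> \<in> borel_measurable borel \<and> (\<exists>C\<ge>0. \<exists>k\<ge>0. \<forall>z. \<bar>\<phi> z\<bar> \<le> C * exp (k * norm z))"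

lemma egrowI:
  assumes "\<phi> \<in> borel_measurable borel" "\<And>z. \<bar>\<phi> z\<bar> \<le> C * exp (k * norm z)" "0 \<le> k"
  shows "egrow \<phi>"
proof -
  have "0 \<le> C" using assms(2)[of 0] by simp
  then show ?thesis using assms unfolding egrow_def by blast
qed

lemma egrowE:
  assumes "egrow \<phi>"
  obtains C k where "0 \<le> C" "0 \<le> k" "\<And>z. \<bar>\<phi> z\<bar> \<le> C * exp (k * norm z)"
  using assms unfolding egrow_def by blast

lemma egrow_measurable: "egrow \<phi> \<Longrightarrow> \<phi> \<in> borel_measurable borel"
  by (simp add: egrow_def)

named_theorems egrow_intros

lemma egrow_exp [egrow_intros]: "0 \<le> k \<Longrightarrow> egrow (\<lambda>z. exp (k * norm z))"
  by (rule egrowI[where C = 1 and k = k]) auto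

lemma egrow_const [egrow_intros]: "egrow (\<lambda>z. c)"
  by (rule egrowI[where C = "\<bar>c\<bar>" and k = 0]) auto

lemma egrow_norm [egrow_intros]: "egrow norm"
proof (rule egrowI[where C = 1 and k = 1])
  show "\<bar>norm z\<bar> \<le> 1 * exp (1 * norm z)" for z :: "real^'n"
    using exp_ge_add_one_self[of "norm z"] by (simp del: exp_ge_add_one_self)
qed auto

lemma egrow_inner [egrow_intros]: fixes v :: "real^'n" shows "egrow (\<lambda>z. z \<bullet> v)"
proof (rule egrowI[where C = "norm v" and k = 1])
  fix z :: "real^'n"
  have "norm z \<le> exp (norm z)"
    using exp_ge_add_one_self[of "norm z"] by (simp del: exp_ge_add_one_self)
  then have "norm z * norm v \<le> exp (norm z) * norm v" by (intro mult_right_mono) auto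
  then show "\<bar>z \<bullet> v\<bar> \<le> norm v * exp (1 * norm z)"
    using Cauchy_Schwarz_ineq2[of z v] by (simp add: mult.commute)
qed auto

lemma egrow_add [egrow_intros]:
  assumes "egrow \<phi>" "egrow \<psi>" shows "egrow (\<lambda>z. \<phi> z + \<psi> z)"
proof -
  obtain C k where 1: "0 \<le> C" "0 \<le> k" "\<And>z. \<bar>\<phi> z\<bar> \<le> C * exp (k * norm z)" using assms(1) by (rule egrowE) blast
  obtain D l where 2: "0 \<le> D" "0 \<le> l" "\<And>z. \<bar>\<psi> z\<bar> \<le> D * exp (l * norm z)" using assms(2) by (rule egrowE) blast
  show ?thesis
  proof (rule egrowI[where C = "C + D" and k = "max k l"])
    fix z :: "real^'a"
    have "C * exp (k * norm z) \<le> C * exp (max k l * norm z)" "D * exp (l * norm z) \<le> D * exp (max k l * norm z)"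
      using 1 2 by (auto intro!: mult_left_mono mult_right_mono)
    then show "\<bar>\<phi> z + \<psi> z\<bar> \<le> (C + D) * exp (max k l * norm z)"
      using 1(3)[of z] 2(3)[of z] by (simp add: distrib_right)
  qed (use assms[THEN egrow_measurable] 1 in \<open>auto intro: borel_measurable_add\<close>)
qed

lemma egrow_mult [egrow_intros]:
  assumes "egrow \<phi>" "egrow \<psi>" shows "egrow (\<lambda>z. \<phi> z * \<psi> z)"
proof -
  obtain C k where 1: "0 \<le> C" "0 \<le> k" "\<And>z. \<bar>\<phi> z\<bar> \<le> C * exp (k * norm z)" using assms(1) by (rule egrowE) blast
  obtain D l where 2: "0 \<le> D" "0 \<le> l" "\<And>z. \<bar>\<psi> z\<bar> \<le> D * exp (l * norm z)" using assms(2) by (rule egrowE) blast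
  show ?thesis
  proof (rule egrowI[where C = "C * D" and k = "k + l"])
    fix z :: "real^'a"
    have "\<bar>\<phi> z\<bar> * \<bar>\<psi> z\<bar> \<le> (C * exp (k * norm z)) * (D * exp (l * norm z))"
      using 1 2 by (intro mult_mono) auto
    then show "\<bar>\<phi> z * \<psi> z\<bar> \<le> C * D * exp ((k + l) * norm z)"
      by (simp add: abs_mult exp_add ring_distribs mult_ac)
  qed (use assms[THEN egrow_measurable] 1 2 in \<open>auto intro: borel_measurable_times\<close>)
qed

lemma egrow_minus [egrow_intros]: "egrow \<phi> \<Longrightarrow> egrow (\<lambda>z. - \<phi> z)"
  using egrow_mult[OF egrow_const[of "-1"]] by simp

lemma egrow_diff [egrow_intros]: "egrow \<phi> \<Longrightarrow> egrow \<psi> \<Longrightarrow> egrow (\<lambda>z. \<phi> z - \<psi> z)"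
  using egrow_add[OF _ egrow_minus, of \<phi> \<psi>] by simp

lemma egrow_power [egrow_intros]: "egrow \<phi> \<Longrightarrow> egrow (\<lambda>z. \<phi> z ^ n)"
  by (induction n) (auto intro: egrow_intros)


section \<open>Posterior moments\<close>

text \<open>Unnormalised posterior moment. The test function takes the noise \<open>u - x\<close>
  rather than \<open>x\<close>, so that differentiating the kernel merely multiplies it by a
  polynomial in its own argument.\<close>

definition mom :: "(real^'n \<Rightarrow> real) \<Rightarrow> (real^'n \<Rightarrow> real) \<Rightarrow> real \<Rightarrow> real^'n \<Rightarrow> real" where
  "mom p \<phi> g u = (LBINT x. p x * (\<phi> (u - x) * kern g (u - x)))"

definition post :: "(real^'n \<Rightarrow> real) \<Rightarrow> (real^'n \<Rightarrow> real) \<Rightarrow> real \<Rightarrow> real^'n \<Rightarrow> real" where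
  "post p \<phi> g u = mom p \<phi> g u / mom p (\<lambda>_. 1) g u"

text \<open>No smoothness of \<open>p\<close> is recorded here: the kernel carries all derivatives
  of the smoothed density.\<close>

locale pos_density =
  fixes p :: "real^'n \<Rightarrow> real"
  assumes p_pos: "\<And>z. p z > 0"
    and p_int: "integrable lborel p"
    and p_mass: "(LBINT z. p z) = 1"
begin

abbreviation "q \<equiv> mom p (\<lambda>_. 1)"
abbreviation "P \<equiv> post p"
abbreviation "PE k \<equiv> P (\<lambda>z. exp (k * norm z))"
abbreviation "P1 v \<equiv> P (\<lambda>z. z \<bullet> v)"
abbreviation "P2 v w \<equiv> P (\<lambda>z. (z \<bullet> v) * (z \<bullet> w))"

lemma p_measurable [measurable]: "p \<in> borel_measurable borel"
  using borel_measurable_integrable[OF p_int] by simp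

lemma mom_integrable:
  assumes "0 < g" "egrow \<phi>"
  shows "integrable lborel (\<lambda>x. p x * (\<phi> (u - x) * kern g (u - x)))"
proof -
  obtain C k where C: "0 \<le> C" "0 \<le> k" "\<And>z. \<bar>\<phi> z\<bar> \<le> C * exp (k * norm z)" using assms(2) by (rule egrowE) blast
  obtain B where B: "0 \<le> B" "\<And>z :: real^'n. exp (k * norm z) * kern g z \<le> B"
    using exp_kern_bounded[OF assms(1), of g k, where 'n = 'n] by auto
  note [measurable] = egrow_measurable[OF assms(2)]
  show ?thesis
  proof (rule Bochner_Integration.integrable_bound)
    show "integrable lborel (\<lambda>x. p x * (C * B))" using p_int by simp
    have "\<bar>\<phi> z * kern g z\<bar> \<le> C * B" for z
    proof -
      have "\<bar>\<phi> z * kern g z\<bar> \<le> C * exp (k * norm z) * kern g z"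
        using C(3)[of z] by (simp add: abs_mult kern_nonneg mult_right_mono)
      also have "\<dots> \<le> C * B" using B(2)[of z] C(1) by (simp add: mult.assoc mult_left_mono)
      finally show ?thesis .
    qed
    then show "AE x in lborel. norm (p x * (\<phi> (u - x) * kern g (u - x))) \<le> norm (p x * (C * B))"
      using p_pos B(1) C(1) by (intro AE_I2) (simp add: abs_mult[of "p _"] mult_left_mono)
  qed measurable
qed

lemma mom_measurable [measurable (raw)]:
  assumes [measurable]: "\<phi> \<in> borel_measurable borel" "f \<in> borel_measurable M" "h \<in> borel_measurable M"
  shows "(\<lambda>x. mom p \<phi> (f x) (h x)) \<in> borel_measurable M"
  unfolding mom_def by measurable

lemma post_measurable [measurable (raw)]:
  assumes [measurable]: "\<phi> \<in> borel_measurable borel" "f \<in> borel_measurable M" "h \<in> borel_measurable M"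
  shows "(\<lambda>x. P \<phi> (f x) (h x)) \<in> borel_measurable M"
  unfolding post_def by measurable

lemma mom_add: "0 < g \<Longrightarrow> egrow \<phi> \<Longrightarrow> egrow \<psi> \<Longrightarrow> mom p (\<lambda>z. \<phi> z + \<psi> z) g u = mom p \<phi> g u + mom p \<psi> g u"
  unfolding mom_def using mom_integrable[of g \<phi> u] mom_integrable[of g \<psi> u] by (simp add: algebra_simps)

lemma mom_cmult: "mom p (\<lambda>z. c * \<phi> z) g u = c * mom p \<phi> g u"
  unfolding mom_def by (subst integral_mult_right_zero[symmetric]) (simp add: mult_ac)

lemma mom_mono:
  assumes "0 < g" "egrow \<phi>" "egrow \<psi>" "\<And>z. \<phi> z \<le> \<psi> z"
  shows "mom p \<phi> g u \<le> mom p \<psi> g u"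
  unfolding mom_def using assms p_pos
  by (intro integral_mono mom_integrable mult_left_mono mult_right_mono kern_nonneg) (auto intro: less_imp_le)

lemma q_pos:
  assumes "0 < g" shows "0 < q g u"
proof -
  have i: "integrable lborel (\<lambda>x. p x * (1 * kern g (u - x)))"
    using assms by (intro mom_integrable egrow_intros)
  have n: "0 \<le> p x * (1 * kern g (u - x))" "p x * (1 * kern g (u - x)) \<noteq> 0" for x
    using p_pos[of x] kern_pos[OF assms, of "u - x"] by auto
  have "q g u \<noteq> 0"
  proof
    assume "q g u = 0"
    then have "AE x in lborel. p x * (1 * kern g (u - x)) = 0"
      using integral_nonneg_eq_0_iff_AE[OF i] n(1) by (simp add: mom_def)
    then have "AE x in lborel. p x = 0"
      by eventually_elim (use n(2) in blast)
    then have "integral\<^sup>L lborel p = (\<integral>x. 0 \<partial>(lborel :: (real^'n) measure))"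
      by (intro integral_cong_AE) auto
    then show False using p_mass by simp
  qed
  moreover have "0 \<le> q g u" unfolding mom_def using n(1) by simp
  ultimately show ?thesis by simp
qed

lemma mom_eq_post: "0 < g \<Longrightarrow> mom p \<phi> g u = q g u * P \<phi> g u"
  using q_pos[of g u] by (simp add: post_def)

lemma post_add: "0 < g \<Longrightarrow> egrow \<phi> \<Longrightarrow> egrow \<psi> \<Longrightarrow> P (\<lambda>z. \<phi> z + \<psi> z) g u = P \<phi> g u + P \<psi> g u"
  by (simp add: post_def mom_add add_divide_distrib)

lemma post_cmult: "P (\<lambda>z. c * \<phi> z) g u = c * P \<phi> g u"
  by (simp add: post_def mom_cmult)

lemma post_diff: "0 < g \<Longrightarrow> egrow \<phi> \<Longrightarrow> egrow \<psi> \<Longrightarrow> P (\<lambda>z. \<phi> z - \<psi> z) g u = P \<phi> g u - P \<psi> g u"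
  using post_add[of g \<phi> "\<lambda>z. -1 * \<psi> z" u] post_cmult[of "-1" \<psi> g u] egrow_minus[of \<psi>] by simp

lemma post_sum:
  assumes "0 < g" "finite I" "\<And>i. i \<in> I \<Longrightarrow> egrow (\<phi> i)"
  shows "P (\<lambda>z. \<Sum>i\<in>I. \<phi> i z) g u = (\<Sum>i\<in>I. P (\<phi> i) g u)" "egrow (\<lambda>z. \<Sum>i\<in>I. \<phi> i z)"
proof -
  have "P (\<lambda>z. \<Sum>i\<in>I. \<phi> i z) g u = (\<Sum>i\<in>I. P (\<phi> i) g u) \<and> egrow (\<lambda>z. \<Sum>i\<in>I. \<phi> i z)"
    using assms(2,3)
  proof (induction I rule: finite_induct)
    case empty
    then show ?case using egrow_const[of 0] by (simp add: post_def mom_def)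
  next
    case (insert i I)
    then show ?case using assms(1) by (simp add: post_add egrow_add)
  qed
  then show "P (\<lambda>z. \<Sum>i\<in>I. \<phi> i z) g u = (\<Sum>i\<in>I. P (\<phi> i) g u)" "egrow (\<lambda>z. \<Sum>i\<in>I. \<phi> i z)" by auto
qed

lemma post_const: "0 < g \<Longrightarrow> P (\<lambda>z. c) g u = c"
  using post_cmult[of c "\<lambda>_. 1" g u] q_pos[of g u] by (simp add: post_def)

lemma post_mono:
  assumes "0 < g" "egrow \<phi>" "egrow \<psi>" "\<And>z. \<phi> z \<le> \<psi> z"
  shows "P \<phi> g u \<le> P \<psi> g u"
  using mom_mono[OF assms] q_pos[OF assms(1)] by (simp add: post_def divide_right_mono less_imp_le)

lemma post_abs_le:
  assumes "0 < g" "egrow \<phi>" "egrow \<psi>" "\<And>z. \<bar>\<phi> z\<bar> \<le> \<psi> z"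
  shows "\<bar>P \<phi> g u\<bar> \<le> P \<psi> g u"
proof (rule abs_leI)
  show "P \<phi> g u \<le> P \<psi> g u"
    using assms abs_le_D1 by (intro post_mono) blast+
  have "P (\<lambda>z. - 1 * \<phi> z) g u \<le> P \<psi> g u"
    using assms abs_le_D2 by (intro post_mono egrow_intros) auto
  then show "- P \<phi> g u \<le> P \<psi> g u"
    unfolding post_cmult by simp
qed

text \<open>Cauchy-Schwarz with weight \<open>p x * kern g (u - x)\<close>, that is, Jensen's
  inequality for the square under the posterior.\<close>

lemma post_square_le:
  assumes "0 < g" "egrow \<phi>"
  shows "(P \<phi> g u)\<^sup>2 \<le> P (\<lambda>z. (\<phi> z)\<^sup>2) g u"
proof -
  let ?f = "\<lambda>x. p x * (\<phi> (u - x) * kern g (u - x))"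
  let ?g = "\<lambda>x. p x * (1 * kern g (u - x))"
  have g: "?g x > 0" for x using p_pos[of x] kern_pos[OF assms(1), of "u - x"] by simp
  have eq: "(?f x)\<^sup>2 / ?g x = p x * ((\<phi> (u - x))\<^sup>2 * kern g (u - x))" for x
    using p_pos[of x] kern_pos[OF assms(1), of "u - x"]
    by (simp add: power2_eq_square)
  have "(integral\<^sup>L lborel ?f)\<^sup>2 / integral\<^sup>L lborel ?g \<le> (LBINT x. (?f x)\<^sup>2 / ?g x)"
  proof (rule integral_cauchy_schwarz_ratio)
    show "integrable lborel ?f" "integrable lborel ?g" "integrable lborel (\<lambda>x. (?f x)\<^sup>2 / ?g x)"
      unfolding eq using assms by (intro mom_integrable egrow_intros; simp)+
    show "0 < integral\<^sup>L lborel ?g" using q_pos[OF assms(1), of u] unfolding mom_def .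
  qed (rule g)
  then have "(mom p \<phi> g u)\<^sup>2 / q g u \<le> mom p (\<lambda>z. (\<phi> z)\<^sup>2) g u"
    unfolding eq unfolding mom_def .
  then have "(mom p \<phi> g u)\<^sup>2 / q g u / q g u \<le> mom p (\<lambda>z. (\<phi> z)\<^sup>2) g u / q g u"
    using q_pos[OF assms(1)] by (intro divide_right_mono) (auto intro: less_imp_le)
  then show ?thesis by (simp add: post_def power_divide power2_eq_square)
qed

lemma post_exp_square_le:
  assumes "0 < g" "0 \<le> k"
  shows "(PE k g u)\<^sup>2 \<le> PE (2 * k) g u"
  using post_square_le[OF assms(1) egrow_exp[OF assms(2)], of u]
  by (simp add: exp_double[symmetric] mult.assoc)

lemma mom_has_derivative:
  assumes g: "0 < g" and \<phi>: "egrow \<phi>" and \<psi>: "egrow \<psi>"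
    and d: "\<And>z. (\<phi> has_derivative \<phi>' z) (at z)"
    and b: "\<And>z h. \<bar>\<phi>' z h\<bar> \<le> \<psi> z * norm h"
    and m: "\<And>h. (\<lambda>z. \<phi>' z h) \<in> borel_measurable borel"
  shows "(mom p \<phi> g has_derivative (\<lambda>h. mom p (\<lambda>z. \<phi>' z h - g * ((z \<bullet> h) * \<phi> z)) g u)) (at u)"
proof -
  \<comment> \<open>The first summand bounds the derivative of the test function, the second that of
    the kernel. As \<eta> grows at most exponentially, \<eta> times the kernel is bounded, so a
    constant multiple of \<open>p\<close> dominates the derivative for all \<open>u\<close> at
    once.\<close>
  define \<eta> where "\<eta> z = \<bar>\<psi> z\<bar> + g * norm z * \<bar>\<phi> z\<bar>" for z
  have [measurable]: "\<phi> \<in> borel_measurable borel" "\<psi> \<in> borel_measurable borel"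
    using \<phi> \<psi> by (auto dest: egrow_measurable)
  have abs: "egrow (\<lambda>z. \<bar>f z\<bar>)" if "egrow f" for f :: "real^'n \<Rightarrow> real"
    using that egrow_measurable[OF that] unfolding egrow_def by auto
  have \<eta>: "egrow \<eta>"
    unfolding \<eta>_def using \<phi> \<psi> by (intro egrow_intros abs)
  obtain C k where C: "0 \<le> C" "0 \<le> k" "\<And>z. \<bar>\<eta> z\<bar> \<le> C * exp (k * norm z)" using \<eta> by (rule egrowE) blast
  obtain B where B: "0 \<le> B" "\<And>z :: real^'n. exp (k * norm z) * kern g z \<le> B"
    using exp_kern_bounded[OF g, of g k, where 'n = 'n] by auto
  have bound: "\<bar>(\<phi>' z h - g * ((z \<bullet> h) * \<phi> z)) * kern g z\<bar> \<le> C * B * norm h" for z h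
  proof -
    have "\<bar>\<phi>' z h - g * ((z \<bullet> h) * \<phi> z)\<bar> \<le> \<psi> z * norm h + g * ((norm z * norm h) * \<bar>\<phi> z\<bar>)"
    proof -
      have "\<bar>z \<bullet> h\<bar> * \<bar>\<phi> z\<bar> \<le> (norm z * norm h) * \<bar>\<phi> z\<bar>"
        using Cauchy_Schwarz_ineq2[of z h] by (rule mult_right_mono) simp
      then have "\<bar>g * ((z \<bullet> h) * \<phi> z)\<bar> \<le> g * ((norm z * norm h) * \<bar>\<phi> z\<bar>)"
        using g by (simp only: abs_mult) simp
      then show ?thesis
        using b[of z h] by (intro order_trans[OF abs_triangle_ineq4] add_mono)
    qed
    also have "\<dots> \<le> \<eta> z * norm h"
      by (simp add: \<eta>_def algebra_simps mult_left_mono)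
    also have "\<dots> \<le> (C * exp (k * norm z)) * norm h"
      using C(3)[of z] by (intro mult_right_mono) auto
    finally have "\<bar>(\<phi>' z h - g * ((z \<bullet> h) * \<phi> z)) * kern g z\<bar> \<le> (C * exp (k * norm z)) * norm h * kern g z"
      by (simp add: abs_mult kern_nonneg mult_right_mono)
    also have "\<dots> = C * norm h * (exp (k * norm z) * kern g z)" by simp
    also have "\<dots> \<le> C * norm h * B" using B(2)[of z] C(1) by (intro mult_left_mono) auto
    finally show ?thesis by (simp add: mult_ac)
  qed
  have eq: "mom p \<phi> g = (\<lambda>y. (LBINT x. p x * (\<phi> (y - x) * kern g (y - x))))"
    by (simp add: mom_def fun_eq_iff)
  show ?thesis
    unfolding eq unfolding mom_def
  proof (rule has_derivative_integral_dominated[where r = 1 and g = "\<lambda>x. p x * (C * B)"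
      and F' = "\<lambda>y x h. p x * ((\<phi>' (y - x) h - g * (((y - x) \<bullet> h) * \<phi> (y - x))) * kern g (y - x))"])
    fix y x :: "real^'n"
    have s: "((\<lambda>y. y - x) has_derivative (\<lambda>h. h)) (at y)"
      by (auto intro!: derivative_eq_intros)
    show "((\<lambda>y. p x * (\<phi> (y - x) * kern g (y - x))) has_derivative
      (\<lambda>h. p x * ((\<phi>' (y - x) h - g * (((y - x) \<bullet> h) * \<phi> (y - x))) * kern g (y - x)))) (at y)"
      by (rule derivative_eq_intros has_derivative_compose[OF s d] has_derivative_compose[OF s kern_has_derivative] refl
        | simp add: algebra_simps fun_eq_iff)+
    show "\<bar>p x * ((\<phi>' (y - x) h - g * (((y - x) \<bullet> h) * \<phi> (y - x))) * kern g (y - x))\<bar> \<le> p x * (C * B) * norm h" for h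
      using bound[of "y - x" h] p_pos[of x] by (simp add: abs_mult[of "p x"] mult.assoc mult_left_mono)
    show "0 \<le> p x * (C * B)" using p_pos[of x] B C by simp
    show "integrable lborel (\<lambda>x. p x * (\<phi> (y - x) * kern g (y - x)))"
      using g \<phi> by (rule mom_integrable)
  next
    show "(\<lambda>x. p x * ((\<phi>' (u - x) h - g * (((u - x) \<bullet> h) * \<phi> (u - x))) * kern g (u - x))) \<in> borel_measurable lborel" for h
      using m[of h] by measurable
  qed (use p_int in auto)
qed

lemma mom_has_real_derivative:
  assumes g: "0 < g" and \<phi>: "egrow \<phi>"
  shows "((\<lambda>g. mom p \<phi> g u) has_real_derivative
    mom p (\<lambda>z. real CARD('n) / (2 * g) * \<phi> z - (1 / 2) * (\<phi> z * (norm z)\<^sup>2)) g u) (at g)"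
proof -
  \<comment> \<open>The ball of radius \<open>g / 2\<close> keeps the precision away from 0;
    \<open>c\<close> is the value of the coefficient \<open>real CARD('n) / (2 * g')\<close> at the
    left end \<open>g' = g / 2\<close>.\<close>
  define c where "c = real CARD('n) / g"
  have [measurable]: "\<phi> \<in> borel_measurable borel"
    using \<phi> by (auto dest: egrow_measurable)
  have \<eta>: "egrow (\<lambda>z. \<phi> z * (c + (norm z)\<^sup>2 / 2))"
    unfolding divide_inverse using \<phi> by (intro egrow_intros)
  obtain C k where C: "0 \<le> C" "0 \<le> k" "\<And>z. \<bar>\<phi> z * (c + (norm z)\<^sup>2 / 2)\<bar> \<le> C * exp (k * norm z)" using \<eta> by (rule egrowE) blast
  obtain B where B: "0 \<le> B" "\<And>g' z. g' \<in> {g/2..2*g} \<Longrightarrow> exp (k * norm (z :: real^'n)) * kern g' z \<le> B"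
    using exp_kern_bounded[of "g / 2" "2 * g" k, where 'n = 'n] g by auto
  let ?D = "\<lambda>g' z. real CARD('n) / (2 * g') * \<phi> z - (1 / 2) * (\<phi> z * (norm z)\<^sup>2)"
  have bound: "\<bar>?D g' z * kern g' z\<bar> \<le> C * B" if "g' \<in> ball g (g / 2)" for g' z
  proof -
    have g': "g / 2 < g'" "g' < 2 * g" using that g by (auto simp: dist_real_def abs_if split: if_splits)
    then have "real CARD('n) / (2 * g') \<le> c" "0 < g'" using g unfolding c_def by (auto intro!: frac_le)
    have "?D g' z = \<phi> z * (real CARD('n) / (2 * g') - (norm z)\<^sup>2 / 2)" by (simp add: algebra_simps)
    moreover have "\<bar>real CARD('n) / (2 * g') - (norm z)\<^sup>2 / 2\<bar> \<le> \<bar>c + (norm z)\<^sup>2 / 2\<bar>"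
      using \<open>real CARD('n) / (2 * g') \<le> c\<close> \<open>0 < g'\<close> divide_nonneg_pos[of "real CARD('n)" "2 * g'"] zero_le_power2[of "norm z"]
      by linarith
    ultimately have "\<bar>?D g' z\<bar> \<le> \<bar>\<phi> z\<bar> * \<bar>c + (norm z)\<^sup>2 / 2\<bar>"
      by (simp add: abs_mult mult_left_mono)
    also have "\<dots> \<le> C * exp (k * norm z)" using C(3)[of z] by (simp add: abs_mult)
    finally have "\<bar>?D g' z * kern g' z\<bar> \<le> C * exp (k * norm z) * kern g' z"
      by (simp add: abs_mult kern_nonneg mult_right_mono)
    also have "\<dots> \<le> C * B" using B(2)[of g' z] g' C(1) by (simp add: mult.assoc mult_left_mono)
    finally show ?thesis .
  qed
  have "((\<lambda>g. mom p \<phi> g u) has_derivative (\<lambda>h. (LBINT x. p x * (h * (?D g (u - x) * kern g (u - x)))))) (at g)"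
    unfolding mom_def
  proof (rule has_derivative_integral_dominated[where r = "g / 2" and g = "\<lambda>x. p x * (C * B)"
      and F' = "\<lambda>g x h. p x * (h * (?D g (u - x) * kern g (u - x)))"])
    fix g' x assume "g' \<in> ball g (g / 2)"
    then have g': "0 < g'" using g by (auto simp: dist_real_def abs_if split: if_splits)
    have "((\<lambda>y. p x * (\<phi> (u - x) * kern y (u - x))) has_real_derivative p x * (?D g' (u - x) * kern g' (u - x))) (at g')"
      using kern_has_real_derivative[OF g', of "u - x"]
      by (auto intro!: derivative_eq_intros simp: algebra_simps)
    then show "((\<lambda>y. p x * (\<phi> (u - x) * kern y (u - x))) has_derivative
      (\<lambda>h. p x * (h * (?D g' (u - x) * kern g' (u - x))))) (at g')"
      unfolding has_field_derivative_def by (rule has_derivative_eq_rhs) (simp add: fun_eq_iff mult_ac)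
    show "\<bar>p x * (h * (?D g' (u - x) * kern g' (u - x)))\<bar> \<le> p x * (C * B) * norm h" for h
    proof -
      have "\<bar>p x * (h * (?D g' (u - x) * kern g' (u - x)))\<bar> = p x * \<bar>h\<bar> * \<bar>?D g' (u - x) * kern g' (u - x)\<bar>"
        using p_pos[of x] by (simp add: abs_mult)
      also have "\<dots> \<le> p x * \<bar>h\<bar> * (C * B)"
        using bound[OF \<open>g' \<in> ball g (g / 2)\<close>] p_pos[of x] by (intro mult_left_mono) auto
      finally show ?thesis by (simp add: mult_ac)
    qed
    show "integrable lborel (\<lambda>x. p x * (\<phi> (u - x) * kern g' (u - x)))"
      using g' \<phi> by (rule mom_integrable)
  next
    show "0 \<le> p x * (C * B)" for x using p_pos[of x] B C by simp
    show "(\<lambda>x. p x * (h * (?D g (u - x) * kern g (u - x)))) \<in> borel_measurable lborel" for h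
      by measurable
  qed (use p_int g in auto)
  moreover have "(LBINT x. p x * (h * (?D g (u - x) * kern g (u - x)))) = mom p (?D g) g u * h" for h
    unfolding mom_def by (subst integral_mult_left_zero[symmetric]) (simp add: mult_ac)
  ultimately show ?thesis
    unfolding has_field_derivative_def by simp
qed

text \<open>First-order Tweedie formula: after division by \<open>q\<close>, the score is
  \<open>- g\<close> times the posterior mean of the noise. This is the origin of
  \<open>dscore\<close>.\<close>

lemma q_has_derivative:
  assumes "0 < g"
  shows "(q g has_derivative (\<lambda>h. - g * (q g u * P1 h g u))) (at u)"
proof -
  have "(q g has_derivative (\<lambda>h. mom p (\<lambda>z. 0 - g * ((z \<bullet> h) * 1)) g u)) (at u)"
    by (rule mom_has_derivative[where \<psi> = "\<lambda>_. 0"]) (auto intro!: egrow_intros assms)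
  moreover have "mom p (\<lambda>z. 0 - g * ((z \<bullet> h) * 1)) g u = - g * (q g u * P1 h g u)" for h
    using mom_cmult[of "-g" "\<lambda>z. z \<bullet> h" g u] mom_eq_post[OF assms, of "\<lambda>z. z \<bullet> h" u] by simp
  ultimately show ?thesis by simp
qed

lemma q_has_real_derivative:
  assumes "0 < g"
  shows "((\<lambda>g. q g u) has_real_derivative q g u * (real CARD('n) / (2 * g) - P (\<lambda>z. (norm z)\<^sup>2) g u / 2)) (at g)"
proof -
  have "mom p (\<lambda>z. real CARD('n) / (2 * g) * 1 - 1 / 2 * (1 * (norm z)\<^sup>2)) g u
    = q g u * (P (\<lambda>z. real CARD('n) / (2 * g)) g u - P (\<lambda>z. 1 / 2 * (norm z)\<^sup>2) g u)"
    unfolding mom_eq_post[OF assms, of "\<lambda>z. _ - _ z"] mult_1_right mult_1_left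
    by (subst post_diff) (intro assms egrow_intros refl)+
  also have "\<dots> = q g u * (real CARD('n) / (2 * g) - P (\<lambda>z. (norm z)\<^sup>2) g u / 2)"
    using assms by (simp only: post_const post_cmult) simp
  finally show ?thesis
    using mom_has_real_derivative[OF assms egrow_const[of 1], of u] by simp
qed

text \<open>The quotient rule produces a covariance: besides the mean of the derivative there is
  \<open>- g\<close> times the posterior covariance of the test function with
  \<open>z \<bullet> h\<close>. Hence posterior moments are closed under differentiation up to
  products.\<close>

lemma post_has_derivative:
  assumes g: "0 < g" and \<phi>: "egrow \<phi>" and \<psi>: "egrow \<psi>"
    and d: "\<And>z. (\<phi> has_derivative \<phi>' z) (at z)"
    and b: "\<And>z h. \<bar>\<phi>' z h\<bar> \<le> \<psi> z * norm h"
    and m: "\<And>h. egrow (\<lambda>z. \<phi>' z h)"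
  shows "(P \<phi> g has_derivative (\<lambda>h. P (\<lambda>z. \<phi>' z h) g u - g * P (\<lambda>z. (z \<bullet> h) * \<phi> z) g u
    + g * (P \<phi> g u * P1 h g u))) (at u)"
proof -
  have "mom p (\<lambda>z. \<phi>' z h - g * ((z \<bullet> h) * \<phi> z)) g u
      = q g u * (P (\<lambda>z. \<phi>' z h) g u - g * P (\<lambda>z. (z \<bullet> h) * \<phi> z) g u)" for h
    using g m \<phi> by (subst mom_eq_post) (auto simp: post_diff post_cmult egrow_intros)
  with mom_has_derivative[OF g \<phi> \<psi> d b egrow_measurable[OF m], of u]
  have 1: "(mom p \<phi> g has_derivative (\<lambda>h. q g u * (P (\<lambda>z. \<phi>' z h) g u - g * P (\<lambda>z. (z \<bullet> h) * \<phi> z) g u))) (at u)"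
    by simp
  have q: "q g u \<noteq> 0" using q_pos[OF g, of u] by simp
  have eq: "P \<phi> g = (\<lambda>u. mom p \<phi> g u / q g u)" by (simp add: post_def fun_eq_iff)
  have "((\<lambda>u. mom p \<phi> g u / q g u) has_derivative (\<lambda>h. P (\<lambda>z. \<phi>' z h) g u - g * P (\<lambda>z. (z \<bullet> h) * \<phi> z) g u
    + g * (P \<phi> g u * P1 h g u))) (at u)"
    by (rule has_derivative_eq_rhs[OF has_derivative_divide'[OF 1 q_has_derivative[OF g] q]])
      (use q g in \<open>simp add: fun_eq_iff mom_eq_post[of g \<phi>] field_simps power2_eq_square\<close>)
  then show ?thesis unfolding eq[symmetric] .
qed

text \<open>Minus half the posterior covariance of the test function with
  \<open>(norm z)\<^sup>2\<close>. The term \<open>real CARD('n) / (2 * g)\<close> from the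
  normalisation of the kernel cancels in the quotient.\<close>

lemma post_has_real_derivative:
  assumes g: "0 < g" and \<phi>: "egrow \<phi>"
  shows "((\<lambda>g. P \<phi> g u) has_real_derivative
    (P \<phi> g u * P (\<lambda>z. (norm z)\<^sup>2) g u - P (\<lambda>z. \<phi> z * (norm z)\<^sup>2) g u) / 2) (at g)"
proof -
  have "mom p (\<lambda>z. real CARD('n) / (2 * g) * \<phi> z - 1 / 2 * (\<phi> z * (norm z)\<^sup>2)) g u
    = q g u * (P (\<lambda>z. real CARD('n) / (2 * g) * \<phi> z) g u - P (\<lambda>z. 1 / 2 * (\<phi> z * (norm z)\<^sup>2)) g u)"
    unfolding mom_eq_post[OF g, of "\<lambda>z. _ z - _ z"]
    by (subst post_diff) (intro g \<phi> egrow_intros refl)+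
  also have "\<dots> = q g u * (real CARD('n) / (2 * g) * P \<phi> g u - P (\<lambda>z. \<phi> z * (norm z)\<^sup>2) g u / 2)"
    by (simp only: post_cmult) simp
  finally have 1: "((\<lambda>g. mom p \<phi> g u) has_real_derivative
      q g u * (real CARD('n) / (2 * g) * P \<phi> g u - P (\<lambda>z. \<phi> z * (norm z)\<^sup>2) g u / 2)) (at g)"
    using mom_has_real_derivative[OF assms, of u] by simp
  have q: "q g u \<noteq> 0" using q_pos[OF g, of u] by simp
  show ?thesis
    unfolding post_def[of p \<phi>]
    by (rule DERIV_cong[OF DERIV_divide[OF 1 q_has_real_derivative[OF g] q]])
      (use q g in \<open>simp add: mom_eq_post[of g \<phi>] field_simps power2_eq_square\<close>)
qed

end


section \<open>Integrability of polynomials in posterior moments against \<open>q\<close>\<close>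

lemma convolution_integrable:
  fixes f h :: "'a::euclidean_space \<Rightarrow> real"
  assumes f: "integrable lborel f" and h: "integrable lborel h"
  shows "integrable lborel (\<lambda>u. (LBINT x. f x * h (u - x)))"
    and "(LBINT u. (LBINT x. f x * h (u - x))) = integral\<^sup>L lborel f * integral\<^sup>L lborel h"
proof -
  have [measurable]: "f \<in> borel_measurable borel" "h \<in> borel_measurable borel"
    using f h by (auto dest: borel_measurable_integrable)
  have t: "integrable lborel (\<lambda>u. h (u - x))" "(LBINT u. h (u - x)) = integral\<^sup>L lborel h"
      "(LBINT u. \<bar>h (u - x)\<bar>) = (LBINT u. \<bar>h u\<bar>)" for x
    using h integrable_translate_iff[of h "-x"] integral_translate[of h "-x"] integral_translate[of "\<lambda>u. \<bar>h u\<bar>" "-x"]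
    by simp_all
  have i: "integrable (lborel \<Otimes>\<^sub>M lborel) (\<lambda>(x, u). f x * h (u - x))"
  proof (rule lborel_pair.Fubini_integrable)
    show "integrable lborel (\<lambda>x. (LBINT u. norm (case (x, u) of (x, u) \<Rightarrow> f x * h (u - x))))"
      using f by (simp add: abs_mult t)
    show "AE x in lborel. integrable lborel (\<lambda>u. case (x, u) of (x, u) \<Rightarrow> f x * h (u - x))"
      using t by simp
  qed measurable
  show "integrable lborel (\<lambda>u. (LBINT x. f x * h (u - x)))"
    using lborel_pair.integrable_snd[OF i] by simp
  show "(LBINT u. (LBINT x. f x * h (u - x))) = integral\<^sup>L lborel f * integral\<^sup>L lborel h"
    using lborel_pair.Fubini_integral[OF i] by (simp add: t)
qed

text \<open>Cauchy-Schwarz bounds the square of the posterior mean of \<open>exp (k \<parallel>z\<parallel>)\<close> by that of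
  \<open>exp (2 k \<parallel>z\<parallel>)\<close>. This makes the following class closed under products, so it contains all polynomials in posterior
  moments, and every member is integrable against \<open>q\<close> uniformly for \<open>g\<close> in \<open>[a, b]\<close>.\<close>

definition good :: "(real^'n \<Rightarrow> real) \<Rightarrow> real \<Rightarrow> real \<Rightarrow> (real \<Rightarrow> real^'n \<Rightarrow> real) \<Rightarrow> bool" where
  "good p a b f \<longleftrightarrow> (\<lambda>(g, u). f g u) \<in> borel_measurable (borel \<Otimes>\<^sub>M borel) \<and>
    (\<exists>C\<ge>0. \<exists>k\<ge>0. \<forall>g\<in>{a..b}. \<forall>u. \<bar>f g u\<bar> \<le> C * post p (\<lambda>z. exp (k * norm z)) g u)"

lemma goodE:
  assumes "good p a b f"
  obtains C k where "0 \<le> C" "0 \<le> k"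
    "\<And>g u. g \<in> {a..b} \<Longrightarrow> \<bar>f g u\<bar> \<le> C * post p (\<lambda>z. exp (k * norm z)) g u"
  using assms unfolding good_def by blast

lemma good_measurable: "good p a b f \<Longrightarrow> (\<lambda>(g, u). f g u) \<in> borel_measurable (borel \<Otimes>\<^sub>M borel)"
  by (simp add: good_def)

lemma good_measurable':
  assumes "good p a b f" and [measurable]: "s \<in> borel_measurable M" "h \<in> borel_measurable M"
  shows "(\<lambda>x. f (s x) (h x)) \<in> borel_measurable M"
  using measurable_compose[OF measurable_Pair[OF assms(2,3)] good_measurable[OF assms(1)]] by simp

named_theorems good_intros

context pos_density
begin

lemma goodI:
  assumes "(\<lambda>(g, u). f g u) \<in> borel_measurable (borel \<Otimes>\<^sub>M borel)" "0 \<le> C" "0 \<le> k"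
    "\<And>g u. g \<in> {a..b} \<Longrightarrow> \<bar>f g u\<bar> \<le> C * PE k g u"
  shows "good p a b f"
  using assms unfolding good_def by blast

lemma good_post [good_intros]:
  assumes "0 < a" "egrow \<phi>"
  shows "good p a b (P \<phi>)"
proof -
  obtain C k where C: "0 \<le> C" "0 \<le> k" "\<And>z. \<bar>\<phi> z\<bar> \<le> C * exp (k * norm z)" using assms(2) by (rule egrowE) blast
  note [measurable] = egrow_measurable[OF assms(2)]
  show ?thesis
  proof (rule goodI[OF _ C(1,2)])
    fix g u assume "g \<in> {a..b}"
    then have "0 < g" using assms(1) by simp
    then have "\<bar>P \<phi> g u\<bar> \<le> P (\<lambda>z. C * exp (k * norm z)) g u"
      using assms C by (intro post_abs_le egrow_intros) auto
    then show "\<bar>P \<phi> g u\<bar> \<le> C * PE k g u"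
      by (simp add: post_cmult)
  qed measurable
qed

lemma good_coeff [good_intros]:
  assumes "0 < a" "continuous_on {a..b} c" and [measurable]: "c \<in> borel_measurable borel"
  shows "good p a b (\<lambda>g u. c g)"
proof -
  obtain B where B: "\<And>g. g \<in> {a..b} \<Longrightarrow> \<bar>c g\<bar> \<le> B"
    using compact_continuous_image[OF assms(2) compact_Icc, THEN compact_imp_bounded]
    unfolding bounded_iff by (auto simp del: atLeastAtMost_iff)
  show ?thesis
  \<comment> \<open>With \<open>k = 0\<close> the posterior mean of the exponential is 1, so a
    bounded coefficient fits the format.\<close>
  proof (rule goodI[where C = "\<bar>B\<bar>" and k = 0])
    fix g u assume g: "g \<in> {a..b}"
    then have "P (\<lambda>z. exp (0 * norm z)) g u = 1"
      using assms(1) by (simp add: post_const)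
    then show "\<bar>c g\<bar> \<le> \<bar>B\<bar> * P (\<lambda>z. exp (0 * norm z)) g u"
      using B[OF g] by simp
  qed auto
qed

lemma good_add [good_intros]:
  assumes "0 < a" "good p a b f" "good p a b h"
  shows "good p a b (\<lambda>g u. f g u + h g u)"
proof -
  obtain C k where C: "0 \<le> C" "0 \<le> k" "\<And>g u. g \<in> {a..b} \<Longrightarrow> \<bar>f g u\<bar> \<le> C * PE k g u"
    using assms(2) by (rule goodE) blast
  obtain D l where D: "0 \<le> D" "0 \<le> l" "\<And>g u. g \<in> {a..b} \<Longrightarrow> \<bar>h g u\<bar> \<le> D * PE l g u"
    using assms(3) by (rule goodE) blast
  show ?thesis
  proof (rule goodI[where C = "C + D" and k = "max k l"])
    fix g u assume g: "g \<in> {a..b}"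
    have "PE k g u \<le> PE (max k l) g u"
      "PE l g u \<le> PE (max k l) g u"
      using g assms(1) C D by (auto intro!: post_mono egrow_intros mult_right_mono)
    then have "C * PE k g u \<le> C * PE (max k l) g u"
      "D * PE l g u \<le> D * PE (max k l) g u"
      using C D by (auto intro: mult_left_mono)
    then show "\<bar>f g u + h g u\<bar> \<le> (C + D) * PE (max k l) g u"
      using C(3)[OF g, of u] D(3)[OF g, of u] by (simp add: distrib_right)
  qed (use C D good_measurable[OF assms(2)] good_measurable[OF assms(3)] in \<open>auto simp: case_prod_beta\<close>)
qed

lemma good_mult [good_intros]:
  assumes "0 < a" "good p a b f" "good p a b h"
  shows "good p a b (\<lambda>g u. f g u * h g u)"
proof -
  obtain C k where C: "0 \<le> C" "0 \<le> k" "\<And>g u. g \<in> {a..b} \<Longrightarrow> \<bar>f g u\<bar> \<le> C * PE k g u"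
    using assms(2) by (rule goodE) blast
  obtain D l where D: "0 \<le> D" "0 \<le> l" "\<And>g u. g \<in> {a..b} \<Longrightarrow> \<bar>h g u\<bar> \<le> D * PE l g u"
    using assms(3) by (rule goodE) blast
  show ?thesis
  proof (rule goodI[where C = "C * D" and k = "2 * max k l"])
    fix g u assume g: "g \<in> {a..b}"
    let ?E = "PE (max k l) g u"
    have "PE k g u \<le> ?E" "PE l g u \<le> ?E"
      using g assms(1) C D by (auto intro!: post_mono egrow_intros mult_right_mono)
    then have "C * PE k g u \<le> C * ?E" "D * PE l g u \<le> D * ?E"
      using C D by (auto intro: mult_left_mono)
    then have "\<bar>f g u\<bar> * \<bar>h g u\<bar> \<le> (C * ?E) * (D * ?E)"
      using C(3)[OF g, of u] D(3)[OF g, of u] by (intro mult_mono) auto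
    also have "\<dots> = C * D * ?E\<^sup>2" by (simp add: power2_eq_square)
    also have "\<dots> \<le> C * D * PE (2 * max k l) g u"
      using C D g assms(1) by (intro mult_left_mono post_exp_square_le) auto
    finally show "\<bar>f g u * h g u\<bar> \<le> C * D * PE (2 * max k l) g u"
      by (simp add: abs_mult)
  qed (use C D good_measurable[OF assms(2)] good_measurable[OF assms(3)] in \<open>auto simp: case_prod_beta\<close>)
qed

lemma good_minus [good_intros]: "0 < a \<Longrightarrow> good p a b f \<Longrightarrow> good p a b (\<lambda>g u. - f g u)"
  using good_mult[OF _ good_coeff[of a b "\<lambda>_. -1"], of f] by simp

lemma good_diff [good_intros]: "0 < a \<Longrightarrow> good p a b f \<Longrightarrow> good p a b h \<Longrightarrow> good p a b (\<lambda>g u. f g u - h g u)"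
  using good_add[OF _ _ good_minus, of a b f h] by simp

lemma good_power [good_intros]: "0 < a \<Longrightarrow> good p a b f \<Longrightarrow> good p a b (\<lambda>g u. f g u ^ n)"
  by (induction n) (auto intro: good_intros)

lemma good_sum [good_intros]: "finite I \<Longrightarrow> 0 < a \<Longrightarrow> (\<And>i. i \<in> I \<Longrightarrow> good p a b (f i)) \<Longrightarrow> good p a b (\<lambda>g u. \<Sum>i\<in>I. f i g u)"
  by (induction I rule: finite_induct) (auto intro: good_intros)

text \<open>Integrating over \<open>u\<close> removes the posterior: the unconditional law of the
  noise is Gaussian whatever \<open>p\<close> is. All integral bounds for \<open>good\<close>
  functions therefore reduce to Gaussian integrals.\<close>

lemma mom_integral:
  assumes "0 < g" "integrable lborel (\<lambda>z. \<phi> z * kern g z)"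
  shows "integrable lborel (mom p \<phi> g)" "integral\<^sup>L lborel (mom p \<phi> g) = (LBINT z. \<phi> z * kern g z)"
  using convolution_integrable(1,2)[OF p_int assms(2)] by (simp_all add: mom_def[abs_def] p_mass)

lemma good_integrable_slice:
  assumes "0 < a" "good p a b f" "g \<in> {a..b}"
  shows "integrable lborel (\<lambda>u. q g u * f g u)"
    and "\<exists>C. \<forall>g\<in>{a..b}. (LBINT u. \<bar>q g u * f g u\<bar>) \<le> C"
proof -
  obtain C k where C: "0 \<le> C" "0 \<le> k" "\<And>g u. g \<in> {a..b} \<Longrightarrow> \<bar>f g u\<bar> \<le> C * PE k g u"
    using assms(2) by (rule goodE) blast
  have b: "\<bar>q g u * f g u\<bar> \<le> C * mom p (\<lambda>z. exp (k * norm z)) g u" if "g \<in> {a..b}" for g u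
  proof -
    have g: "0 < g" using assms(1) that by simp
    have "\<bar>q g u * f g u\<bar> \<le> q g u * (C * PE k g u)"
      using q_pos[OF g, of u] C(3)[OF that, of u] by (simp add: abs_mult)
    also have "\<dots> = C * mom p (\<lambda>z. exp (k * norm z)) g u"
      by (simp add: mom_eq_post[OF g, of "\<lambda>z. exp (k * norm z)"])
    finally show ?thesis .
  qed
  have i: "integrable lborel (\<lambda>u. C * mom p (\<lambda>z. exp (k * norm z)) g u)" if "g \<in> {a..b}" for g
    using assms(1) that by (intro integrable_mult_right mom_integral exp_kern_integrable) auto
  have j: "integrable lborel (\<lambda>u. q g u * f g u)" if "g \<in> {a..b}" for g
    using i[OF that]
  proof (rule Bochner_Integration.integrable_bound)
    show "(\<lambda>u. q g u * f g u) \<in> borel_measurable lborel"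
      by (intro borel_measurable_times good_measurable'[OF assms(2)]) measurable
    show "AE u in lborel. norm (q g u * f g u) \<le> norm (C * mom p (\<lambda>z. exp (k * norm z)) g u)"
      using b[OF that] by (intro AE_I2) (auto intro: order_trans[OF _ abs_ge_self])
  qed
  show "integrable lborel (\<lambda>u. q g u * f g u)" using j[OF assms(3)] .
  show "\<exists>C. \<forall>g\<in>{a..b}. (LBINT u. \<bar>q g u * f g u\<bar>) \<le> C"
  proof (intro exI ballI)
    fix g assume g: "g \<in> {a..b}"
    have "(LBINT u. \<bar>q g u * f g u\<bar>) \<le> (LBINT u. C * mom p (\<lambda>z. exp (k * norm z)) g u)"
      using j[OF g] i[OF g] b[OF g] by (intro integral_mono) auto
    also have "\<dots> = C * (\<integral>z. exp (k * norm z) * kern g z \<partial>(lborel :: (real^'n) measure))"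
      using assms(1) g by (simp add: mom_integral exp_kern_integrable)
    also have "\<dots> \<le> C * (exp (k\<^sup>2 / a) * 2 powr (real CARD('n) / 2))"
      using assms(1) g C(1) by (intro mult_left_mono exp_kern_integral_le) auto
    finally show "(LBINT u. \<bar>q g u * f g u\<bar>) \<le> C * (exp (k\<^sup>2 / a) * 2 powr (real CARD('n) / 2))" .
  qed
qed

lemma good_integrable:
  assumes "0 < g" "good p g g f"
  shows "integrable lborel (\<lambda>u. q g u * f g u)"
  using good_integrable_slice(1)[OF assms] by simp

lemma good_integrable_joint:
  assumes "0 < a" "good p a b f"
  shows "integrable (lborel \<Otimes>\<^sub>M lborel) (\<lambda>(g, u). indicator {a..b} g * (q g u * f g u))"
proof (cases "a \<le> b")
  case True
  obtain C where C: "\<And>g. g \<in> {a..b} \<Longrightarrow> (LBINT u. \<bar>q g u * f g u\<bar>) \<le> C"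
    using good_integrable_slice(2)[OF assms, of a] True by fastforce
  have m: "(\<lambda>(g, u). q g u * f g u) \<in> borel_measurable (borel \<Otimes>\<^sub>M borel)"
    unfolding case_prod_beta by (intro borel_measurable_times good_measurable'[OF assms(2)]) measurable
  then have m': "(\<lambda>(g, u). indicator {a..b} g * (q g u * f g u)) \<in> borel_measurable (lborel \<Otimes>\<^sub>M lborel)"
    unfolding case_prod_beta by measurable
  show ?thesis
  proof (rule lborel_pair.Fubini_integrable[OF m'])
    show "integrable lborel (\<lambda>g. (LBINT u. norm (case (g, u) of (g, u) \<Rightarrow> indicator {a..b} g * (q g u * f g u))))"
    proof (rule Bochner_Integration.integrable_bound)
      show "integrable lborel (\<lambda>g. indicator {a..b} g * \<bar>C\<bar> :: real)"
        using True by (intro integrable_mult_left integrable_real_indicator) auto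
      show "(\<lambda>g. (LBINT u. norm (case (g, u) of (g, u) \<Rightarrow> indicator {a..b} g * (q g u * f g u)))) \<in> borel_measurable lborel"
        using m' by (intro lborel.borel_measurable_lebesgue_integral) (simp add: case_prod_beta)
      show "AE g in lborel. norm (LBINT u. norm (case (g, u) of (g, u) \<Rightarrow> indicator {a..b} g * (q g u * f g u)))
          \<le> norm (indicator {a..b} g * \<bar>C\<bar>)"
      proof (rule AE_I2)
        fix g
        show "norm (LBINT u. norm (case (g, u) of (g, u) \<Rightarrow> indicator {a..b} g * (q g u * f g u)))
          \<le> norm (indicator {a..b} g * \<bar>C\<bar>)"
          using C[of g] by (cases "g \<in> {a..b}") (simp_all add: indicator_def order_trans[OF _ abs_ge_self])
      qed
    qed
    show "AE g in lborel. integrable lborel (\<lambda>u. case (g, u) of (g, u) \<Rightarrow> indicator {a..b} g * (q g u * f g u))"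
    proof (rule AE_I2)
      fix g show "integrable lborel (\<lambda>u. case (g, u) of (g, u) \<Rightarrow> indicator {a..b} g * (q g u * f g u))"
        using good_integrable_slice(1)[OF assms, of g] by (cases "g \<in> {a..b}") auto
    qed
  qed
next
  case False
  then have "(\<lambda>(g, u). indicator {a..b} g * (q g u * f g u)) = (\<lambda>_. 0)" by auto
  then show ?thesis by simp
qed

text \<open>Take a ball of radius \<open>R\<close> that carries more than half of the mass of
  \<open>p\<close>: each of its points is at distance at most \<open>norm u + R\<close> from
  \<open>u\<close>. The bound controls the denominator in posterior moments.\<close>

lemma q_lower_bound:
  assumes "0 < g"
  shows "\<exists>R\<ge>0. \<forall>u. q g u \<ge> (g / (2 * pi)) powr (real CARD('n) / 2) * exp (- (g * (norm u + R)\<^sup>2 / 2)) / 2"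
proof -
  let ?c = "(g / (2 * pi)) powr (real CARD('n) / 2)"
  have "(\<lambda>n. (LBINT x. indicator (cball 0 (real n)) x * p x)) \<longlonglongrightarrow> (LBINT x. p x)"
  proof (rule integral_dominated_convergence[where w = p])
    show "AE x in lborel. (\<lambda>n. indicator (cball 0 (real n)) x * p x) \<longlonglongrightarrow> p x"
    proof (rule AE_I2)
      fix x :: "real^'n"
      have "eventually (\<lambda>n. indicator (cball 0 (real n)) x * p x = p x) sequentially"
        using eventually_ge_at_top[of "nat \<lceil>norm x\<rceil>"]
        by eventually_elim (simp add: nat_le_iff ceiling_le_iff)
      then show "(\<lambda>n. indicator (cball 0 (real n)) x * p x) \<longlonglongrightarrow> p x" by (rule tendsto_eventually)
    qed
    show "AE x in lborel. norm (indicator (cball 0 (real n)) x * p x) \<le> p x" for n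
      using p_pos by (intro AE_I2) (auto simp: indicator_def less_imp_le)
    show "(\<lambda>x. indicator (cball 0 (real n)) x * p x) \<in> borel_measurable lborel" for n
      by (intro borel_measurable_times borel_measurable_indicator) auto
  qed (use p_int in auto)
  then have "eventually (\<lambda>n. (LBINT x. indicator (cball 0 (real n)) x * p x) > 1/2) sequentially"
    using p_mass by (intro order_tendstoD(1)) auto
  then obtain n where n: "(LBINT x. indicator (cball 0 (real n)) x * p x) > 1/2"
    by (auto simp: eventually_sequentially)
  show ?thesis
  proof (intro exI conjI allI)
    fix u :: "real^'n"
    let ?L = "?c * exp (- (g * (norm u + real n)\<^sup>2 / 2))"
    have ip: "integrable lborel (\<lambda>x. indicator (cball 0 (real n)) x * p x)"
      using integrable_real_mult_indicator[of "cball 0 (real n)" lborel p] p_int by (simp add: mult.commute)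
    have "?L / 2 \<le> ?L * (LBINT x. indicator (cball 0 (real n)) x * p x)"
      using mult_left_mono[OF less_imp_le[OF n], of ?L] by simp
    also have "\<dots> = (LBINT x. ?L * (indicator (cball 0 (real n)) x * p x))" by simp
    also have "\<dots> \<le> (LBINT x. p x * (1 * kern g (u - x)))"
    proof (rule integral_mono)
      show "integrable lborel (\<lambda>x. p x * (1 * kern g (u - x)))"
        using assms by (intro mom_integrable egrow_intros)
      fix x
      show "?L * (indicator (cball 0 (real n)) x * p x) \<le> p x * (1 * kern g (u - x))"
      proof (cases "norm x \<le> real n")
        case True
        then have "(norm (u - x))\<^sup>2 \<le> (norm u + real n)\<^sup>2"
          using norm_triangle_ineq4[of u x] by (intro power_mono) auto
        then have "?L \<le> kern g (u - x)"
          using assms by (simp add: kern_def)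
        then show ?thesis using True p_pos[of x] by (simp add: indicator_def mult.commute)
      qed (use less_imp_le[OF p_pos[of x]] kern_nonneg[of g "u - x"] in \<open>simp add: indicator_def\<close>)
    qed (use ip in simp)
    finally show "?L / 2 \<le> q g u" by (simp add: mom_def)
  qed simp
qed

text \<open>Split the noise at \<open>norm z = L\<close>. Below, \<open>exp (k * norm z)\<close> is
  at most \<open>exp (k * L)\<close>, and \<open>L\<close> is affine in \<open>norm u\<close>.
  Above, the kernel is so small that the lower bound on \<open>q\<close> absorbs the whole
  contribution.\<close>

lemma good_growth:
  assumes g: "0 < g" and f: "good p g g f"
  shows "\<exists>C\<ge>0. \<exists>k\<ge>0. \<forall>u. \<bar>f g u\<bar> \<le> C * exp (k * norm u)"
proof -
  obtain D k where D: "0 \<le> D" "0 \<le> k" "\<And>u. \<bar>f g u\<bar> \<le> D * PE k g u"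
    using f by (rule goodE) auto
  obtain R where R: "0 \<le> R"
    "\<And>u. (g / (2 * pi)) powr (real CARD('n) / 2) * exp (- (g * (norm u + R)\<^sup>2 / 2)) / 2 \<le> q g u"
    using q_lower_bound[OF g] by blast
  let ?c = "(g / (2 * pi)) powr (real CARD('n) / 2)"
  have "PE k g u \<le> (exp (2 * k * R) + 2 * exp (k\<^sup>2 / g)) * exp (2 * k * norm u)" for u
  proof -
    \<comment> \<open>After absorbing the exponential, \<open>g * (norm z)\<^sup>2 / 4\<close> is
      left in the exponent. The factor 2 makes this at least \<open>g * (norm u + R)\<^sup>2\<close>
      for \<open>norm z > L\<close>, which beats the exponent
      \<open>g * (norm u + R)\<^sup>2 / 2\<close> in the lower bound for \<open>q\<close>.\<close>
    define L where "L = 2 * (norm u + R)"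
    let ?E = "?c * exp (k\<^sup>2 / g) * exp (- (g * (norm u + R)\<^sup>2))"
    have pt: "exp (k * norm z) * kern g z \<le> exp (k * L) * (1 * kern g z) + ?E" for z :: "real^'n"
    proof (cases "norm z \<le> L")
      case True
      then have "exp (k * norm z) * kern g z \<le> exp (k * L) * kern g z"
        using D(2) by (intro mult_right_mono kern_nonneg) (simp add: mult_left_mono)
      then show ?thesis by (simp add: add_increasing2)
    next
      case False
      have "0 \<le> (k / sqrt g - sqrt g * norm z / 2)\<^sup>2" by simp
      also have "\<dots> = k\<^sup>2 / g - k * norm z + g * (norm z)\<^sup>2 / 4"
        using g by (simp add: power2_diff power_divide power_mult_distrib)
      finally have 1: "k * norm z - g * (norm z)\<^sup>2 / 2 \<le> k\<^sup>2 / g - g * (norm z)\<^sup>2 / 4" by simp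
      have "L\<^sup>2 \<le> (norm z)\<^sup>2"
        using False R(1) by (intro power_mono) (auto simp: L_def)
      then have "g * (4 * (norm u + R)\<^sup>2) \<le> g * (norm z)\<^sup>2"
        using g by (intro mult_left_mono) (auto simp: L_def power_mult_distrib simp del: distrib_left_numeral)
      with 1 have 2: "k * norm z - g * (norm z)\<^sup>2 / 2 \<le> k\<^sup>2 / g - g * (norm u + R)\<^sup>2" by simp
      have "exp (k * norm z) * kern g z = ?c * exp (k * norm z - g * (norm z)\<^sup>2 / 2)"
        by (simp add: kern_def exp_add[symmetric] mult.left_commute)
      also have "\<dots> \<le> ?c * exp (k\<^sup>2 / g - g * (norm u + R)\<^sup>2)"
        using 2 by (intro mult_left_mono) auto
      also have "\<dots> = ?E" by (simp add: exp_diff exp_minus field_simps)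
      finally show ?thesis by (simp add: kern_nonneg add_increasing)
    qed
    have "mom p (\<lambda>z. exp (k * norm z)) g u \<le> (LBINT x. exp (k * L) * (p x * (1 * kern g (u - x))) + p x * ?E)"
      unfolding mom_def
    proof (rule integral_mono)
      show "integrable lborel (\<lambda>x. exp (k * L) * (p x * (1 * kern g (u - x))) + p x * ?E)"
        using g p_int by (intro Bochner_Integration.integrable_add integrable_mult_right integrable_mult_left mom_integrable egrow_intros)
      show "p x * (exp (k * norm (u - x)) * kern g (u - x)) \<le> exp (k * L) * (p x * (1 * kern g (u - x))) + p x * ?E" for x
        using mult_left_mono[OF pt[of "u - x"], of "p x"] p_pos[of x] by (simp add: distrib_left mult_ac)
    qed (use g D in \<open>intro mom_integrable egrow_intros\<close>)
    also have "\<dots> = exp (k * L) * q g u + ?E"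
      using mom_integrable[OF g egrow_const[of 1], of u] p_int p_mass by (simp add: mom_def)
    also have "?E \<le> 2 * exp (k\<^sup>2 / g) * q g u"
    proof -
      have "?E \<le> ?c * exp (k\<^sup>2 / g) * exp (- (g * (norm u + R)\<^sup>2 / 2))"
        using g by (intro mult_left_mono) auto
      also have "\<dots> = 2 * exp (k\<^sup>2 / g) * (?c * exp (- (g * (norm u + R)\<^sup>2 / 2)) / 2)" by simp
      also have "\<dots> \<le> 2 * exp (k\<^sup>2 / g) * q g u" using R(2)[of u] by (intro mult_left_mono) auto
      finally show ?thesis .
    qed
    finally have "PE k g u \<le> exp (k * L) + 2 * exp (k\<^sup>2 / g)"
      using q_pos[OF g, of u] by (simp add: post_def pos_divide_le_eq distrib_right)
    also have "\<dots> \<le> exp (2 * k * R) * exp (2 * k * norm u) + 2 * exp (k\<^sup>2 / g) * exp (2 * k * norm u)"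
      using D(2) by (intro add_mono) (auto simp: L_def exp_add[symmetric] algebra_simps)
    finally show ?thesis by (simp add: distrib_right)
  qed
  then have "\<bar>f g u\<bar> \<le> D * ((exp (2 * k * R) + 2 * exp (k\<^sup>2 / g)) * exp (2 * k * norm u))" for u
    using D(3)[of u] D(1) by (meson mult_left_mono order_trans)
  then show ?thesis
    using D by (intro exI[where x = "D * (exp (2 * k * R) + 2 * exp (k\<^sup>2 / g))"] conjI exI[where x = "2 * k"])
      (auto simp: mult.assoc)
qed

end


section \<open>Evolution of the Fisher information\<close>

lemma has_derivative_imp_directional:
  fixes f :: "'a::real_normed_vector \<Rightarrow> real"
  assumes "(f has_derivative f') (at u)"
  shows "((\<lambda>t. f (u + t *\<^sub>R e)) has_real_derivative f' e) (at 0)"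
proof -
  have l: "((\<lambda>t::real. u + t *\<^sub>R e) has_derivative (\<lambda>t. t *\<^sub>R e)) (at 0)"
    by (auto intro!: derivative_eq_intros)
  have "((\<lambda>t. f (u + t *\<^sub>R e)) has_derivative (\<lambda>t. f' (t *\<^sub>R e))) (at 0)"
    using has_derivative_compose[OF l, of f f'] assms by simp
  moreover have "(\<lambda>t. f' (t *\<^sub>R e)) = (*) (f' e)"
    using linear_scale[OF has_derivative_linear[OF assms]] by (auto simp: mult.commute)
  ultimately show ?thesis by (simp add: has_field_derivative_def)
qed

context pos_density
begin

text \<open>\<open>dscore v\<close>, \<open>dhess v w\<close> and \<open>dthird v e\<close> are \<open>\<partial>\<^sub>v log q\<close>, \<open>\<partial>\<^sub>w \<partial>\<^sub>v log q\<close> and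
  \<open>\<partial>\<^sub>e \<partial>\<^sub>e \<partial>\<^sub>v log q\<close> as polynomials in posterior moments.\<close>

definition dscore :: "real^'n \<Rightarrow> real \<Rightarrow> real^'n \<Rightarrow> real" where
  "dscore v g u = - g * P1 v g u"

definition dhess :: "real^'n \<Rightarrow> real^'n \<Rightarrow> real \<Rightarrow> real^'n \<Rightarrow> real" where
  "dhess v w g u = - g * (w \<bullet> v - g * P2 w v g u
     + g * (P1 v g u * P (\<lambda>z. z \<bullet> w) g u))"

definition dthird :: "real^'n \<Rightarrow> real^'n \<Rightarrow> real \<Rightarrow> real^'n \<Rightarrow> real" where
  "dthird v e g u = - g * (- g * (P (\<lambda>z. (e \<bullet> e) * (z \<bullet> v) + (z \<bullet> e) * (e \<bullet> v)) g u
       - g * P (\<lambda>z. (z \<bullet> e) * ((z \<bullet> e) * (z \<bullet> v))) g u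
       + g * (P2 e v g u * P1 e g u))
     + g * ((e \<bullet> v - g * P2 e v g u + g * (P1 v g u * P1 e g u)) * P1 e g u
       + P1 v g u * (e \<bullet> e - g * P2 e e g u + g * (P1 e g u * P1 e g u))))"

lemma good_dscore [good_intros]: "0 < a \<Longrightarrow> good p a b (dscore v)"
  unfolding dscore_def[abs_def] by (intro good_intros egrow_intros continuous_intros) auto

lemma good_dhess [good_intros]: "0 < a \<Longrightarrow> good p a b (dhess v w)"
  unfolding dhess_def[abs_def] by (intro good_intros egrow_intros continuous_intros) auto

lemma good_dthird [good_intros]: "0 < a \<Longrightarrow> good p a b (dthird v w)"
  unfolding dthird_def[abs_def] by (intro good_intros egrow_intros continuous_intros) auto

lemma post_inner_has_derivative:
  assumes "0 < g"
  shows "(P1 v g has_derivative (\<lambda>h. h \<bullet> v - g * P2 h v g u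
    + g * (P1 v g u * P1 h g u))) (at u)"
proof -
  have "(P1 v g has_derivative (\<lambda>h. P (\<lambda>z. h \<bullet> v) g u - g * P2 h v g u
    + g * (P1 v g u * P1 h g u))) (at u)"
  proof (rule post_has_derivative[where \<psi> = "\<lambda>_. norm v" and \<phi>' = "\<lambda>z h. h \<bullet> v"])
    show "((\<lambda>z. z \<bullet> v) has_derivative (\<lambda>h. h \<bullet> v)) (at z)" for z
      by (auto intro!: derivative_eq_intros)
    show "\<bar>h \<bullet> v\<bar> \<le> norm v * norm h" for h
      using Cauchy_Schwarz_ineq2[of h v] by (simp add: mult.commute)
  qed (intro assms egrow_intros)+
  then show ?thesis using assms by (simp add: post_const)
qed

lemma dscore_has_derivative:
  assumes "0 < g"
  shows "(dscore v g has_derivative (\<lambda>h. dhess v h g u)) (at u)"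
  unfolding dscore_def[abs_def] dhess_def
  by (intro has_derivative_mult_right post_inner_has_derivative assms)

lemma dhess_has_derivative:
  assumes "0 < g"
  shows "((\<lambda>t. dhess v e g (u + t *\<^sub>R e)) has_real_derivative dthird v e g u) (at 0)"
proof -
  have "(P2 e v g has_derivative
    (\<lambda>h. P (\<lambda>z. (h \<bullet> e) * (z \<bullet> v) + (z \<bullet> e) * (h \<bullet> v)) g u - g * P (\<lambda>z. (z \<bullet> h) * ((z \<bullet> e) * (z \<bullet> v))) g u
    + g * (P2 e v g u * P1 h g u))) (at u)"
  proof (rule post_has_derivative[where \<psi> = "\<lambda>z. 2 * norm e * norm v * norm z"])
    show "((\<lambda>z. (z \<bullet> e) * (z \<bullet> v)) has_derivative (\<lambda>h. (h \<bullet> e) * (z \<bullet> v) + (z \<bullet> e) * (h \<bullet> v))) (at z)" for z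
      by (auto intro!: derivative_eq_intros)
    show "\<bar>(h \<bullet> e) * (z \<bullet> v) + (z \<bullet> e) * (h \<bullet> v)\<bar> \<le> 2 * norm e * norm v * norm z * norm h" for z h
    proof -
      have "\<bar>h \<bullet> e\<bar> * \<bar>z \<bullet> v\<bar> \<le> (norm h * norm e) * (norm z * norm v)"
        "\<bar>z \<bullet> e\<bar> * \<bar>h \<bullet> v\<bar> \<le> (norm z * norm e) * (norm h * norm v)"
        using Cauchy_Schwarz_ineq2 by (auto intro!: mult_mono)
      then show ?thesis
        by (intro order_trans[OF abs_triangle_ineq]) (simp add: abs_mult algebra_simps)
    qed
  qed (intro assms egrow_intros)+
  note 1 = has_derivative_imp_directional[OF this, where e = e]
  note 2 = has_derivative_imp_directional[OF post_inner_has_derivative[OF assms], where e = e]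
  show ?thesis
    unfolding dhess_def dthird_def
    by (rule derivative_eq_intros 1 2 refl | simp add: algebra_simps)+
qed

lemma q_has_directional:
  assumes "0 < g"
  shows "((\<lambda>t. q g (u + t *\<^sub>R e)) has_real_derivative q g u * dscore e g u) (at 0)"
  using has_derivative_imp_directional[OF q_has_derivative[OF assms], of u e] by (simp add: dscore_def mult.left_commute)

lemma dscore_has_directional:
  assumes "0 < g"
  shows "((\<lambda>t. dscore v g (u + t *\<^sub>R e)) has_real_derivative dhess v e g u) (at 0)"
  using has_derivative_imp_directional[OF dscore_has_derivative[OF assms], of v u e] .

text \<open>With \<open>S = dscore v\<close>, these are the first and second derivatives of \<open>q S\<^sup>2\<close> in direction
  \<open>e\<close>, divided by \<open>q\<close>.\<close>

definition fisher1 :: "real^'n \<Rightarrow> real^'n \<Rightarrow> real \<Rightarrow> real^'n \<Rightarrow> real" where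
  "fisher1 v e g u = dscore e g u * (dscore v g u)\<^sup>2 + 2 * dscore v g u * dhess v e g u"

definition fisher2 :: "real^'n \<Rightarrow> real^'n \<Rightarrow> real \<Rightarrow> real^'n \<Rightarrow> real" where
  "fisher2 v e g u = dscore e g u * fisher1 v e g u
     + (dhess e e g u * (dscore v g u)\<^sup>2 + dscore e g u * (2 * dscore v g u * dhess v e g u)
     + 2 * (dhess v e g u)\<^sup>2 + 2 * dscore v g u * dthird v e g u)"

lemma good_fisher1 [good_intros]: "0 < a \<Longrightarrow> good p a b (fisher1 v w)"
  unfolding fisher1_def[abs_def] by (intro good_intros continuous_intros) auto

lemma good_fisher2 [good_intros]: "0 < a \<Longrightarrow> good p a b (fisher2 v w)"
  unfolding fisher2_def[abs_def] by (intro good_intros continuous_intros) auto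

text \<open>The integrand is the derivative along \<open>e\<close> of \<open>q * fisher1\<close>.
  Both are integrable as polynomials in posterior moments, so no boundary term arises.\<close>

lemma integral_fisher2:
  assumes "0 < g"
  shows "(LBINT u. q g u * fisher2 v e g u) = 0"
proof (rule integral_directional_derivative_eq_0[where e = e and f = "\<lambda>u. q g u * fisher1 v e g u"])
  show "integrable lborel (\<lambda>u. q g u * fisher1 v e g u)" "integrable lborel (\<lambda>u. q g u * fisher2 v e g u)"
    using assms by (auto intro!: good_integrable good_intros)
  show "((\<lambda>t. q g (u + t *\<^sub>R e) * fisher1 v e g (u + t *\<^sub>R e)) has_real_derivative q g u * fisher2 v e g u) (at 0)" for u
    unfolding fisher1_def
    by (rule derivative_eq_intros q_has_directional dscore_has_directional dhess_has_derivative assms refl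
        | simp add: fisher2_def fisher1_def algebra_simps power2_eq_square)+
qed

text \<open>One direction's share of the evolution equation: the right-hand side is
  \<open>g\<^sup>2\<close> times what the unit vector \<open>e\<close> contributes to the
  \<open>g\<close>-derivative of \<open>q * (dscore v)\<^sup>2\<close>, divided by \<open>q\<close>.
  Once the moments are opaque variables, both sides are rational expressions in them and
  \<open>g\<close>; the third moment \<open>d\<close> is the highest that occurs.\<close>

lemma fisher_term_identity:
  assumes "0 < g" "e \<bullet> e = 1"
  shows "(dhess v e g u)\<^sup>2 - fisher2 v e g u / 2
    = g\<^sup>2 * ((1 / (2 * g) - P2 e e g u / 2) * (dscore v g u)\<^sup>2
      + 2 * dscore v g u * (- ((e \<bullet> v) * P1 e g u)
        - g * (P1 v g u * P2 e e g u - P (\<lambda>z. (z \<bullet> e) * ((z \<bullet> e) * (z \<bullet> v))) g u) / 2))"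
proof -
  have s: "P (\<lambda>z. (z \<bullet> v) + (z \<bullet> e) * (e \<bullet> v)) g u = P1 v g u + (e \<bullet> v) * P1 e g u"
    using assms(1) post_cmult[of "e \<bullet> v" "\<lambda>z. z \<bullet> e" g u]
    by (subst post_add) (auto intro!: egrow_intros simp: mult.commute)
  define A a b c d n where "A = P1 v g u" and "a = P1 e g u"
    and "b = P2 e v g u" and "c = P2 e e g u"
    and "d = P (\<lambda>z. (z \<bullet> e) * ((z \<bullet> e) * (z \<bullet> v))) g u" and "n = e \<bullet> v"
  show ?thesis
    unfolding fisher2_def fisher1_def dscore_def dhess_def dthird_def assms(2) mult_1_left s
    unfolding A_def[symmetric] a_def[symmetric] b_def[symmetric] c_def[symmetric] d_def[symmetric] n_def[symmetric]
    using assms(1) by (simp add: field_simps power2_eq_square)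
qed

text \<open>Since \<open>q * fisher2\<close> is a second derivative along \<open>e\<close>, the sum
  of these terms is the Laplacian of \<open>q * (dscore v)\<^sup>2\<close>. The equation is obtained
  by matching posterior moments on both sides, which avoids interchanging derivatives in
  \<open>g\<close> and in \<open>u\<close>.\<close>

lemma fisher_has_real_derivative:
  assumes g: "0 < g"
  shows "((\<lambda>g. q g u * (dscore v g u)\<^sup>2) has_real_derivative
    q g u * (1 / g\<^sup>2 * ((\<Sum>e\<in>Basis. (dhess v e g u)\<^sup>2) - (\<Sum>e\<in>Basis. fisher2 v e g u) / 2))) (at g)"
proof -
  let ?N = "P (\<lambda>z. (norm z)\<^sup>2) g u" and ?V = "P (\<lambda>z. (z \<bullet> v) * (norm z)\<^sup>2) g u"
    and ?A = "P1 v g u" and ?S = "dscore v g u"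
  \<comment> \<open>\<open>N\<close>, \<open>V\<close> and \<open>A\<close> split the moments in the
    \<open>g\<close>-derivative over the coordinate directions, to be matched with the summands of
    \<open>fisher_term_identity\<close>.\<close>
  have nrm: "(norm z)\<^sup>2 = (\<Sum>e\<in>Basis. (z \<bullet> e) * (z \<bullet> e))" for z :: "real^'n"
    unfolding power2_norm_eq_inner by (rule euclidean_inner)
  have N: "?N = (\<Sum>e\<in>Basis. P2 e e g u)"
    unfolding nrm by (rule post_sum) (auto intro!: g egrow_intros)
  have V: "?V = (\<Sum>e\<in>Basis. P (\<lambda>z. (z \<bullet> e) * ((z \<bullet> e) * (z \<bullet> v))) g u)"
  proof -
    have "?V = P (\<lambda>z. \<Sum>e\<in>Basis. (z \<bullet> e) * ((z \<bullet> e) * (z \<bullet> v))) g u"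
      unfolding nrm by (simp add: sum_distrib_left mult_ac)
    then show ?thesis
      by (subst (asm) post_sum(1)) (auto intro!: g egrow_intros)
  qed
  have A: "?A = (\<Sum>e\<in>Basis. (e \<bullet> v) * P1 e g u)"
  proof -
    have "(\<lambda>z. z \<bullet> v) = (\<lambda>z. \<Sum>e\<in>Basis. (e \<bullet> v) * (z \<bullet> e))"
      by (rule ext, subst euclidean_inner) (simp add: inner_commute mult.commute)
    from arg_cong[OF this, of "\<lambda>\<phi>. P \<phi> g u"] show ?thesis
      by (subst (asm) post_sum(1)) (auto intro!: g egrow_intros simp: post_cmult)
  qed
  have "(\<Sum>e\<in>Basis. (dhess v e g u)\<^sup>2) - (\<Sum>e\<in>Basis. fisher2 v e g u) / 2
      = (\<Sum>e\<in>Basis. (dhess v e g u)\<^sup>2 - fisher2 v e g u / 2)"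
    by (simp add: sum_subtractf sum_divide_distrib)
  also have "\<dots> = (\<Sum>e\<in>Basis. g\<^sup>2 * ((1 / (2 * g) - P2 e e g u / 2) * ?S\<^sup>2
      + 2 * ?S * (- ((e \<bullet> v) * P1 e g u)
        - g * (?A * P2 e e g u - P (\<lambda>z. (z \<bullet> e) * ((z \<bullet> e) * (z \<bullet> v))) g u) / 2)))"
    by (intro sum.cong refl fisher_term_identity g) (simp add: inner_Basis)
  also have "\<dots> = g\<^sup>2 * ((real CARD('n) / (2 * g) - ?N / 2) * ?S\<^sup>2 + 2 * ?S * (- ?A - g * (?A * ?N - ?V) / 2))"
    unfolding sum_distrib_left[symmetric] sum.distrib sum_subtractf sum_distrib_right[symmetric]
      sum_negf sum_divide_distrib[symmetric] N[symmetric] V[symmetric] A[symmetric]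
    by simp
  finally have eq: "(\<Sum>e\<in>Basis. (dhess v e g u)\<^sup>2) - (\<Sum>e\<in>Basis. fisher2 v e g u) / 2 = \<dots>" .
  have 1: "((\<lambda>g. dscore v g u) has_real_derivative (- ?A - g * (?A * ?N - ?V) / 2)) (at g)"
    unfolding dscore_def
    by (rule derivative_eq_intros post_has_real_derivative[OF g egrow_inner] refl | simp)+
  show ?thesis
    unfolding eq
    by (rule derivative_eq_intros q_has_real_derivative[OF g] 1 refl
      | use g in \<open>simp add: field_simps power2_eq_square\<close>)+
qed

definition fisher :: "real^'n \<Rightarrow> real \<Rightarrow> real" where
  "fisher v g = (LBINT u. q g u * (dscore v g u)\<^sup>2)"

text \<open>The mean squared gradient of \<open>dscore v\<close>; the factor
  \<open>1 / g\<^sup>2\<close> comes from the time change to \<open>1 / g\<close>.\<close>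

definition dissipation :: "real^'n \<Rightarrow> real \<Rightarrow> real" where
  "dissipation v g = 1 / g\<^sup>2 * (LBINT u. q g u * (\<Sum>e\<in>Basis. (dhess v e g u)\<^sup>2))"

lemma dissipation_nonneg: "0 < g \<Longrightarrow> 0 \<le> dissipation v g"
  unfolding dissipation_def
  by (intro mult_nonneg_nonneg integral_nonneg_AE AE_I2 sum_nonneg) (auto intro: less_imp_le[OF q_pos])

text \<open>The de Bruijn-type identity in integrated form, for which joint integrability over
  \<open>{a..b}\<close> is enough. The lower end is positive because the exponential moments of the
  noise, and with them the bounds on \<open>good\<close> functions, blow up as the precision tends
  to 0.\<close>

lemma fisher_diff:
  assumes "0 < a" "a \<le> b"
  shows "fisher v b - fisher v a = (LBINT g. indicator {a..b} g * dissipation v g)"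
    and "integrable lborel (\<lambda>g. indicator {a..b} g * dissipation v g)"
proof -
  let ?F' = "\<lambda>g u. 1 / g\<^sup>2 * ((\<Sum>e\<in>Basis. (dhess v e g u)\<^sup>2) - (\<Sum>e\<in>Basis. fisher2 v e g u) / 2)"
  have gd: "good p a b ?F'"
    unfolding divide_inverse[of "sum _ _"] using assms
    by (intro good_intros finite_Basis continuous_intros) (auto intro!: good_intros)
  have s: "integral\<^sup>L lborel (\<lambda>u. q g u * ?F' g u) = dissipation v g" if "g \<in> {a..b}" for g
  proof -
    have g: "0 < g" using that assms by simp
    have i: "integrable lborel (\<lambda>u. q g u * (\<Sum>e\<in>Basis. (dhess v e g u)\<^sup>2))"
      "integrable lborel (\<lambda>u. q g u * fisher2 v e g u)" for e
      using g by (auto intro!: good_integrable good_intros)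
    have "integral\<^sup>L lborel (\<lambda>u. q g u * ?F' g u)
      = (LBINT u. 1 / g\<^sup>2 * (q g u * (\<Sum>e\<in>Basis. (dhess v e g u)\<^sup>2)) - 1 / (2 * g\<^sup>2) * (\<Sum>e\<in>Basis. q g u * fisher2 v e g u))"
      using g by (intro Bochner_Integration.integral_cong refl) (simp add: sum_distrib_left[symmetric] field_simps)
    also have "\<dots> = dissipation v g"
      using i by (simp add: dissipation_def integral_fisher2[OF g])
    finally show ?thesis .
  qed
  have "indicator {a..b} g * integral\<^sup>L lborel (\<lambda>u. q g u * ?F' g u) = indicator {a..b} g * dissipation v g" for g
    using s[of g] by (cases "g \<in> {a..b}") auto
  note r = this
  note pf = parametric_fundamental_theorem[where F = "\<lambda>g u. q g u * (dscore v g u)\<^sup>2" and F' = "\<lambda>g u. q g u * ?F' g u",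
      OF assms(2) fisher_has_real_derivative good_integrable_joint[OF assms(1) gd]]
  have i: "integrable lborel (\<lambda>u. q g u * (dscore v g u)\<^sup>2)" if "0 < g" for g
    using that by (intro good_integrable good_intros)
  have "0 < b" using assms by simp
  note pf = pf[OF _ i[OF assms(1)] i[OF this], unfolded r]
  show "fisher v b - fisher v a = (LBINT g. indicator {a..b} g * dissipation v g)"
    unfolding fisher_def by (rule pf(1)) (use assms in auto)
  show "integrable lborel (\<lambda>g. indicator {a..b} g * dissipation v g)"
    by (rule pf(2)) (use assms in auto)
qed

end


section \<open>Limits of the Fisher information\<close>

lemma powr_times_exp_LIMSEQ_0:
  assumes "0 < b"
  shows "(\<lambda>n. real (Suc n) powr a * exp (- (b * real (Suc n)))) \<longlonglongrightarrow> 0"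
proof -
  define k where "k = nat \<lceil>a\<rceil>"
  have t: "filterlim (\<lambda>n. b * real (Suc n)) at_top sequentially"
    using assms by (intro filterlim_tendsto_pos_mult_at_top[OF tendsto_const])
      (auto simp del: of_nat_Suc intro: filterlim_compose[OF filterlim_real_sequentially filterlim_Suc])
  have "(\<lambda>n. (1 / b ^ k) * ((b * real (Suc n)) ^ k / exp (b * real (Suc n)))) \<longlonglongrightarrow> (1 / b ^ k) * 0"
    by (intro tendsto_mult tendsto_const filterlim_compose[OF tendsto_power_div_exp_0 t])
  moreover have "(1 / b ^ k) * ((b * x) ^ k / exp (b * x)) = x ^ k * exp (- (b * x))" for x
    using assms by (simp add: power_mult_distrib exp_minus field_simps)
  ultimately have l: "(\<lambda>n. real (Suc n) ^ k * exp (- (b * real (Suc n)))) \<longlonglongrightarrow> 0"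
    by simp
  show ?thesis
  proof (rule tendsto_sandwich[OF _ _ tendsto_const l])
    have "real (Suc n) powr a \<le> real (Suc n) ^ k" for n
    proof -
      have "real (Suc n) powr a \<le> real (Suc n) powr real k"
        unfolding k_def by (intro powr_mono) linarith+
      then show ?thesis by (simp add: powr_realpow)
    qed
    then show "\<forall>\<^sub>F n in sequentially. real (Suc n) powr a * exp (- (b * real (Suc n))) \<le> real (Suc n) ^ k * exp (- (b * real (Suc n)))"
      by (intro always_eventually allI mult_right_mono) auto
  qed auto
qed

text \<open>Approximate identity at a continuity point. As \<open>f\<close> is integrable but
  possibly unbounded, the far part is split: the term with \<open>f x\<close> is controlled by the
  supremum of the kernel there, the term with the constant \<open>f u\<close> by the mass of the
  kernel there.\<close>

lemma kern_convolution_tendsto: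
  fixes f :: "real^'n \<Rightarrow> real"
  assumes f: "integrable lborel f" and cont: "isCont f u"
  shows "(\<lambda>n. (LBINT x. f x * kern (real (Suc n)) (u - x))) \<longlonglongrightarrow> f u"
proof (rule tendstoI)
  fix e :: real assume e: "0 < e"
  have [measurable]: "f \<in> borel_measurable borel" using f by (auto dest: borel_measurable_integrable)
  obtain r where r: "r > 0" "\<And>x. norm (u - x) < r \<Longrightarrow> \<bar>f x - f u\<bar> < e / 2"
    using cont e unfolding continuous_at_eps_delta dist_real_def dist_norm
    by (metis half_gt_zero norm_minus_commute)
  let ?d = "real CARD('n) / 2"
  \<comment> \<open>Outside the ball of radius \<open>r\<close>, \<open>c n\<close> bounds the
    kernel, and \<open>c' n\<close> bounds its ratio to the kernel of half the precision, hence its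
    mass. The exponent 0 in \<open>c'\<close> only brings it into the form of
    \<open>powr_times_exp_LIMSEQ_0\<close>.\<close>
  define c where "c n = (1 / (2 * pi)) powr ?d * (real (Suc n) powr ?d * exp (- (r\<^sup>2 / 2 * real (Suc n))))" for n
  define c' where "c' n = 2 powr ?d * (real (Suc n) powr 0 * exp (- (r\<^sup>2 / 4 * real (Suc n))))" for n
  have lim: "(\<lambda>n. e / 2 + (c n * (LBINT x. \<bar>f x\<bar>) + \<bar>f u\<bar> * c' n)) \<longlonglongrightarrow> e / 2 + ((1 / (2 * pi)) powr ?d * 0 * (LBINT x. \<bar>f x\<bar>) + \<bar>f u\<bar> * (2 powr ?d * 0))"
    unfolding c_def c'_def using r(1)
    by (intro tendsto_intros powr_times_exp_LIMSEQ_0) auto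
  have bound: "\<bar>(LBINT x. f x * kern (real (Suc n)) (u - x)) - f u\<bar>
      \<le> e / 2 + (c n * (LBINT x. \<bar>f x\<bar>) + \<bar>f u\<bar> * c' n)" for n
  proof -
    let ?g = "real (Suc n)"
    have kt: "integrable lborel (\<lambda>x. kern g (u - x))" "(LBINT x. kern g (u - x)) = 1" if "0 < g" for g
    proof -
      have eq: "kern g (u - x) = kern g (- u + x)" for x
        using norm_minus_commute[of u x] by (simp add: kern_def)
      show "integrable lborel (\<lambda>x. kern g (u - x))" "(LBINT x. kern g (u - x)) = 1"
        unfolding eq using kern_integral[OF that, where 'n = 'n] integrable_translate_iff[of "kern g" "-u"]
          integral_translate[of "kern g" "-u"] by simp_all
    qed
    have fk: "integrable lborel (\<lambda>x. f x * kern ?g (u - x))"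
      by (rule integrable_mult_kern[OF _ f]) simp
    have pt: "\<bar>(f x - f u) * kern ?g (u - x)\<bar>
      \<le> e / 2 * kern ?g (u - x) + (c n * \<bar>f x\<bar> + \<bar>f u\<bar> * (c' n * kern (?g / 2) (u - x)))" for x
    proof (cases "norm (u - x) < r")
      case True
      have "\<bar>(f x - f u) * kern ?g (u - x)\<bar> \<le> e / 2 * kern ?g (u - x)"
        using mult_right_mono[OF less_imp_le[OF r(2)[OF True]] kern_nonneg[of ?g "u - x"]]
        by (simp add: abs_mult kern_nonneg)
      moreover have "0 \<le> c n * \<bar>f x\<bar> + \<bar>f u\<bar> * (c' n * kern (?g / 2) (u - x))"
        by (simp add: c_def c'_def kern_nonneg)
      ultimately show ?thesis by linarith
    next
      case False
      then have sq: "r\<^sup>2 \<le> (norm (u - x))\<^sup>2" using r(1) by (intro power_mono) auto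
      have 1: "kern ?g (u - x) \<le> c n"
      proof -
        have "kern ?g (u - x) \<le> (?g / (2 * pi)) powr ?d * exp (- (r\<^sup>2 / 2 * ?g))"
          unfolding kern_def using sq by (intro mult_left_mono) (auto simp: mult.commute)
        also have "(?g / (2 * pi)) powr ?d = (1 / (2 * pi)) powr ?d * ?g powr ?d"
          by (subst powr_mult[symmetric]) auto
        finally show ?thesis by (simp add: c_def mult.assoc)
      qed
      have 2: "kern ?g (u - x) \<le> c' n * kern (?g / 2) (u - x)"
      proof -
        have a: "(?g / (2 * pi)) powr ?d = 2 powr ?d * ((?g / 2) / (2 * pi)) powr ?d"
          by (subst powr_mult[symmetric]) (auto simp del: of_nat_Suc)
        have "exp (- (?g * (norm (u - x))\<^sup>2 / 2)) \<le> exp (- (r\<^sup>2 / 4 * ?g) + - (?g / 2 * (norm (u - x))\<^sup>2 / 2))"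
          using mult_left_mono[OF sq, of ?g] by (simp add: field_simps)
        then have "kern ?g (u - x) \<le> (2 powr ?d * ((?g / 2) / (2 * pi)) powr ?d)
            * exp (- (r\<^sup>2 / 4 * ?g) + - (?g / 2 * (norm (u - x))\<^sup>2 / 2))"
          unfolding kern_def a by (intro mult_left_mono) auto
        also have "\<dots> = c' n * kern (?g / 2) (u - x)"
          unfolding c'_def kern_def exp_add by simp
        finally show ?thesis .
      qed
      have "\<bar>(f x - f u) * kern ?g (u - x)\<bar> \<le> \<bar>f x\<bar> * kern ?g (u - x) + \<bar>f u\<bar> * kern ?g (u - x)"
        by (simp add: abs_mult kern_nonneg distrib_right[symmetric] mult_right_mono)
      also have "\<dots> \<le> \<bar>f x\<bar> * c n + \<bar>f u\<bar> * (c' n * kern (?g / 2) (u - x))"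
        using 1 2 by (intro add_mono mult_left_mono) auto
      also have "\<dots> \<le> e / 2 * kern ?g (u - x) + (c n * \<bar>f x\<bar> + \<bar>f u\<bar> * (c' n * kern (?g / 2) (u - x)))"
        using e kern_nonneg[of ?g "u - x"] by (simp add: mult.commute)
      finally show ?thesis .
    qed
    have "(LBINT x. f x * kern ?g (u - x)) - f u = (LBINT x. (f x - f u) * kern ?g (u - x))"
      using fk kt[of ?g] by (simp add: left_diff_distrib)
    also have "\<bar>\<dots>\<bar> \<le> (LBINT x. \<bar>(f x - f u) * kern ?g (u - x)\<bar>)"
      using integral_norm_bound[of lborel "\<lambda>x. (f x - f u) * kern ?g (u - x)"] by simp
    also have "\<dots> \<le> (LBINT x. e / 2 * kern ?g (u - x) + (c n * \<bar>f x\<bar> + \<bar>f u\<bar> * (c' n * kern (?g / 2) (u - x))))"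
    proof (rule integral_mono)
      show "integrable lborel (\<lambda>x. \<bar>(f x - f u) * kern ?g (u - x)\<bar>)"
        using fk kt[of ?g] by (simp add: left_diff_distrib)
      show "integrable lborel (\<lambda>x. e / 2 * kern ?g (u - x) + (c n * \<bar>f x\<bar> + \<bar>f u\<bar> * (c' n * kern (?g / 2) (u - x))))"
        using f kt[of ?g] kt[of "?g / 2"] by simp
    qed (rule pt)
    also have "\<dots> = e / 2 + (c n * (LBINT x. \<bar>f x\<bar>) + \<bar>f u\<bar> * c' n)"
      using f kt[of ?g] kt[of "?g / 2"] by simp
    finally show ?thesis .
  qed
  have "\<forall>\<^sub>F n in sequentially. e / 2 + (c n * (LBINT x. \<bar>f x\<bar>) + \<bar>f u\<bar> * c' n) < e"
    using lim e by (intro order_tendstoD(2)[OF lim]) simp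
  then show "\<forall>\<^sub>F n in sequentially. dist (LBINT x. f x * kern (real (Suc n)) (u - x)) (f u) < e"
    by eventually_elim (use bound in \<open>auto simp: dist_real_def intro: le_less_trans\<close>)
qed

context pos_density
begin

text \<open>The score is \<open>- g\<close> times a posterior mean of the noise, so its mean square
  is at most \<open>g\<^sup>2\<close> times the second moment of \<open>z \<bullet> v\<close>, which
  is of order \<open>1 / g\<close>. The constant is crude; what counts is that the bound vanishes as
  \<open>g\<close> tends to 0.\<close>

lemma fisher_le_linear:
  assumes g: "0 < g"
  shows "fisher v g \<le> 4 * g * (norm v)\<^sup>2 * 2 powr (real CARD('n) / 2)"
proof -
  let ?d = "real CARD('n) / 2"
  have k: "(z \<bullet> v)\<^sup>2 * kern g z \<le> (norm v)\<^sup>2 * (4 / g) * 2 powr ?d * kern (g / 2) z" for z :: "real^'n"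
  proof -
    have a: "(g / (2 * pi)) powr ?d = 2 powr ?d * ((g / 2) / (2 * pi)) powr ?d"
      using g by (subst powr_mult[symmetric]) auto
    have s: "exp (- (g * (norm z)\<^sup>2 / 2)) = exp (- (g * (norm z)\<^sup>2 / 4)) * exp (- (g / 2 * (norm z)\<^sup>2 / 2))"
      by (simp add: exp_add[symmetric])
    have kk: "kern g z = exp (- (g * (norm z)\<^sup>2 / 4)) * 2 powr ?d * kern (g / 2) z"
      unfolding kern_def a s by simp
    \<comment> \<open>This is \<open>t * exp (- t) \<le> 1\<close> for the half of the exponent that
      is spent on the polynomial; the other half leaves a kernel of precision
      \<open>g / 2\<close>.\<close>
    have "g * (norm z)\<^sup>2 / 4 * exp (- (g * (norm z)\<^sup>2 / 4)) \<le> 1"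
      using exp_ge_add_one_self[of "g * (norm z)\<^sup>2 / 4"] by (simp add: exp_minus field_simps del: exp_ge_add_one_self)
    then have "(norm z)\<^sup>2 * exp (- (g * (norm z)\<^sup>2 / 4)) \<le> 4 / g"
      using g by (simp add: field_simps)
    moreover have "(z \<bullet> v)\<^sup>2 \<le> (norm z)\<^sup>2 * (norm v)\<^sup>2"
      using Cauchy_Schwarz_ineq[of z v] by (simp add: power2_norm_eq_inner)
    moreover have "(z \<bullet> v)\<^sup>2 * exp (- (g * (norm z)\<^sup>2 / 4)) \<le> (norm z)\<^sup>2 * (norm v)\<^sup>2 * exp (- (g * (norm z)\<^sup>2 / 4))"
      using calculation(2) by (rule mult_right_mono) simp
    moreover have "(norm v)\<^sup>2 * ((norm z)\<^sup>2 * exp (- (g * (norm z)\<^sup>2 / 4))) \<le> (norm v)\<^sup>2 * (4 / g)"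
      using calculation(1) by (rule mult_left_mono) simp
    ultimately have "(z \<bullet> v)\<^sup>2 * exp (- (g * (norm z)\<^sup>2 / 4)) \<le> (norm v)\<^sup>2 * (4 / g)"
      by (simp only: mult_ac)
    then have "(z \<bullet> v)\<^sup>2 * exp (- (g * (norm z)\<^sup>2 / 4)) * (2 powr ?d * kern (g / 2) z)
        \<le> (norm v)\<^sup>2 * (4 / g) * (2 powr ?d * kern (g / 2) z)"
      by (intro mult_right_mono) (auto simp: kern_nonneg)
    then show ?thesis unfolding kk by (simp add: mult_ac)
  qed
  have eg: "egrow (\<lambda>z. (z \<bullet> v)\<^sup>2)" by (intro egrow_intros)
  have ik: "integrable lborel (\<lambda>z::real^'n. (norm v)\<^sup>2 * (4 / g) * 2 powr ?d * kern (g / 2) z)"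
    using g by (intro integrable_mult_right kern_integral) simp
  have iz: "integrable lborel (\<lambda>z::real^'n. (z \<bullet> v)\<^sup>2 * kern g z)"
    by (rule Bochner_Integration.integrable_bound[OF ik])
      (use k g in \<open>auto simp: abs_mult kern_nonneg intro!: AE_I2 intro: order_trans[OF _ abs_ge_self]\<close>)
  have "fisher v g \<le> (LBINT u. g\<^sup>2 * mom p (\<lambda>z. (z \<bullet> v)\<^sup>2) g u)"
    unfolding fisher_def
  proof (rule integral_mono)
    show "integrable lborel (\<lambda>u. q g u * (dscore v g u)\<^sup>2)"
      using g by (intro good_integrable good_intros)
    show "integrable lborel (\<lambda>u. g\<^sup>2 * mom p (\<lambda>z. (z \<bullet> v)\<^sup>2) g u)"
      using mom_integral(1)[OF g iz] by simp
    show "q g u * (dscore v g u)\<^sup>2 \<le> g\<^sup>2 * mom p (\<lambda>z. (z \<bullet> v)\<^sup>2) g u" for u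
      using mult_left_mono[OF post_square_le[OF g egrow_inner, of v u], of "g\<^sup>2 * q g u"] q_pos[OF g, of u]
      by (simp add: dscore_def mom_eq_post[OF g, of "\<lambda>z. (z \<bullet> v)\<^sup>2"] power_mult_distrib mult_ac)
  qed
  also have "\<dots> = g\<^sup>2 * (LBINT z. (z \<bullet> v)\<^sup>2 * kern g z)"
    using mom_integral(2)[OF g iz] by simp
  also have "\<dots> \<le> g\<^sup>2 * (LBINT z. (norm v)\<^sup>2 * (4 / g) * 2 powr ?d * kern (g / 2) (z :: real^'n))"
    using iz ik k by (intro mult_left_mono integral_mono) auto
  also have "\<dots> = 4 * g * (norm v)\<^sup>2 * 2 powr ?d"
    using g kern_integral(2)[of "g / 2", where 'n = 'n] by (simp add: power2_eq_square)
  finally show ?thesis .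
qed

lemma fisher_nonneg: "0 < g \<Longrightarrow> 0 \<le> fisher v g"
  unfolding fisher_def by (intro integral_nonneg_AE AE_I2 mult_nonneg_nonneg zero_le_power2 less_imp_le[OF q_pos])

lemma dhess_measurable [measurable (raw)]:
  "f \<in> borel_measurable M \<Longrightarrow> h \<in> borel_measurable M \<Longrightarrow> (\<lambda>x. dhess v w (f x) (h x)) \<in> borel_measurable M"
  by (rule good_measurable'[OF good_dhess[of 1 1]]) auto

lemma dissipation_measurable [measurable]: "dissipation v \<in> borel_measurable borel"
  unfolding dissipation_def[abs_def] by measurable

context
  fixes v :: "real^'n" and dp :: "real^'n \<Rightarrow> real"
  assumes dp: "\<And>z. ((\<lambda>t. p (z + t *\<^sub>R v)) has_real_derivative dp z) (at 0)"
    and dp_int: "integrable lborel dp"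
    and dp_sq: "integrable lborel (\<lambda>z. (dp z)\<^sup>2 / p z)"
begin

text \<open>Integration by parts moves the derivative from the kernel to \<open>p\<close>. Only in
  this form does the score have a limit as the precision grows, since the factor \<open>g\<close> is
  gone.\<close>

lemma q_dscore_eq:
  assumes g: "0 < g"
  shows "q g u * dscore v g u = (LBINT x. dp x * kern g (u - x))"
proof -
  have i1: "integrable lborel (\<lambda>x. dp x * kern g (u - x))" by (rule integrable_mult_kern[OF g dp_int])
  have i2: "integrable lborel (\<lambda>x. p x * (((u - x) \<bullet> v) * kern g (u - x)))"
    by (intro mom_integrable g egrow_intros)
  have "(LBINT x. dp x * kern g (u - x) + g * (p x * (((u - x) \<bullet> v) * kern g (u - x)))) = 0"
  proof (rule integral_directional_derivative_eq_0[where e = v and f = "\<lambda>x. p x * kern g (u - x)"])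
    show "integrable lborel (\<lambda>x. p x * kern g (u - x))" by (rule integrable_mult_kern[OF g p_int])
    show "integrable lborel (\<lambda>x. dp x * kern g (u - x) + g * (p x * (((u - x) \<bullet> v) * kern g (u - x))))"
      using i1 i2 by simp
    fix x
    have l: "((\<lambda>x. u - x) has_derivative (\<lambda>h. - h)) (at x)"
      by (auto intro!: derivative_eq_intros)
    have "((\<lambda>x. kern g (u - x)) has_derivative (\<lambda>h. - g * ((u - x) \<bullet> - h) * kern g (u - x))) (at x)"
      by (rule has_derivative_compose[OF l kern_has_derivative])
    from has_derivative_imp_directional[OF this, of v]
    have k: "((\<lambda>t. kern g (u - (x + t *\<^sub>R v))) has_real_derivative g * ((u - x) \<bullet> v) * kern g (u - x)) (at 0)"
      by simp
    show "((\<lambda>t. p (x + t *\<^sub>R v) * kern g (u - (x + t *\<^sub>R v))) has_real_derivative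
        dp x * kern g (u - x) + g * (p x * (((u - x) \<bullet> v) * kern g (u - x)))) (at 0)"
      by (rule DERIV_cong[OF DERIV_mult[OF dp k]]) (simp add: mult_ac)
  qed
  then have "(LBINT x. dp x * kern g (u - x)) + g * mom p (\<lambda>z. z \<bullet> v) g u = 0"
    using i1 i2 by (simp add: mom_def)
  then show ?thesis using mom_eq_post[OF g, of "\<lambda>z. z \<bullet> v" u] by (simp add: dscore_def algebra_simps)
qed

text \<open>Smoothing cannot increase Fisher information, because \<open>a\<^sup>2 / b\<close> is
  jointly convex: Cauchy-Schwarz at each \<open>u\<close> compares with the smoothed
  \<open>(dp x)\<^sup>2 / p x\<close>, and the kernel has mass 1.\<close>

lemma fisher_le:
  assumes g: "0 < g"
  shows "fisher v g \<le> (LBINT z. (dp z)\<^sup>2 / p z)"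
proof -
  have k: "integrable lborel (kern g :: real^'n \<Rightarrow> real)" using kern_integral(1)[OF g] .
  note conv = convolution_integrable[OF dp_sq k]
  have "fisher v g \<le> (LBINT u. (LBINT x. (dp x)\<^sup>2 / p x * kern g (u - x)))"
    unfolding fisher_def
  proof (rule integral_mono)
    show "integrable lborel (\<lambda>u. q g u * (dscore v g u)\<^sup>2)"
      using g by (intro good_integrable good_intros)
    show "integrable lborel (\<lambda>u. (LBINT x. (dp x)\<^sup>2 / p x * kern g (u - x)))" by (rule conv(1))
    fix u
    have pos: "0 < p x * kern g (u - x)" for x
      using p_pos[of x] kern_pos[OF g, of "u - x"] by simp
    have eq: "(dp x * kern g (u - x))\<^sup>2 / (p x * kern g (u - x)) = (dp x)\<^sup>2 / p x * kern g (u - x)" for x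
      using kern_pos[OF g, of "u - x"] by (simp add: power2_eq_square)
    have qq: "q g u = (LBINT x. p x * kern g (u - x))" by (simp add: mom_def)
    have "(LBINT x. dp x * kern g (u - x))\<^sup>2 / (LBINT x. p x * kern g (u - x))
      \<le> (LBINT x. (dp x * kern g (u - x))\<^sup>2 / (p x * kern g (u - x)))"
      using q_pos[OF g, of u] unfolding qq
      by (intro integral_cauchy_schwarz_ratio integrable_mult_kern g dp_int p_int pos)
        (simp_all only: eq integrable_mult_kern g dp_sq)
    moreover have "q g u * (dscore v g u)\<^sup>2 = (q g u * dscore v g u)\<^sup>2 / q g u"
      using q_pos[OF g, of u] by (simp add: power2_eq_square)
    then have "q g u * (dscore v g u)\<^sup>2 = (LBINT x. dp x * kern g (u - x))\<^sup>2 / (LBINT x. p x * kern g (u - x))"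
      unfolding q_dscore_eq[OF g] unfolding qq .
    ultimately show "q g u * (dscore v g u)\<^sup>2 \<le> (LBINT x. (dp x)\<^sup>2 / p x * kern g (u - x))"
      unfolding eq by simp
  qed
  also have "\<dots> = (LBINT z. (dp z)\<^sup>2 / p z)"
    using conv(2) kern_integral(2)[OF g, where 'n = 'n] by simp
  finally show ?thesis .
qed

text \<open>Instead of a dominating function, Fatou's lemma bounds the lower limit and
  \<open>fisher_le\<close> the upper one. The pointwise limit treats numerator and denominator as
  two separate approximate identities.\<close>

lemma fisher_tendsto:
  assumes cont_p: "\<And>u. isCont p u" and cont_dp: "\<And>u. isCont dp u"
  shows "(\<lambda>n. fisher v (real (Suc n))) \<longlonglongrightarrow> (LBINT z. (dp z)\<^sup>2 / p z)"
proof -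
  have [measurable]: "dp \<in> borel_measurable borel" using dp_int by (auto dest: borel_measurable_integrable)
  let ?J = "(LBINT z. (dp z)\<^sup>2 / p z)"
  let ?F = "\<lambda>n u. q (real (Suc n)) u * (dscore v (real (Suc n)) u)\<^sup>2"
  have iF: "integrable lborel (?F n)" for n by (intro good_integrable good_intros) auto
  have nF: "0 \<le> ?F n u" for n u using q_pos[of "real (Suc n)" u] by simp
  have l: "(\<lambda>n. ?F n u) \<longlonglongrightarrow> (dp u)\<^sup>2 / p u" for u
  proof -
    have eq: "?F n u = (LBINT x. dp x * kern (real (Suc n)) (u - x))\<^sup>2 / (LBINT x. p x * kern (real (Suc n)) (u - x))" for n
    proof -
      have "?F n u = (q (real (Suc n)) u * dscore v (real (Suc n)) u)\<^sup>2 / q (real (Suc n)) u"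
        using q_pos[of "real (Suc n)" u] by (simp add: power2_eq_square)
      then show ?thesis by (simp only: q_dscore_eq) (simp add: mom_def)
    qed
    show ?thesis
      unfolding eq using p_pos[of u]
      by (intro tendsto_divide tendsto_power kern_convolution_tendsto dp_int p_int cont_p cont_dp) simp
  qed
  have "ennreal ?J = (\<integral>\<^sup>+u. ennreal ((dp u)\<^sup>2 / p u) \<partial>lborel)"
    using dp_sq p_pos by (intro nn_integral_eq_integral[symmetric]) (auto simp: less_imp_le)
  also have "\<dots> = (\<integral>\<^sup>+u. liminf (\<lambda>n. ennreal (?F n u)) \<partial>lborel)"
    by (intro nn_integral_cong lim_imp_Liminf[symmetric] tendsto_ennrealI l) simp
  also have "\<dots> \<le> liminf (\<lambda>n. \<integral>\<^sup>+u. ennreal (?F n u) \<partial>lborel)"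
    using iF by (intro nn_integral_liminf) (auto dest: borel_measurable_integrable)
  also have "\<dots> = liminf (\<lambda>n. ennreal (fisher v (real (Suc n))))"
    using iF nF by (simp add: nn_integral_eq_integral fisher_def)
  finally have lower: "ennreal ?J \<le> liminf (\<lambda>n. ennreal (fisher v (real (Suc n))))" .
  have upper: "limsup (\<lambda>n. ennreal (fisher v (real (Suc n)))) \<le> ennreal ?J"
    using fisher_le by (intro Limsup_bounded always_eventually allI ennreal_leI) simp
  have J: "0 \<le> ?J" using p_pos by (intro integral_nonneg_AE AE_I2) (simp add: less_imp_le)
  have "(\<lambda>n. ennreal (fisher v (real (Suc n)))) \<longlonglongrightarrow> ennreal ?J"
    using lower upper Liminf_le_Limsup[of sequentially "\<lambda>n. ennreal (fisher v (real (Suc n)))"]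
    by (subst tendsto_iff_Liminf_eq_Limsup) (auto intro!: antisym)
  then show ?thesis
    using J by (subst (asm) tendsto_ennreal_iff) (auto intro!: always_eventually fisher_nonneg)
qed

lemma dissipation_integral:
  assumes cont_p: "\<And>u. isCont p u" and cont_dp: "\<And>u. isCont dp u"
  shows "(\<integral>\<^sup>+g. ennreal (indicator {0<..} g * dissipation v g) \<partial>lborel) = ennreal (LBINT z. (dp z)\<^sup>2 / p z)"
proof -
  \<comment> \<open>These intervals increase to \<open>{0<..}\<close>. Over each, the dissipation is
    a difference of Fisher informations, whose lower end is killed by
    \<open>fisher_le_linear\<close>.\<close>
  define I where "I n = {1 / real (Suc n)..real (Suc n)}" for n
  have pos: "g \<in> I n \<Longrightarrow> 0 < g" for g n
    unfolding I_def by (auto intro: less_le_trans[of _ "1 / real (Suc n)"])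
  have le: "1 / real (Suc n) \<le> real (Suc n)" for n
    by (simp add: field_simps)
  have val: "(\<integral>\<^sup>+g. ennreal (indicator (I n) g * dissipation v g) \<partial>lborel)
      = ennreal (fisher v (real (Suc n)) - fisher v (1 / real (Suc n)))" for n
    unfolding I_def using fisher_diff[OF _ le, of n v] pos dissipation_nonneg[of _ v]
    by (subst nn_integral_eq_integral) (auto simp: indicator_def I_def)
  have lim1: "(\<lambda>n. \<integral>\<^sup>+g. ennreal (indicator (I n) g * dissipation v g) \<partial>lborel)
      \<longlonglongrightarrow> (\<integral>\<^sup>+g. ennreal (indicator {0<..} g * dissipation v g) \<partial>lborel)"
  proof (rule nn_integral_LIMSEQ)
    have "I m \<subseteq> I n" if "m \<le> n" for m n
      using that frac_le[of 1 1 "real (Suc m)" "real (Suc n)"] by (auto simp: I_def)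
    then have "indicator (I m) g * dissipation v g \<le> indicator (I n) g * dissipation v g" if "m \<le> n" for m n g
      using dissipation_nonneg[OF pos, of g n v] that by (auto simp: indicator_def)
    then show "incseq (\<lambda>n g. ennreal (indicator (I n) g * dissipation v g))"
      by (intro monoI le_funI ennreal_leI)
    show "(\<lambda>g. ennreal (indicator (I n) g * dissipation v g)) \<in> borel_measurable lborel" for n
      unfolding I_def by measurable
    show "(\<lambda>n. ennreal (indicator (I n) g * dissipation v g)) \<longlonglongrightarrow> ennreal (indicator {0<..} g * dissipation v g)" for g
    proof (cases "0 < g")
      case True
      have "eventually (\<lambda>n. g \<in> I n) sequentially"
        using eventually_ge_at_top[of "nat \<lceil>max g (1 / g)\<rceil>"]
      proof eventually_elim
        case (elim n)
        then have "max g (1 / g) \<le> real (Suc n)" by linarith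
        then show ?case using True by (auto simp: I_def field_simps)
      qed
      then show ?thesis
        by (intro tendsto_eventually) (auto elim!: eventually_mono simp: True)
    next
      case False
      then have "g \<notin> I n" for n using pos by blast
      then show ?thesis using False by simp
    qed
  qed
  have z: "(\<lambda>n. fisher v (1 / real (Suc n))) \<longlonglongrightarrow> 0"
  proof (rule tendsto_sandwich[OF _ _ tendsto_const])
    show "\<forall>\<^sub>F n in sequentially. 0 \<le> fisher v (1 / real (Suc n))"
      by (intro always_eventually allI fisher_nonneg) simp
    show "\<forall>\<^sub>F n in sequentially. fisher v (1 / real (Suc n)) \<le> 4 * (norm v)\<^sup>2 * 2 powr (real CARD('n) / 2) * inverse (real (Suc n))"
      using fisher_le_linear[of "1 / real (Suc _)" v]
      by (intro always_eventually allI) (simp add: field_simps)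
    show "(\<lambda>n. 4 * (norm v)\<^sup>2 * 2 powr (real CARD('n) / 2) * inverse (real (Suc n))) \<longlonglongrightarrow> 0"
      by (rule tendsto_mult_right_zero[OF LIMSEQ_inverse_real_of_nat])
  qed
  have "(\<lambda>n. ennreal (fisher v (real (Suc n)) - fisher v (1 / real (Suc n)))) \<longlonglongrightarrow> ennreal ((LBINT z. (dp z)\<^sup>2 / p z) - 0)"
    by (intro tendsto_ennrealI tendsto_diff fisher_tendsto cont_p cont_dp z)
  with lim1 show ?thesis unfolding val by (auto intro: LIMSEQ_unique)
qed

end

end


section \<open>Score, Hessian and posterior covariance\<close>

lemma gradient_eqI:
  assumes "GDERIV f x :> D"
  shows "gradient f x = D"
  unfolding gradient_def
proof (rule the_equality[where P = "\<lambda>D. GDERIV f x :> D", OF assms])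
  fix D' assume "GDERIV f x :> D'"
  then have "(\<lambda>h. h \<bullet> D') = (\<lambda>h. h \<bullet> D)"
    using assms unfolding gderiv_def by (rule has_derivative_unique)
  then show "D' = D" by (metis vector_eq_ldot)
qed

lemma hessian_eqI:
  assumes "(gradient f has_derivative (\<lambda>h. H *v h)) (at x)"
  shows "hessian f x = H"
  unfolding hessian_def
proof (rule the_equality[where P = "\<lambda>H. (gradient f has_derivative (\<lambda>h. H *v h)) (at x)", OF assms])
  fix H' assume "(gradient f has_derivative (\<lambda>h. H' *v h)) (at x)"
  then have "(\<lambda>h. H' *v h) = (\<lambda>h. H *v h)"
    using assms by (rule has_derivative_unique)
  then show "H' = H" by (simp add: matrix_eq fun_eq_iff)
qed

lemma integrable_componentwise:
  fixes f :: "'a \<Rightarrow> 'b::euclidean_space"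
  assumes "\<And>b. b \<in> Basis \<Longrightarrow> integrable M (\<lambda>x. f x \<bullet> b)"
  shows "integrable M f"
proof -
  have "integrable M (\<lambda>x. \<Sum>b\<in>Basis. (f x \<bullet> b) *\<^sub>R b)"
    using assms by (intro Bochner_Integration.integrable_sum integrable_scaleR_left) auto
  then show ?thesis by (simp add: euclidean_representation)
qed

lemma matrix_nth_eq_inner: "(M :: real^'n^'m) $ i $ j = M \<bullet> axis i (axis j 1)"
  by (simp add: inner_axis)

context pos_density
begin

lemma dhess_sym: "dhess v w g u = dhess w v g u"
  by (simp add: dhess_def inner_commute mult.commute)

lemma dhess_linear: "0 < g \<Longrightarrow> linear (\<lambda>w. dhess v w g u)"
  using has_derivative_linear[OF dscore_has_derivative] .

lemma dscore_linear:
  assumes "0 < g" shows "linear (\<lambda>v. dscore v g u)"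
proof (rule linearI)
  show "dscore (v + w) g u = dscore v g u + dscore w g u" for v w
    using assms by (simp add: dscore_def inner_add_right post_add egrow_intros algebra_simps)
  show "dscore (c *\<^sub>R v) g u = c *\<^sub>R dscore v g u" for c v
    by (simp add: dscore_def post_cmult)
qed

text \<open>Chain rule for \<open>u = y / g\<close>: each derivative in \<open>y\<close> costs a
  factor \<open>1 / g\<close>, hence the division by \<open>g\<^sup>2\<close> here and by
  \<open>g\<close> in \<open>svec\<close>.\<close>

definition hmat :: "real \<Rightarrow> real^'n \<Rightarrow> real^'n^'n" where
  "hmat g u = (\<chi> i j. dhess (axis i 1) (axis j 1) g u / g\<^sup>2)"

definition svec :: "real \<Rightarrow> real^'n \<Rightarrow> real^'n" where
  "svec g u = (\<chi> i. dscore (axis i 1) g u / g)"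

lemma inner_svec:
  assumes "0 < g"
  shows "v \<bullet> svec g u = dscore v g u / g"
proof -
  have "dscore v g u = dscore (\<Sum>i\<in>UNIV. v $ i *\<^sub>R axis i 1) g u"
    by (simp add: basis_expansion scalar_mult_eq_scaleR[symmetric])
  also have "\<dots> = (\<Sum>i\<in>UNIV. v $ i * dscore (axis i 1) g u)"
    by (simp add: linear_sum[OF dscore_linear[OF assms]] linear_scale[OF dscore_linear[OF assms]])
  finally show ?thesis by (simp add: svec_def inner_vec_def sum_divide_distrib)
qed

lemma inner_hmat:
  assumes "0 < g"
  shows "v \<bullet> (hmat g u *v w) = dhess v w g u / g\<^sup>2"
proof -
  have ex: "dhess v' w' g u = (\<Sum>j\<in>UNIV. w' $ j * dhess v' (axis j 1) g u)" for v' w'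
  proof -
    have "dhess v' w' g u = dhess v' (\<Sum>j\<in>UNIV. w' $ j *\<^sub>R axis j 1) g u"
      by (simp add: basis_expansion scalar_mult_eq_scaleR[symmetric])
    then show ?thesis
      by (simp add: linear_sum[OF dhess_linear[OF assms]] linear_scale[OF dhess_linear[OF assms]])
  qed
  have "dhess v w g u = (\<Sum>i\<in>UNIV. v $ i * dhess (axis i 1) w g u)"
    using ex[of w v] by (simp add: dhess_sym[of w])
  also have "\<dots> = (\<Sum>i\<in>UNIV. v $ i * (\<Sum>j\<in>UNIV. w $ j * dhess (axis i 1) (axis j 1) g u))"
    by (subst ex) (rule refl)
  finally show ?thesis
    by (simp add: hmat_def inner_vec_def matrix_vector_mult_def sum_divide_distrib sum_distrib_left mult_ac)
qed

lemma hmat_transpose: "transpose (hmat g u) = hmat g u"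
  by (simp add: hmat_def transpose_def vec_eq_iff dhess_sym)

lemma py_eq:
  assumes "0 < g"
  shows "py p g y = g powr (- real CARD('n)) * q g (y /\<^sub>R g)"
proof -
  have "y - g *\<^sub>R x = g *\<^sub>R (y /\<^sub>R g - x)" for x
    using assms by (simp add: algebra_simps)
  then have "gauss_dens g (y - g *\<^sub>R x) = g powr (- real CARD('n)) * kern g (y /\<^sub>R g - x)" for x
    using gauss_dens_scaleR[OF assms, where 'n = 'n] by simp
  then show ?thesis
    unfolding py_def mom_def by (subst integral_mult_right_zero[symmetric]) (simp add: mult_ac)
qed

lemma score_eq:
  assumes g: "0 < g"
  shows "score p g y = svec g (y /\<^sub>R g)"
proof -
  have l: "((\<lambda>y. y /\<^sub>R g) has_derivative (\<lambda>h. h /\<^sub>R g)) (at y)"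
    by (auto intro!: derivative_eq_intros)
  have q: "((\<lambda>y. q g (y /\<^sub>R g)) has_derivative (\<lambda>h. - g * (q g (y /\<^sub>R g) * P (\<lambda>z. z \<bullet> (h /\<^sub>R g)) g (y /\<^sub>R g)))) (at y)"
    by (rule has_derivative_compose[OF l q_has_derivative[OF g]])
  have "((\<lambda>u. ln (py p g u)) has_derivative (\<lambda>h. h \<bullet> svec g (y /\<^sub>R g))) (at y)"
    unfolding py_eq[OF g] inner_svec[OF g]
  proof (rule has_derivative_eq_rhs[OF DERIV_compose_FDERIV[OF DERIV_ln has_derivative_mult_right[OF q]]])
    show "0 < g powr (- real CARD('n)) * q g (y /\<^sub>R g)"
      using g q_pos[OF g] by simp
    show "(\<lambda>h. g powr (- real CARD('n)) * (- g * (q g (y /\<^sub>R g) * P (\<lambda>z. z \<bullet> (h /\<^sub>R g)) g (y /\<^sub>R g)))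
        * inverse (g powr (- real CARD('n)) * q g (y /\<^sub>R g))) = (\<lambda>h. dscore h g (y /\<^sub>R g) / g)"
      using g q_pos[OF g, of "y /\<^sub>R g"] by (simp add: fun_eq_iff dscore_def post_cmult) (simp add: field_simps)
  qed
  then show ?thesis
    unfolding score_def gderiv_def[symmetric] by (rule gradient_eqI)
qed

lemma svec_has_derivative:
  assumes g: "0 < g"
  shows "((\<lambda>y. svec g (y /\<^sub>R g)) has_derivative (\<lambda>h. hmat g (y /\<^sub>R g) *v h)) (at y)"
proof (subst has_derivative_componentwise_within, rule ballI)
  fix b :: "real^'n"
  have l: "((\<lambda>y. y /\<^sub>R g) has_derivative (\<lambda>h. h /\<^sub>R g)) (at y)"
    by (auto intro!: derivative_eq_intros)
  have s: "((\<lambda>y. dscore b g (y /\<^sub>R g) / g) has_derivative (\<lambda>h. dhess b (h /\<^sub>R g) g (y /\<^sub>R g) / g)) (at y)"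
    unfolding divide_inverse
    by (intro has_derivative_mult_left has_derivative_compose[OF l dscore_has_derivative[OF g]])
  have "(\<lambda>h. dhess b (h /\<^sub>R g) g (y /\<^sub>R g) / g) = (\<lambda>h. (hmat g (y /\<^sub>R g) *v h) \<bullet> b)"
    using g by (simp add: fun_eq_iff inner_commute[of _ b] inner_hmat linear_scale[OF dhess_linear[OF g]] power2_eq_square field_simps)
  with s show "((\<lambda>y. svec g (y /\<^sub>R g) \<bullet> b) has_derivative (\<lambda>h. (hmat g (y /\<^sub>R g) *v h) \<bullet> b)) (at y)"
    by (simp add: inner_commute[of _ b] inner_svec[OF g])
qed

lemma hess_log_eq:
  assumes g: "0 < g"
  shows "hess_log p g y = hmat g (y /\<^sub>R g)"
proof -
  have "gradient (\<lambda>u. ln (py p g u)) = (\<lambda>y. svec g (y /\<^sub>R g))"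
    using score_eq[OF g] by (simp add: score_def fun_eq_iff)
  then show ?thesis
    unfolding hess_log_def using svec_has_derivative[OF g] by (intro hessian_eqI) simp
qed

lemma post_weight:
  assumes "0 < g"
  shows "p x * gauss_dens g (y - g *\<^sub>R x) / py p g y = p x * kern g (y /\<^sub>R g - x) / q g (y /\<^sub>R g)"
proof -
  have "y - g *\<^sub>R x = g *\<^sub>R (y /\<^sub>R g - x)"
    using assms by (simp add: algebra_simps)
  then have "gauss_dens g (y - g *\<^sub>R x) = g powr (- real CARD('n)) * kern g (y /\<^sub>R g - x)"
    using gauss_dens_scaleR[OF assms, where 'n = 'n] by simp
  then show ?thesis using assms by (simp add: py_eq)
qed

text \<open>Links the vector-valued integrals in \<open>post_mean\<close> and
  \<open>post_cov\<close> to the scalar \<open>post\<close>. A component may be pulled out of the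
  integral once the vector integrand is integrable, and this is checked on the components.\<close>

lemma integral_weight_componentwise:
  fixes f :: "real^'n \<Rightarrow> 'b::euclidean_space"
  assumes g: "0 < g" and f: "\<And>b. b \<in> Basis \<Longrightarrow> egrow (\<lambda>z. f (y /\<^sub>R g - z) \<bullet> b)" and "b \<in> Basis"
  shows "((1 / py p g y) *\<^sub>R (LBINT x. (p x * gauss_dens g (y - g *\<^sub>R x)) *\<^sub>R f x)) \<bullet> b
    = P (\<lambda>z. f (y /\<^sub>R g - z) \<bullet> b) g (y /\<^sub>R g)"
proof -
  let ?u = "y /\<^sub>R g"
  let ?h = "\<lambda>x. (p x * kern g (?u - x) / q g ?u) *\<^sub>R f x"
  have c: "?h x \<bullet> b = inverse (q g ?u) * (p x * ((f (?u - (?u - x)) \<bullet> b) * kern g (?u - x)))" for x b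
    by (simp add: divide_inverse mult_ac)
  have "integrable lborel (\<lambda>x. ?h x \<bullet> b)" if "b \<in> Basis" for b
    unfolding c by (intro integrable_mult_right mom_integrable[where \<phi> = "\<lambda>z. f (?u - z) \<bullet> b"] g f that)
  then have i: "integrable lborel ?h" by (rule integrable_componentwise)
  have "(1 / py p g y) *\<^sub>R (LBINT x. (p x * gauss_dens g (y - g *\<^sub>R x)) *\<^sub>R f x)
      = (LBINT x. (1 / py p g y) *\<^sub>R ((p x * gauss_dens g (y - g *\<^sub>R x)) *\<^sub>R f x))"
    by (rule integral_scaleR_right[symmetric])
  also have "\<dots> = (LBINT x. ?h x)"
  proof -
    have "(1 / py p g y) *\<^sub>R ((p x * gauss_dens g (y - g *\<^sub>R x)) *\<^sub>R f x)
        = (p x * gauss_dens g (y - g *\<^sub>R x) / py p g y) *\<^sub>R f x" for x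
      by simp
    then show ?thesis by (simp only: post_weight[OF g])
  qed
  also have "\<dots> \<bullet> b = (LBINT x. ?h x \<bullet> b)"
    by (rule integral_inner_left[symmetric]) (rule i)
  also have "\<dots> = P (\<lambda>z. f (?u - z) \<bullet> b) g ?u"
    unfolding c by (simp add: post_def mom_def divide_inverse)
  finally show ?thesis .
qed

lemma post_mean_eq:
  assumes g: "0 < g"
  shows "post_mean p g y $ i = (y /\<^sub>R g) $ i - P1 (axis i 1) g (y /\<^sub>R g)"
proof -
  have "post_mean p g y \<bullet> axis i 1 = P (\<lambda>z. (y /\<^sub>R g - z) \<bullet> axis i 1) g (y /\<^sub>R g)"
    unfolding post_mean_def
    by (rule integral_weight_componentwise[OF g]) (auto simp: inner_diff_left axis_in_Basis_iff intro!: egrow_intros)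
  also have "\<dots> = (y /\<^sub>R g) \<bullet> axis i 1 - P1 (axis i 1) g (y /\<^sub>R g)"
    using g by (simp add: inner_diff_left post_diff post_const egrow_intros)
  finally show ?thesis by (simp add: inner_axis)
qed

text \<open>Given \<open>u\<close>, signal and noise are related by \<open>x = u - z\<close>, so
  they have the same posterior covariance, and \<open>dhess\<close> is built from just that
  covariance.\<close>

lemma post_cov_eq:
  assumes g: "0 < g"
  shows "post_cov p g y = hess_log p g y + (1 / g) *\<^sub>R mat 1"
proof -
  have "post_cov p g y $ i $ j = (hess_log p g y + (1 / g) *\<^sub>R mat 1) $ i $ j" for i j
  proof -
    let ?u = "y /\<^sub>R g"
    define m where "m k = P1 (axis k 1) g ?u" for k :: 'n
    have c: "(?u - z - post_mean p g y) $ k = - (z \<bullet> axis k 1 - m k)" for z k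
      using post_mean_eq[OF g, of y k] by (simp add: m_def inner_axis)
    have oc: "outer (?u - z - post_mean p g y) (?u - z - post_mean p g y) \<bullet> b =
       (\<Sum>k\<in>UNIV. \<Sum>l\<in>UNIV. (z \<bullet> axis k 1 - m k) * (z \<bullet> axis l 1 - m l) * (b $ k $ l))" for z b
    proof -
      have "M \<bullet> b = (\<Sum>k\<in>UNIV. \<Sum>l\<in>UNIV. M $ k $ l * b $ k $ l)" for M :: "real^'n^'n"
        by (simp add: inner_vec_def)
      then show ?thesis by (simp only: outer_def vec_lambda_beta c minus_mult_minus)
    qed
    have eg: "egrow (\<lambda>z. outer (?u - z - post_mean p g y) (?u - z - post_mean p g y) \<bullet> b)" for b
      unfolding oc by (intro post_sum(2)[OF g] egrow_intros finite)
    have "post_cov p g y $ i $ j = post_cov p g y \<bullet> axis i (axis j 1)"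
      by (rule matrix_nth_eq_inner)
    also have "\<dots> = P (\<lambda>z. outer (?u - z - post_mean p g y) (?u - z - post_mean p g y) \<bullet> axis i (axis j 1)) g ?u"
      unfolding post_cov_def
      by (rule integral_weight_componentwise[OF g eg]) (auto simp: axis_in_Basis_iff)
    also have "\<dots> = P (\<lambda>z. (z \<bullet> axis i 1 - m i) * (z \<bullet> axis j 1 - m j)) g ?u"
      unfolding matrix_nth_eq_inner[symmetric] by (simp only: outer_def vec_lambda_beta c minus_mult_minus)
    also have "\<dots> = P (\<lambda>z. (z \<bullet> axis i 1) * (z \<bullet> axis j 1) - m j * (z \<bullet> axis i 1) - m i * (z \<bullet> axis j 1) + m i * m j) g ?u"
      by (simp add: algebra_simps)
    also have "\<dots> = P (\<lambda>z. (z \<bullet> axis i 1) * (z \<bullet> axis j 1)) g ?u - m j * m i - m i * m j + m i * m j"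
    proof -
      have "P (\<lambda>z. (z \<bullet> axis i 1) * (z \<bullet> axis j 1) - m j * (z \<bullet> axis i 1) - m i * (z \<bullet> axis j 1) + m i * m j) g ?u
          = P (\<lambda>z. (z \<bullet> axis i 1) * (z \<bullet> axis j 1)) g ?u - P (\<lambda>z. m j * (z \<bullet> axis i 1)) g ?u
            - P (\<lambda>z. m i * (z \<bullet> axis j 1)) g ?u + P (\<lambda>z. m i * m j) g ?u"
        by (subst post_add post_diff, (intro g egrow_intros)+)+ (rule refl)
      then show ?thesis by (simp only: post_cmult post_const[OF g] m_def)
    qed
    also have "\<dots> = hmat g ?u $ i $ j + (1 / g) * (if i = j then 1 else 0)"
      using g by (simp add: hmat_def dhess_def m_def inner_axis_axis power2_eq_square field_simps)
    finally show ?thesis by (simp add: hess_log_eq[OF g] mat_def)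
  qed
  then show ?thesis by (simp add: vec_eq_iff)
qed

text \<open>The square removes the sign in \<open>I - g Cov = - g H\<close>. The identity holds at
  every \<open>y\<close>, so (b) follows by rewriting under both integrals, with no question of
  convergence.\<close>

lemma covariance_form:
  assumes g: "0 < g"
  shows "(mat 1 - g *\<^sub>R post_cov p g y) ** (mat 1 - g *\<^sub>R post_cov p g y)
    = g\<^sup>2 *\<^sub>R (hess_log p g y ** hess_log p g y)"
proof -
  have "mat 1 - g *\<^sub>R post_cov p g y = (- g) *\<^sub>R hess_log p g y"
    using g by (simp add: post_cov_eq scaleR_right_distrib)
  then show ?thesis
    by (simp add: vec_eq_iff matrix_matrix_mult_def sum_distrib_left power2_eq_square mult_ac)
qed

end


section \<open>Local expansion of the metric\<close>

text \<open>The norm of a matrix is here the Frobenius norm. It dominates the operator norm, so a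
  bound on the mean square of \<open>norm\<close> of the Hessian controls all directions.\<close>

lemma norm_matrix_vector_le: "norm ((M :: real^'n^'m) *v h) \<le> norm M * norm h"
proof -
  have "norm (M *v h) = L2_set (\<lambda>i. norm ((M *v h) $ i)) UNIV" by (simp add: norm_vec_def)
  also have "\<dots> \<le> L2_set (\<lambda>i. norm (M $ i) * norm h) UNIV"
    by (intro L2_set_mono) (auto simp: matrix_vector_mul_component Cauchy_Schwarz_ineq2)
  also have "\<dots> = norm M * norm h"
    by (simp add: L2_set_left_distrib norm_vec_def)
  finally show ?thesis .
qed

lemma Basis_matrixE:
  assumes "b \<in> (Basis :: (real^'n^'m) set)"
  obtains i j where "b = axis i (axis j 1)"
  using assms by (auto simp: Basis_vec_def)

lemma bounded_linear_quadratic_form: "bounded_linear (\<lambda>M::real^'n^'m. v \<bullet> (M *v w))"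
proof -
  have "linear (\<lambda>M::real^'n^'m. v \<bullet> (M *v w))"
    by (rule linearI) (simp_all add: matrix_vector_mult_add_rdistrib inner_add_right scaleR_matrix_vector_assoc[symmetric])
  then show ?thesis by (simp add: linear_conv_bounded_linear)
qed

lemma matrix_vector_mult_measurable [measurable (raw)]:
  assumes "A \<in> borel_measurable M"
  shows "(\<lambda>x. (A x :: real^'n^'m) *v w) \<in> borel_measurable M"
proof -
  have "linear (\<lambda>M::real^'n^'m. M *v w)"
    by (rule linearI) (simp_all add: matrix_vector_mult_add_rdistrib scaleR_matrix_vector_assoc[symmetric])
  then have "(\<lambda>M::real^'n^'m. M *v w) \<in> borel_measurable borel"
    by (intro borel_measurable_continuous_onI linear_continuous_on) (simp add: linear_conv_bounded_linear)
  with assms show ?thesis by (rule measurable_compose)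
qed

lemma quadratic_form_axis: "axis i 1 \<bullet> (M *v axis j 1) = (M :: real^'n^'m) $ i $ j"
  by (simp add: inner_axis' matrix_vector_mult_basis column_def)

lemma quadratic_form_square:
  assumes "transpose H = (H :: real^'n^'n)"
  shows "v \<bullet> ((H ** H) *v w) = (H *v v) \<bullet> (H *v w)"
  by (metis assms dot_lmul_matrix matrix_vector_mul_assoc transpose_matrix_vector)

lemma gauss_dens_eq_kern:
  fixes w :: "real^'n"
  assumes "0 < g" shows "gauss_dens g w = kern (1 / g) w"
proof -
  have "(2 * pi * g) powr (- real CARD('n) / 2) = (1 / g / (2 * pi)) powr (real CARD('n) / 2)"
    using assms by (simp add: powr_minus[symmetric] powr_divide powr_minus_divide mult.commute)
  then show ?thesis by (simp add: gauss_dens_def kern_def)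
qed

lemma gauss_dens_measurable [measurable (raw)]:
  assumes [measurable]: "f \<in> borel_measurable M" "h \<in> borel_measurable M"
  shows "(\<lambda>x. gauss_dens (f x) (h x)) \<in> borel_measurable M"
  unfolding gauss_dens_def by measurable

lemma gauss_dens_nonneg: "0 \<le> gauss_dens g w"
  by (simp add: gauss_dens_def)

lemma gam_range_measurable [measurable]: "gam_range \<Gamma> \<in> sets borel"
proof -
  have "{s \<in> space borel. 0 < s \<and> ereal s < \<Gamma>} \<in> sets borel" by measurable
  then show ?thesis by (simp add: gam_range_def)
qed

lemma gam_range_pos: "s \<in> gam_range \<Gamma> \<Longrightarrow> 0 < s"
  by (simp add: gam_range_def)

context pos_density
begin

lemma good_hmat [good_intros]: "0 < a \<Longrightarrow> good p a b (\<lambda>g u. hmat g u $ i $ j)"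
  unfolding hmat_def divide_inverse vec_lambda_beta
  by (intro good_intros continuous_intros) auto

lemma good_svec [good_intros]: "0 < a \<Longrightarrow> good p a b (\<lambda>g u. svec g u $ i)"
  unfolding svec_def divide_inverse vec_lambda_beta
  by (intro good_intros continuous_intros) auto

abbreviation "energy v g u \<equiv> (hmat g u *v v) \<bullet> (hmat g u *v v)"

lemma good_hmat_vec [good_intros]: "0 < a \<Longrightarrow> good p a b (\<lambda>g u. (hmat g u *v w) \<bullet> (hmat g u *v v))"
  unfolding inner_vec_def matrix_vector_mult_def vec_lambda_beta inner_real_def
  by (intro good_intros finite) auto

lemma hmat_measurable [measurable (raw)]:
  assumes "f \<in> borel_measurable M" "h \<in> borel_measurable M"
  shows "(\<lambda>x. hmat (f x) (h x)) \<in> borel_measurable M"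
proof (subst borel_measurable_euclidean_space, rule ballI)
  fix b :: "real^'n^'n" assume "b \<in> Basis"
  then obtain i j where b: "b = axis i (axis j 1)" by (rule Basis_matrixE)
  show "(\<lambda>x. hmat (f x) (h x) \<bullet> b) \<in> borel_measurable M"
    unfolding b matrix_nth_eq_inner[symmetric]
    by (rule good_measurable'[OF good_hmat[of 1 1] assms]) simp
qed

lemma hmat_square_measurable [measurable (raw)]:
  assumes "f \<in> borel_measurable M" "h \<in> borel_measurable M"
  shows "(\<lambda>x. hmat (f x) (h x) ** hmat (f x) (h x)) \<in> borel_measurable M"
proof (subst borel_measurable_euclidean_space, rule ballI)
  fix b :: "real^'n^'n" assume "b \<in> Basis"
  then obtain i j where b: "b = axis i (axis j 1)" by (rule Basis_matrixE)
  have "good p 1 1 (\<lambda>g u. \<Sum>k\<in>UNIV. hmat g u $ i $ k * hmat g u $ k $ j)"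
    by (intro good_intros finite) auto
  from good_measurable'[OF this assms]
  show "(\<lambda>x. (hmat (f x) (h x) ** hmat (f x) (h x)) \<bullet> b) \<in> borel_measurable M"
    unfolding b matrix_nth_eq_inner[symmetric] by (simp add: matrix_matrix_mult_def)
qed

lemma svec_measurable [measurable (raw)]:
  assumes "f \<in> borel_measurable M" "h \<in> borel_measurable M"
  shows "(\<lambda>x. svec (f x) (h x)) \<in> borel_measurable M"
proof (subst borel_measurable_euclidean_space, rule ballI)
  fix b :: "real^'n" assume "b \<in> Basis"
  then obtain i where b: "b = axis i 1" by (auto simp: Basis_vec_def)
  show "(\<lambda>x. svec (f x) (h x) \<bullet> b) \<in> borel_measurable M"
    unfolding b inner_axis inner_real_def mult_1_right
    by (rule good_measurable'[OF good_svec[of 1 1] assms]) simp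
qed

lemma hmat_growth:
  assumes g: "0 < g"
  shows "\<exists>C\<ge>0. \<exists>k\<ge>0. \<forall>u. norm (hmat g u) \<le> C * exp (k * norm u)"
proof -
  \<comment> \<open>A polynomial majorant of the sum of absolute values of the entries, so that the
    closure rules for \<open>good\<close> apply to it.\<close>
  let ?f = "\<lambda>g u. \<Sum>i\<in>UNIV. \<Sum>j\<in>UNIV. 1 + (hmat g u $ i $ j)\<^sup>2"
  have "good p g g ?f"
    by (intro good_intros finite continuous_intros g) auto
  from good_growth[OF g this]
  obtain C k where C: "0 \<le> C" "0 \<le> k" "\<And>u. \<bar>?f g u\<bar> \<le> C * exp (k * norm u)" by blast
  have "norm (hmat g u) \<le> ?f g u" for u
  proof -
    have "norm (hmat g u) \<le> (\<Sum>i\<in>UNIV. norm (hmat g u $ i))"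
      unfolding norm_vec_def[of "hmat g u"] by (rule L2_set_le_sum) simp
    also have "\<dots> \<le> (\<Sum>i\<in>UNIV. \<Sum>j\<in>UNIV. \<bar>hmat g u $ i $ j\<bar>)"
      by (intro sum_mono norm_le_l1_cart)
    also have "\<dots> \<le> ?f g u"
    proof (intro sum_mono)
      fix i j show "\<bar>hmat g u $ i $ j\<bar> \<le> 1 + (hmat g u $ i $ j)\<^sup>2"
        using zero_le_power2[of "\<bar>hmat g u $ i $ j\<bar> - 1"] by (simp add: power2_diff)
    qed
    finally show ?thesis .
  qed
  then have "norm (hmat g u) \<le> C * exp (k * norm u)" for u
    using C(3)[of u] by (meson abs_ge_self order_trans)
  then show ?thesis using C by blast
qed

lemma hess_log_shift: "0 < g \<Longrightarrow> hess_log p g (g *\<^sub>R z + w) = hmat g (z + w /\<^sub>R g)"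
  by (simp add: hess_log_eq scaleR_right_distrib)

lemma score_shift: "0 < g \<Longrightarrow> score p g (g *\<^sub>R z + w) = svec g (z + w /\<^sub>R g)"
  by (simp add: score_eq scaleR_right_distrib)

lemma gauss_exp_integrable:
  assumes "0 < g"
  shows "integrable lborel (\<lambda>w::real^'n. gauss_dens g w * exp (k * norm w))"
  using exp_kern_integrable[of "1 / g" k, where 'n = 'n] assms
  by (simp add: gauss_dens_eq_kern mult.commute)

lemma gauss_good_integrable:
  assumes g: "0 < g" and f: "good p g g f"
  shows "integrable lborel (\<lambda>w. gauss_dens g w * f g (z + w /\<^sub>R g))"
proof -
  obtain C k where C: "0 \<le> C" "0 \<le> k" "\<And>u. \<bar>f g u\<bar> \<le> C * exp (k * norm u)"
    using good_growth[OF assms] by blast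
  show ?thesis
  proof (rule Bochner_Integration.integrable_bound)
    show "integrable lborel (\<lambda>w::real^'n. C * exp (k * norm z) * (gauss_dens g w * exp (k / g * norm w)))"
      by (intro integrable_mult_right gauss_exp_integrable g)
    show "(\<lambda>w. gauss_dens g w * f g (z + w /\<^sub>R g)) \<in> borel_measurable lborel"
      by (intro borel_measurable_times good_measurable'[OF f]) measurable
    show "AE w in lborel. norm (gauss_dens g w * f g (z + w /\<^sub>R g)) \<le> norm (C * exp (k * norm z) * (gauss_dens g w * exp (k / g * norm w)))"
    proof (rule AE_I2)
      fix w :: "real^'n"
      have "norm (z + w /\<^sub>R g) \<le> norm z + norm w / g"
        using norm_triangle_ineq[of z "w /\<^sub>R g"] g by (simp add: divide_inverse mult.commute)
      then have "exp (k * norm (z + w /\<^sub>R g)) \<le> exp (k * norm z) * exp (k / g * norm w)"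
        using mult_left_mono[of "norm (z + w /\<^sub>R g)" "norm z + norm w / g" k] C(2)
        by (simp add: exp_add[symmetric] distrib_left)
      then have "\<bar>f g (z + w /\<^sub>R g)\<bar> \<le> C * (exp (k * norm z) * exp (k / g * norm w))"
        using C(3)[of "z + w /\<^sub>R g"] C(1) by (meson mult_left_mono order_trans)
      then have "gauss_dens g w * \<bar>f g (z + w /\<^sub>R g)\<bar> \<le> gauss_dens g w * (C * (exp (k * norm z) * exp (k / g * norm w)))"
        by (intro mult_left_mono gauss_dens_nonneg)
      then show "norm (gauss_dens g w * f g (z + w /\<^sub>R g)) \<le> norm (C * exp (k * norm z) * (gauss_dens g w * exp (k / g * norm w)))"
        using C(1) by (simp add: abs_mult gauss_dens_nonneg mult_ac)
    qed
  qed
qed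

lemma gauss_hmat_square_integrable:
  assumes g: "0 < g"
  shows "integrable lborel (\<lambda>w. gauss_dens g w *\<^sub>R (hmat g (z + w /\<^sub>R g) ** hmat g (z + w /\<^sub>R g)))"
proof (rule integrable_componentwise)
  fix b :: "real^'n^'n" assume "b \<in> Basis"
  then obtain i j where b: "b = axis i (axis j 1)" by (rule Basis_matrixE)
  have "good p g g (\<lambda>g u. \<Sum>k\<in>UNIV. hmat g u $ i $ k * hmat g u $ k $ j)"
    by (intro good_intros finite g)
  from gauss_good_integrable[OF g this]
  show "integrable lborel (\<lambda>w. gauss_dens g w *\<^sub>R (hmat g (z + w /\<^sub>R g) ** hmat g (z + w /\<^sub>R g)) \<bullet> b)"
    unfolding b matrix_nth_eq_inner[symmetric] by (simp add: matrix_matrix_mult_def)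
qed

definition hsq :: "real \<Rightarrow> real^'n \<Rightarrow> real^'n^'n" where
  "hsq g z = gexp g (\<lambda>w. hmat g (z + w /\<^sub>R g) ** hmat g (z + w /\<^sub>R g))"

lemma hsq_measurable [measurable (raw)]:
  assumes [measurable]: "f \<in> borel_measurable M" "h \<in> borel_measurable M"
  shows "(\<lambda>x. hsq (f x) (h x)) \<in> borel_measurable M"
  unfolding hsq_def gexp_def by measurable

lemma gexp_hess_square: "0 < g \<Longrightarrow> gexp g (\<lambda>w. hess_log p g (g *\<^sub>R z + w) ** hess_log p g (g *\<^sub>R z + w)) = hsq g z"
  by (simp add: hsq_def hess_log_shift)

lemma hsq_form:
  assumes g: "0 < g"
  shows "v \<bullet> (hsq g z *v w) = gexp g (\<lambda>y. (hmat g (z + y /\<^sub>R g) *v v) \<bullet> (hmat g (z + y /\<^sub>R g) *v w))"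
proof -
  interpret bounded_linear "\<lambda>M::real^'n^'n. v \<bullet> (M *v w)" by (rule bounded_linear_quadratic_form)
  show ?thesis
    unfolding hsq_def gexp_def integral_bounded_linear[OF bounded_linear_axioms gauss_hmat_square_integrable[OF g], symmetric]
    by (simp add: scaleR_matrix_vector_assoc[symmetric] quadratic_form_square[OF hmat_transpose])
qed

lemma hsq_form_nonneg: "0 < g \<Longrightarrow> 0 \<le> v \<bullet> (hsq g z *v v)"
  by (simp add: hsq_form gexp_def gauss_dens_nonneg)

lemma norm_square_expectation_le:
  assumes g: "0 < g"
    and i: "integrable lborel (\<lambda>w. gauss_dens g w * (norm (hmat g (z + w /\<^sub>R g)))\<^sup>2)"
  shows "\<bar>v \<bullet> (hsq g z *v w)\<bar> \<le> norm v * norm w * gexp g (\<lambda>w. (norm (hmat g (z + w /\<^sub>R g)))\<^sup>2)"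
proof -
  have "\<bar>v \<bullet> (hsq g z *v w)\<bar> \<le> (LBINT y. norm (gauss_dens g y * ((hmat g (z + y /\<^sub>R g) *v v) \<bullet> (hmat g (z + y /\<^sub>R g) *v w))))"
    using integral_norm_bound[of lborel "\<lambda>y. gauss_dens g y * ((hmat g (z + y /\<^sub>R g) *v v) \<bullet> (hmat g (z + y /\<^sub>R g) *v w))"]
    by (simp add: hsq_form[OF g] gexp_def)
  also have "\<dots> \<le> (LBINT y. norm v * norm w * (gauss_dens g y * (norm (hmat g (z + y /\<^sub>R g)))\<^sup>2))"
  proof (rule integral_mono)
    show "integrable lborel (\<lambda>y. norm (gauss_dens g y * ((hmat g (z + y /\<^sub>R g) *v v) \<bullet> (hmat g (z + y /\<^sub>R g) *v w))))"
      by (intro integrable_norm gauss_good_integrable[where f = "\<lambda>g u. (hmat g u *v v) \<bullet> (hmat g u *v w)"] g good_intros)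
    show "integrable lborel (\<lambda>y. norm v * norm w * (gauss_dens g y * (norm (hmat g (z + y /\<^sub>R g)))\<^sup>2))"
      using i by simp
    fix y
    let ?H = "hmat g (z + y /\<^sub>R g)"
    have "\<bar>(?H *v v) \<bullet> (?H *v w)\<bar> \<le> (norm ?H * norm v) * (norm ?H * norm w)"
      by (rule order_trans[OF Cauchy_Schwarz_ineq2]) (intro mult_mono norm_matrix_vector_le; simp)
    then have "gauss_dens g y * \<bar>(?H *v v) \<bullet> (?H *v w)\<bar> \<le> gauss_dens g y * ((norm ?H * norm v) * (norm ?H * norm w))"
      by (intro mult_left_mono gauss_dens_nonneg)
    then show "norm (gauss_dens g y * ((?H *v v) \<bullet> (?H *v w))) \<le> norm v * norm w * (gauss_dens g y * (norm ?H)\<^sup>2)"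
      by (simp add: abs_mult gauss_dens_nonneg power2_eq_square mult_ac)
  qed
  finally show ?thesis by (simp add: gexp_def)
qed

section \<open>Increments of the score at a fixed precision\<close>

lemma svec_has_derivative_scaled:
  assumes g: "0 < g"
  shows "(svec g has_derivative (\<lambda>h. g *\<^sub>R (hmat g u *v h))) (at u)"
proof -
  have l: "((\<lambda>u. g *\<^sub>R u) has_derivative (\<lambda>h. g *\<^sub>R h)) (at u)"
    by (auto intro!: derivative_eq_intros)
  have "((\<lambda>u. svec g ((g *\<^sub>R u) /\<^sub>R g)) has_derivative (\<lambda>h. hmat g ((g *\<^sub>R u) /\<^sub>R g) *v (g *\<^sub>R h))) (at u)"
    by (rule has_derivative_compose[OF l svec_has_derivative[OF g]])
  then show ?thesis using g by (simp add: matrix_vector_mult_scaleR)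
qed

text \<open>The increment \<open>v\<close> is tested against itself: \<open>(norm v)\<^sup>2\<close>
  is the integral of \<open>v\<close> times the derivative along the segment. Young's inequality
  bounds this by \<open>(norm v)\<^sup>2 / 2\<close> plus half the right-hand side, and the first
  term is absorbed on the left.\<close>

lemma square_le_integral_derivative:
  assumes g: "0 < g"
  shows "(norm (svec g (u + e) - svec g u))\<^sup>2
      \<le> (LBINT t. indicator {0..1} t * (g\<^sup>2 * (norm e)\<^sup>2 * (norm (hmat g (u + t *\<^sub>R e)))\<^sup>2))"
    and "integrable lborel (\<lambda>t. indicator {0..1::real} t * (g\<^sup>2 * (norm e)\<^sup>2 * (norm (hmat g (u + t *\<^sub>R e)))\<^sup>2))"
proof -
  let ?H = "\<lambda>t. hmat g (u + t *\<^sub>R e)"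
  define v where "v = svec g (u + e) - svec g u"
  obtain C k where C: "0 \<le> C" "0 \<le> k" "\<And>u. norm (hmat g u) \<le> C * exp (k * norm u)"
    using hmat_growth[OF g] by blast
  have Hb: "norm (?H t) \<le> C * exp (k * (norm u + norm e))" if "t \<in> {0..1}" for t
  proof -
    have "norm (u + t *\<^sub>R e) \<le> norm u + norm e"
      using that by (intro order_trans[OF norm_triangle_ineq]) (simp add: mult_left_le_one_le)
    then have "exp (k * norm (u + t *\<^sub>R e)) \<le> exp (k * (norm u + norm e))"
      using C(2) by (simp add: mult_left_mono)
    then show ?thesis using C(3)[of "u + t *\<^sub>R e"] C(1) by (meson mult_left_mono order_trans)
  qed
  have bi: "integrable lborel (\<lambda>t. indicator {0..1::real} t * f t)"
    if [measurable]: "f \<in> borel_measurable borel" and b: "\<And>t. t \<in> {0..1} \<Longrightarrow> \<bar>f t\<bar> \<le> B" for f :: "real \<Rightarrow> real" and B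
  proof (rule Bochner_Integration.integrable_bound)
    show "integrable lborel (\<lambda>t. indicator {0..1::real} t * B)"
      by (intro integrable_mult_left integrable_real_indicator) auto
    show "AE t in lborel. norm (indicator {0..1} t * f t) \<le> norm (indicator {0..1} t * B)"
      using b by (intro AE_I2) (force simp: indicator_def)
  qed measurable
  show i2: "integrable lborel (\<lambda>t. indicator {0..1::real} t * (g\<^sup>2 * (norm e)\<^sup>2 * (norm (?H t))\<^sup>2))"
    using Hb by (intro bi[where B = "g\<^sup>2 * (norm e)\<^sup>2 * (C * exp (k * (norm u + norm e)))\<^sup>2"])
      (auto simp: abs_mult intro!: mult_left_mono power_mono)
  have i1: "integrable lborel (\<lambda>t. indicator {0..1::real} t * (v \<bullet> (g *\<^sub>R (?H t *v e))))"
  proof (rule bi)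
    show "(\<lambda>t. v \<bullet> (g *\<^sub>R (?H t *v e))) \<in> borel_measurable borel" by measurable
    show "\<bar>v \<bullet> (g *\<^sub>R (?H t *v e))\<bar> \<le> norm v * (g * (C * exp (k * (norm u + norm e)) * norm e))" if "t \<in> {0..1}" for t
    proof -
      have "norm (?H t *v e) \<le> C * exp (k * (norm u + norm e)) * norm e"
        using norm_matrix_vector_le[of "?H t" e] mult_right_mono[OF Hb[OF that], of "norm e"] by simp
      then show ?thesis
        using g by (intro order_trans[OF Cauchy_Schwarz_ineq2] mult_left_mono) auto
    qed
  qed
  have d: "((\<lambda>t. v \<bullet> svec g (u + t *\<^sub>R e)) has_real_derivative v \<bullet> (g *\<^sub>R (?H t *v e))) (at t)" for t
  proof -
    have l: "((\<lambda>t::real. u + t *\<^sub>R e) has_derivative (\<lambda>t. t *\<^sub>R e)) (at t)"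
      by (auto intro!: derivative_eq_intros)
    have "((\<lambda>t. v \<bullet> svec g (u + t *\<^sub>R e)) has_derivative (\<lambda>s. v \<bullet> (g *\<^sub>R (?H t *v (s *\<^sub>R e))))) (at t)"
      by (intro has_derivative_inner_right has_derivative_compose[OF l svec_has_derivative_scaled[OF g]])
    then show ?thesis
      unfolding has_field_derivative_def by (rule has_derivative_eq_rhs) (simp add: fun_eq_iff matrix_vector_mult_scaleR)
  qed
  have "(norm v)\<^sup>2 = v \<bullet> svec g (u + 1 *\<^sub>R e) - v \<bullet> svec g (u + 0 *\<^sub>R e)"
    by (simp add: v_def power2_norm_eq_inner inner_diff_right)
  also have "\<dots> = (LBINT t. indicator {0..1} t * (v \<bullet> (g *\<^sub>R (?H t *v e))))"
    using d i1 by (intro integral_derivative_eq_diff[symmetric]) auto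
  also have "\<dots> \<le> (LBINT t. indicator {0..1} t * ((norm v)\<^sup>2 / 2) + indicator {0..1} t * (g\<^sup>2 * (norm e)\<^sup>2 * (norm (?H t))\<^sup>2) / 2)"
  proof (rule integral_mono[OF i1])
    show "integrable lborel (\<lambda>t. indicator {0..1} t * ((norm v)\<^sup>2 / 2) + indicator {0..1::real} t * (g\<^sup>2 * (norm e)\<^sup>2 * (norm (?H t))\<^sup>2) / 2)"
      using i2 by (intro Bochner_Integration.integrable_add integrable_divide integrable_mult_left integrable_real_indicator) auto
    fix t :: real
    have "v \<bullet> (g *\<^sub>R (?H t *v e)) \<le> norm v * (g * norm (?H t) * norm e)"
      using norm_matrix_vector_le[of "?H t" e] g
      by (intro order_trans[OF norm_cauchy_schwarz] mult_left_mono) (auto simp: mult.assoc)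
    also have "\<dots> \<le> (norm v)\<^sup>2 / 2 + g\<^sup>2 * (norm e)\<^sup>2 * (norm (?H t))\<^sup>2 / 2"
      using zero_le_power2[of "norm v - g * norm (?H t) * norm e"] by (simp add: power2_diff power_mult_distrib mult_ac)
    finally show "indicator {0..1} t * (v \<bullet> (g *\<^sub>R (?H t *v e)))
      \<le> indicator {0..1} t * ((norm v)\<^sup>2 / 2) + indicator {0..1} t * (g\<^sup>2 * (norm e)\<^sup>2 * (norm (?H t))\<^sup>2) / 2"
      by (simp add: indicator_def)
  qed
  also have "\<dots> = (norm v)\<^sup>2 / 2 + (LBINT t. indicator {0..1} t * (g\<^sup>2 * (norm e)\<^sup>2 * (norm (?H t))\<^sup>2)) / 2"
    using i2 by (subst Bochner_Integration.integral_add) auto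
  finally show "(norm (svec g (u + e) - svec g u))\<^sup>2
      \<le> (LBINT t. indicator {0..1} t * (g\<^sup>2 * (norm e)\<^sup>2 * (norm (?H t))\<^sup>2))"
    by (simp add: v_def)
qed

definition sdist :: "real \<Rightarrow> real^'n \<Rightarrow> real^'n \<Rightarrow> real" where
  "sdist g x e = gexp g (\<lambda>w. (norm (svec g (x + w /\<^sub>R g) - svec g (x + e + w /\<^sub>R g)))\<^sup>2)"

lemma sdist_nonneg: "0 \<le> sdist g x e"
  unfolding sdist_def gexp_def by (intro integral_nonneg_AE AE_I2) (simp add: gauss_dens_nonneg)

lemma sdist_measurable [measurable]: "(\<lambda>g. sdist g x e) \<in> borel_measurable borel"
  unfolding sdist_def gexp_def by measurable

lemma sdist_integrable:
  assumes g: "0 < g"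
  shows "integrable lborel (\<lambda>w. gauss_dens g w * (norm (svec g (x + w /\<^sub>R g) - svec g (x + e + w /\<^sub>R g)))\<^sup>2)"
proof -
  have s: "integrable lborel (\<lambda>w. gauss_dens g w * (norm (svec g (z + w /\<^sub>R g)))\<^sup>2)" for z
    unfolding power2_norm_eq_inner inner_vec_def inner_real_def
    by (intro gauss_good_integrable[where f = "\<lambda>g u. \<Sum>i\<in>UNIV. svec g u $ i * svec g u $ i"] g good_intros finite)
  show ?thesis
  proof (rule Bochner_Integration.integrable_bound)
    show "integrable lborel (\<lambda>w. 2 * (gauss_dens g w * (norm (svec g (x + w /\<^sub>R g)))\<^sup>2) + 2 * (gauss_dens g w * (norm (svec g (x + e + w /\<^sub>R g)))\<^sup>2))"
      using s[of x] s[of "x + e"] by simp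
    show "AE w in lborel. norm (gauss_dens g w * (norm (svec g (x + w /\<^sub>R g) - svec g (x + e + w /\<^sub>R g)))\<^sup>2)
      \<le> norm (2 * (gauss_dens g w * (norm (svec g (x + w /\<^sub>R g)))\<^sup>2) + 2 * (gauss_dens g w * (norm (svec g (x + e + w /\<^sub>R g)))\<^sup>2))"
    proof (rule AE_I2)
      fix w
      let ?a = "svec g (x + w /\<^sub>R g)" and ?b = "svec g (x + e + w /\<^sub>R g)"
      have "(norm (?a - ?b))\<^sup>2 \<le> (norm ?a + norm ?b)\<^sup>2"
        by (intro power_mono norm_triangle_ineq4) simp
      also have "\<dots> \<le> 2 * (norm ?a)\<^sup>2 + 2 * (norm ?b)\<^sup>2"
        using zero_le_power2[of "norm ?a - norm ?b"] by (simp add: power2_diff power2_sum)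
      finally have "gauss_dens g w * (norm (?a - ?b))\<^sup>2 \<le> gauss_dens g w * (2 * (norm ?a)\<^sup>2 + 2 * (norm ?b)\<^sup>2)"
        by (intro mult_left_mono gauss_dens_nonneg)
      then show "norm (gauss_dens g w * (norm (?a - ?b))\<^sup>2) \<le> norm (2 * (gauss_dens g w * (norm ?a)\<^sup>2) + 2 * (gauss_dens g w * (norm ?b)\<^sup>2))"
        by (simp add: gauss_dens_nonneg distrib_left mult_ac)
    qed
  qed measurable
qed

text \<open>Tonelli exchanges the average over the segment with the average over the noise. The mean
  squared Hessian is then evaluated at every point \<open>x + t *\<^sub>R e\<close>, which is why
  the domination is required in a neighbourhood of \<open>x\<close>.\<close>

lemma sdist_le:
  assumes g: "0 < g"
    and i: "\<And>t. t \<in> {0..1} \<Longrightarrow> integrable lborel (\<lambda>w. gauss_dens g w * (norm (hmat g (x + t *\<^sub>R e + w /\<^sub>R g)))\<^sup>2)"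
    and b: "\<And>t. t \<in> {0..1} \<Longrightarrow> g\<^sup>2 * gexp g (\<lambda>w. (norm (hmat g (x + t *\<^sub>R e + w /\<^sub>R g)))\<^sup>2) \<le> B"
  shows "sdist g x e \<le> (norm e)\<^sup>2 * B"
proof -
  have B: "0 \<le> B"
  proof -
    have "0 \<le> g\<^sup>2 * gexp g (\<lambda>w. (norm (hmat g (x + 0 *\<^sub>R e + w /\<^sub>R g)))\<^sup>2)"
      unfolding gexp_def by (intro mult_nonneg_nonneg integral_nonneg_AE AE_I2) (simp_all add: gauss_dens_nonneg)
    also have "\<dots> \<le> B" by (rule b) simp
    finally show ?thesis .
  qed
  let ?f = "\<lambda>w t. ennreal (gauss_dens g w) * ennreal (indicator {0..1} t * (g\<^sup>2 * (norm e)\<^sup>2 * (norm (hmat g (x + t *\<^sub>R e + w /\<^sub>R g)))\<^sup>2))"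
  have "ennreal (sdist g x e) = (\<integral>\<^sup>+w. ennreal (gauss_dens g w * (norm (svec g (x + w /\<^sub>R g) - svec g (x + e + w /\<^sub>R g)))\<^sup>2) \<partial>lborel)"
    unfolding sdist_def gexp_def using sdist_integrable[OF g, of x e]
    by (subst nn_integral_eq_integral) (auto simp: gauss_dens_nonneg)
  also have "\<dots> \<le> (\<integral>\<^sup>+w. \<integral>\<^sup>+t. ?f w t \<partial>lborel \<partial>lborel)"
  proof (rule nn_integral_mono)
    fix w :: "real^'n"
    let ?u = "x + w /\<^sub>R g"
    have eq: "x + t *\<^sub>R e + w /\<^sub>R g = ?u + t *\<^sub>R e" for t by (simp add: algebra_simps)
    have "(norm (svec g ?u - svec g (x + e + w /\<^sub>R g)))\<^sup>2 = (norm (svec g (?u + e) - svec g ?u))\<^sup>2"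
      by (subst norm_minus_commute) (simp add: algebra_simps)
    also have "ennreal \<dots> \<le> ennreal (LBINT t. indicator {0..1} t * (g\<^sup>2 * (norm e)\<^sup>2 * (norm (hmat g (?u + t *\<^sub>R e)))\<^sup>2))"
      by (intro ennreal_leI square_le_integral_derivative g)
    also have "\<dots> = (\<integral>\<^sup>+t. ennreal (indicator {0..1} t * (g\<^sup>2 * (norm e)\<^sup>2 * (norm (hmat g (?u + t *\<^sub>R e)))\<^sup>2)) \<partial>lborel)"
      by (intro nn_integral_eq_integral[symmetric] square_le_integral_derivative(2) g AE_I2) simp
    finally have "ennreal (gauss_dens g w) * ennreal ((norm (svec g ?u - svec g (x + e + w /\<^sub>R g)))\<^sup>2)
        \<le> ennreal (gauss_dens g w) * (\<integral>\<^sup>+t. ennreal (indicator {0..1} t * (g\<^sup>2 * (norm e)\<^sup>2 * (norm (hmat g (?u + t *\<^sub>R e)))\<^sup>2)) \<partial>lborel)"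
      by (intro mult_left_mono) auto
    then show "ennreal (gauss_dens g w * (norm (svec g ?u - svec g (x + e + w /\<^sub>R g)))\<^sup>2) \<le> (\<integral>\<^sup>+t. ?f w t \<partial>lborel)"
      unfolding eq by (subst nn_integral_cmult) (simp_all add: ennreal_mult gauss_dens_nonneg)
  qed
  also have "\<dots> = (\<integral>\<^sup>+t. \<integral>\<^sup>+w. ?f w t \<partial>lborel \<partial>lborel)"
    by (rule lborel_pair.Fubini') measurable
  also have "\<dots> \<le> (\<integral>\<^sup>+t. ennreal ((norm e)\<^sup>2 * B) * indicator {0..1::real} t \<partial>lborel)"
  proof (rule nn_integral_mono)
    fix t :: real
    show "(\<integral>\<^sup>+w. ?f w t \<partial>lborel) \<le> ennreal ((norm e)\<^sup>2 * B) * indicator {0..1} t"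
    proof (cases "t \<in> {0..1}")
      case True
      have "(\<integral>\<^sup>+w. ?f w t \<partial>lborel) = (\<integral>\<^sup>+w. ennreal (g\<^sup>2 * (norm e)\<^sup>2 * (gauss_dens g w * (norm (hmat g (x + t *\<^sub>R e + w /\<^sub>R g)))\<^sup>2)) \<partial>lborel)"
        using True by (intro nn_integral_cong) (simp add: ennreal_mult[symmetric] gauss_dens_nonneg mult_ac)
      also have "\<dots> = ennreal (g\<^sup>2 * (norm e)\<^sup>2 * gexp g (\<lambda>w. (norm (hmat g (x + t *\<^sub>R e + w /\<^sub>R g)))\<^sup>2))"
        unfolding gexp_def using i[OF True]
        by (subst nn_integral_eq_integral) (auto simp: gauss_dens_nonneg)
      also have "\<dots> \<le> ennreal ((norm e)\<^sup>2 * B)"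
        using mult_left_mono[OF b[OF True], of "(norm e)\<^sup>2"] by (intro ennreal_leI) (simp add: mult_ac)
      finally show ?thesis using True by simp
    qed simp
  qed
  also have "\<dots> = ennreal ((norm e)\<^sup>2 * B)" by (simp add: nn_integral_cmult)
  finally show ?thesis using B by (simp add: ennreal_le_iff)
qed

text \<open>The direction of \<open>X n\<close> need not converge, so the quadratic form is
  subtracted before passing to the limit. Difference quotient \<open>a\<close> and linear part
  \<open>b\<close> have a common bound \<open>K\<close>, and the difference of their squared norms
  is at most \<open>norm (a - b)\<close> times \<open>2 * K\<close>.\<close>

lemma sdist_difference_tendsto:
  assumes g: "0 < g" and X: "\<And>n. X n \<noteq> 0" "\<And>n. norm (X n) \<le> 1" "X \<longlonglongrightarrow> 0"
  shows "(\<lambda>n. (sdist g x (X n) - g\<^sup>2 * (X n \<bullet> (hsq g x *v X n))) / (norm (X n))\<^sup>2) \<longlonglongrightarrow> 0"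
proof -
  obtain C k where C: "0 \<le> C" "0 \<le> k" "\<And>u. norm (hmat g u) \<le> C * exp (k * norm u)"
    using hmat_growth[OF g] by blast
  \<comment> \<open>Bounds the derivative of \<open>svec\<close> on the unit ball around
    \<open>x + w /\<^sub>R g\<close>; the 1 pays for \<open>norm (X n) \<le> 1\<close>. It is
    exponential in \<open>norm w\<close>, so its square is integrable against the Gaussian.\<close>
  define K where "K w = g * (C * exp (k * (norm x + 1)) * exp (k / g * norm w))" for w :: "real^'n"
  have K0: "0 \<le> K w" for w using g C by (simp add: K_def)
  define a where "a n w = (svec g (x + X n + w /\<^sub>R g) - svec g (x + w /\<^sub>R g)) /\<^sub>R norm (X n)" for n w
  define b where "b n w = (g *\<^sub>R (hmat g (x + w /\<^sub>R g) *v X n)) /\<^sub>R norm (X n)" for n w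
  have Hb: "g * norm (hmat g u) \<le> K w" if "u \<in> cball (x + w /\<^sub>R g) 1" for u w
  proof -
    have "norm u \<le> norm (x + w /\<^sub>R g) + 1"
      using that norm_triangle_ineq2[of u "x + w /\<^sub>R g"] by (simp add: dist_norm norm_minus_commute)
    also have "\<dots> \<le> norm x + norm w / g + 1"
      using norm_triangle_ineq[of x "w /\<^sub>R g"] g by (simp add: divide_inverse mult.commute)
    finally have "k * norm u \<le> k * (norm x + norm w / g + 1)"
      using C(2) by (rule mult_left_mono)
    then have "exp (k * norm u) \<le> exp (k * (norm x + 1)) * exp (k / g * norm w)"
      by (simp add: exp_add[symmetric] algebra_simps)
    then have "norm (hmat g u) \<le> C * (exp (k * (norm x + 1)) * exp (k / g * norm w))"
      using C(3)[of u] C(1) by (meson mult_left_mono order_trans)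
    then show ?thesis using g by (simp add: K_def mult.assoc)
  qed
  have b_le: "norm (b n w) \<le> K w" for n w
  proof -
    have "norm (g *\<^sub>R (hmat g (x + w /\<^sub>R g) *v X n)) \<le> g * norm (hmat g (x + w /\<^sub>R g)) * norm (X n)"
      using norm_matrix_vector_le[of "hmat g (x + w /\<^sub>R g)" "X n"] g by simp
    also have "\<dots> \<le> K w * norm (X n)"
      by (intro mult_right_mono Hb) auto
    finally show ?thesis using X(1)[of n] by (simp add: b_def field_simps)
  qed
  have a_le: "norm (a n w) \<le> K w" for n w
  proof -
    let ?u = "x + w /\<^sub>R g"
    have "norm (svec g (?u + X n) - svec g ?u) \<le> K w * norm ((?u + X n) - ?u)"
    proof (rule differentiable_bound[where S = "cball ?u 1" and f' = "\<lambda>u h. g *\<^sub>R (hmat g u *v h)"])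
      show "(svec g has_derivative (\<lambda>h. g *\<^sub>R (hmat g u *v h))) (at u within cball ?u 1)" for u
        using svec_has_derivative_scaled[OF g] by (rule has_derivative_at_withinI)
      show "onorm (\<lambda>h. g *\<^sub>R (hmat g u *v h)) \<le> K w" if "u \<in> cball ?u 1" for u
      proof (rule onorm_bound[OF K0])
        fix h
        have "norm (g *\<^sub>R (hmat g u *v h)) \<le> g * norm (hmat g u) * norm h"
          using norm_matrix_vector_le[of "hmat g u" h] g by simp
        also have "\<dots> \<le> K w * norm h" by (intro mult_right_mono Hb that) simp
        finally show "norm (g *\<^sub>R (hmat g u *v h)) \<le> K w * norm h" .
      qed
    qed (use X(2)[of n] in \<open>auto simp: dist_norm\<close>)
    moreover have "norm (a n w) = norm (svec g (?u + X n) - svec g ?u) / norm (X n)"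
    proof -
      have e: "x + X n + w /\<^sub>R g = ?u + X n" by (simp add: algebra_simps)
      show ?thesis unfolding a_def e by (simp add: divide_inverse mult.commute)
    qed
    ultimately show ?thesis using X(1)[of n] by (simp add: pos_divide_le_eq)
  qed
  have ab: "(\<lambda>n. norm (a n w - b n w)) \<longlonglongrightarrow> 0" for w
  proof -
    let ?u = "x + w /\<^sub>R g"
    have "((\<lambda>h. norm (svec g (?u + h) - svec g ?u - g *\<^sub>R (hmat g ?u *v h)) / norm h) \<longlongrightarrow> 0) (at 0)"
      using svec_has_derivative_scaled[OF g, of ?u] unfolding has_derivative_at by simp
    moreover have "filterlim X (at 0) sequentially"
      using X by (auto simp: filterlim_at)
    ultimately have "(\<lambda>n. norm (svec g (?u + X n) - svec g ?u - g *\<^sub>R (hmat g ?u *v X n)) / norm (X n)) \<longlonglongrightarrow> 0"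
      by (rule filterlim_compose)
    moreover have "norm (a n w - b n w) = norm (svec g (?u + X n) - svec g ?u - g *\<^sub>R (hmat g ?u *v X n)) / norm (X n)" for n
    proof -
      have e: "x + X n + w /\<^sub>R g = ?u + X n" by (simp add: algebra_simps)
      show ?thesis
        unfolding a_def b_def e scaleR_diff_right[symmetric] by (simp add: divide_inverse mult.commute)
    qed
    ultimately show ?thesis by simp
  qed
  have eq: "(sdist g x (X n) - g\<^sup>2 * (X n \<bullet> (hsq g x *v X n))) / (norm (X n))\<^sup>2
      = (LBINT w. gauss_dens g w * ((norm (a n w))\<^sup>2 - (norm (b n w))\<^sup>2))" for n
  proof -
    let ?A = "\<lambda>w. gauss_dens g w * (norm (svec g (x + w /\<^sub>R g) - svec g (x + X n + w /\<^sub>R g)))\<^sup>2"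
    let ?B = "\<lambda>w. gauss_dens g w * (energy (X n) g (x + w /\<^sub>R g))"
    have A: "integrable lborel ?A" by (rule sdist_integrable[OF g])
    have B: "integrable lborel ?B"
      by (intro gauss_good_integrable[where f = "\<lambda>g u. energy (X n) g u"] g good_intros)
    have "gauss_dens g w * ((norm (a n w))\<^sup>2 - (norm (b n w))\<^sup>2) = (?A w - g\<^sup>2 * ?B w) / (norm (X n))\<^sup>2" for w
    proof -
      have "(norm (a n w))\<^sup>2 = (norm (svec g (x + w /\<^sub>R g) - svec g (x + X n + w /\<^sub>R g)))\<^sup>2 / (norm (X n))\<^sup>2"
        unfolding a_def norm_minus_commute[of "svec g (x + w /\<^sub>R g)"]
        by (simp only: norm_scaleR) (simp add: power_mult_distrib power_inverse divide_inverse mult.commute)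
      moreover have "(norm (b n w))\<^sup>2 = g\<^sup>2 * (energy (X n) g (x + w /\<^sub>R g)) / (norm (X n))\<^sup>2"
        unfolding b_def
        by (simp only: norm_scaleR power_mult_distrib power2_norm_eq_inner) (simp add: power_inverse divide_inverse mult_ac power2_norm_eq_inner)
      ultimately show ?thesis by (simp only:) (simp add: right_diff_distrib diff_divide_distrib mult_ac)
    qed
    then have "(LBINT w. gauss_dens g w * ((norm (a n w))\<^sup>2 - (norm (b n w))\<^sup>2)) = (LBINT w. (?A w - g\<^sup>2 * ?B w) / (norm (X n))\<^sup>2)"
      by simp
    also have "\<dots> = (sdist g x (X n) - g\<^sup>2 * (X n \<bullet> (hsq g x *v X n))) / (norm (X n))\<^sup>2"
      using A B by (simp add: sdist_def hsq_form[OF g] gexp_def)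
    finally show ?thesis by simp
  qed
  have "(\<lambda>n. (LBINT w. gauss_dens g w * ((norm (a n w))\<^sup>2 - (norm (b n w))\<^sup>2))) \<longlonglongrightarrow> (\<integral>w. 0 \<partial>(lborel :: (real^'n) measure))"
  proof (rule integral_dominated_convergence[where w = "\<lambda>w. gauss_dens g w * (K w)\<^sup>2"])
    have "(K w)\<^sup>2 = (g * (C * exp (k * (norm x + 1))))\<^sup>2 * exp (2 * k / g * norm w)" for w
      by (simp add: K_def power_mult_distrib exp_double[symmetric])
    then have "gauss_dens g w * (K w)\<^sup>2 = (g * (C * exp (k * (norm x + 1))))\<^sup>2 * (gauss_dens g w * exp (2 * k / g * norm w))" for w
      by simp
    then show "integrable lborel (\<lambda>w. gauss_dens g w * (K w)\<^sup>2)"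
      by (simp only:) (intro integrable_mult_right gauss_exp_integrable g)
    show "AE w in lborel. (\<lambda>n. gauss_dens g w * ((norm (a n w))\<^sup>2 - (norm (b n w))\<^sup>2)) \<longlonglongrightarrow> 0"
    proof (rule AE_I2, rule tendsto_mult_right_zero, rule tendsto_rabs_zero_cancel)
      fix w
      have lim: "(\<lambda>n. norm (a n w - b n w) * (2 * K w)) \<longlonglongrightarrow> 0"
        using tendsto_mult_left_zero[OF ab] .
      have le: "\<bar>(norm (a n w))\<^sup>2 - (norm (b n w))\<^sup>2\<bar> \<le> norm (a n w - b n w) * (2 * K w)" for n
      proof -
        have "(norm (a n w))\<^sup>2 - (norm (b n w))\<^sup>2 = (norm (a n w) - norm (b n w)) * (norm (a n w) + norm (b n w))"
          by (simp add: power2_eq_square algebra_simps)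
        also have "\<bar>\<dots>\<bar> \<le> norm (a n w - b n w) * (2 * K w)"
          unfolding abs_mult using a_le[of n w] b_le[of n w] norm_triangle_ineq3[of "a n w" "b n w"]
          by (intro mult_mono) auto
        finally show ?thesis .
      qed
      show "(\<lambda>n. \<bar>(norm (a n w))\<^sup>2 - (norm (b n w))\<^sup>2\<bar>) \<longlonglongrightarrow> 0"
        by (rule tendsto_sandwich[OF _ _ tendsto_const lim]) (use le in \<open>simp_all add: always_eventually\<close>)
    qed
    show "AE w in lborel. norm (gauss_dens g w * ((norm (a n w))\<^sup>2 - (norm (b n w))\<^sup>2)) \<le> gauss_dens g w * (K w)\<^sup>2" for n
    proof (rule AE_I2)
      fix w
      have "(norm (a n w))\<^sup>2 \<le> (K w)\<^sup>2" "(norm (b n w))\<^sup>2 \<le> (K w)\<^sup>2"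
        using a_le b_le by (auto intro: power_mono)
      then have "\<bar>(norm (a n w))\<^sup>2 - (norm (b n w))\<^sup>2\<bar> \<le> (K w)\<^sup>2"
        using zero_le_power2[of "norm (a n w)"] zero_le_power2[of "norm (b n w)"] by linarith
      then show "norm (gauss_dens g w * ((norm (a n w))\<^sup>2 - (norm (b n w))\<^sup>2)) \<le> gauss_dens g w * (K w)\<^sup>2"
        by (simp add: abs_mult gauss_dens_nonneg mult_left_mono)
    qed
    show "(\<lambda>w. gauss_dens g w * ((norm (a n w))\<^sup>2 - (norm (b n w))\<^sup>2)) \<in> borel_measurable lborel" for n
      unfolding a_def b_def by measurable
  qed simp
  then show ?thesis unfolding eq by simp
qed

end


section \<open>Quadratic forms of \<open>Gmat\<close>, the averaged energy, and integration over the
  precision\<close>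

lemma gexp_scaleR: "gexp g (\<lambda>w. c *\<^sub>R f w) = c *\<^sub>R gexp g f"
proof -
  have "gexp g (\<lambda>w. c *\<^sub>R f w) = (LBINT w. c *\<^sub>R (gauss_dens g w *\<^sub>R f w))"
    unfolding gexp_def by (simp add: mult.commute)
  then show ?thesis by (simp only: integral_scaleR_right gexp_def)
qed

text \<open>Polarisation. It reduces the matrix equation in (c) to the diagonal forms, where all
  integrands are nonnegative.\<close>

lemma matrix_eq_quadratic_form:
  fixes A B :: "real^'n^'n"
  assumes "\<And>v w. v \<bullet> (A *v w) = w \<bullet> (A *v v)" "\<And>v w. v \<bullet> (B *v w) = w \<bullet> (B *v v)"
    and "\<And>v. v \<bullet> (A *v v) = v \<bullet> (B *v v)"
  shows "A = B"
proof -
  have "A $ i $ j = B $ i $ j" for i j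
  proof -
    let ?v = "axis i (1::real) :: real^'n" and ?w = "axis j (1::real) :: real^'n"
    have "(?v + ?w) \<bullet> (A *v (?v + ?w)) = (?v + ?w) \<bullet> (B *v (?v + ?w))" by (rule assms(3))
    then have "?v \<bullet> (A *v ?w) + ?w \<bullet> (A *v ?v) = ?v \<bullet> (B *v ?w) + ?w \<bullet> (B *v ?v)"
      using assms(3)[of ?v] assms(3)[of ?w]
      by (simp add: matrix_vector_right_distrib inner_add_left inner_add_right)
    then have "?v \<bullet> (A *v ?w) = ?v \<bullet> (B *v ?w)"
      using assms(1)[of ?v ?w] assms(2)[of ?v ?w] by simp
    then show ?thesis by (simp add: quadratic_form_axis)
  qed
  then show ?thesis by (simp add: vec_eq_iff)
qed

lemma outer_form: "v \<bullet> (outer a b *v w) = (v \<bullet> a) * (w \<bullet> b)"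
  by (simp add: outer_def inner_vec_def matrix_vector_mult_def sum_product sum_distrib_left mult_ac) (rule sum.swap)

lemma nn_integral_gauss_scale:
  fixes F :: "real^'n \<Rightarrow> ennreal"
  assumes g: "0 < g" and [measurable]: "F \<in> borel_measurable borel"
  shows "(\<integral>\<^sup>+w. ennreal (gauss_dens g w) * F (w /\<^sub>R g) \<partial>lborel) = (\<integral>\<^sup>+u. ennreal (kern g u) * F u \<partial>lborel)"
proof -
  let ?h = "\<lambda>w::real^'n. ennreal (gauss_dens g w) * F (w /\<^sub>R g)"
  have "(\<integral>\<^sup>+w. ?h w \<partial>lborel) = (\<integral>\<^sup>+w. ?h w \<partial>density (distr lborel borel (\<lambda>x. 0 + g *\<^sub>R x)) (\<lambda>_. ennreal (\<bar>g\<bar> ^ DIM(real^'n))))"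
    using lborel_affine[of g "0 :: real^'n"] g by simp
  also have "\<dots> = (\<integral>\<^sup>+x. ennreal (\<bar>g\<bar> ^ DIM(real^'n)) * ?h (g *\<^sub>R x) \<partial>lborel)"
    by (subst nn_integral_density) (simp_all add: nn_integral_distr)
  also have "\<dots> = (\<integral>\<^sup>+u. ennreal (kern g u) * F u \<partial>lborel)"
  proof (rule nn_integral_cong)
    fix u :: "real^'n"
    have "\<bar>g\<bar> ^ DIM(real^'n) * gauss_dens g (g *\<^sub>R u) = kern g u"
      using g by (simp add: gauss_dens_scaleR powr_minus powr_realpow)
    then have "ennreal (\<bar>g\<bar> ^ DIM(real^'n)) * ennreal (gauss_dens g (g *\<^sub>R u)) = ennreal (kern g u)"
      by (subst ennreal_mult[symmetric]) (auto simp: gauss_dens_nonneg)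
    then show "ennreal (\<bar>g\<bar> ^ DIM(real^'n)) * ?h (g *\<^sub>R u) = ennreal (kern g u) * F u"
      using g by (simp add: mult.assoc[symmetric])
  qed
  finally show ?thesis .
qed

lemma gam_range_PInf: "gam_range \<infinity> = {0<..}"
  by (auto simp: gam_range_def)

context pos_density
begin

text \<open>Averaging over a point drawn from \<open>p\<close> and over the noise amounts to
  averaging over the observation \<open>u\<close>, whose density is \<open>q g\<close>. The extended
  nonnegative version allows Tonelli with measurability alone.\<close>

lemma nn_integral_noisy_density:
  assumes g: "0 < g" and f [measurable]: "f \<in> borel_measurable borel"
  shows "(\<integral>\<^sup>+z. ennreal (p z) * (\<integral>\<^sup>+w. ennreal (gauss_dens g w) * f (z + w /\<^sub>R g) \<partial>lborel) \<partial>lborel)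
    = (\<integral>\<^sup>+u. ennreal (q g u) * f u \<partial>lborel)"
proof -
  have "(\<integral>\<^sup>+w. ennreal (gauss_dens g w) * f (z + w /\<^sub>R g) \<partial>lborel) = (\<integral>\<^sup>+u. ennreal (kern g (u - z)) * f u \<partial>lborel)" for z
  proof -
    have "(\<integral>\<^sup>+w. ennreal (gauss_dens g w) * f (z + w /\<^sub>R g) \<partial>lborel) = (\<integral>\<^sup>+u. ennreal (kern g u) * f (z + u) \<partial>lborel)"
      by (rule nn_integral_gauss_scale[OF g]) measurable
    also have "\<dots> = (\<integral>\<^sup>+u. ennreal (kern g (u - z)) * f u \<partial>distr lborel borel ((+) z))"
      by (subst nn_integral_distr) auto
    finally show ?thesis by (simp add: lborel_distr_plus)
  qed
  then have "(\<integral>\<^sup>+z. ennreal (p z) * (\<integral>\<^sup>+w. ennreal (gauss_dens g w) * f (z + w /\<^sub>R g) \<partial>lborel) \<partial>lborel)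
     = (\<integral>\<^sup>+z. \<integral>\<^sup>+u. ennreal (p z) * (ennreal (kern g (u - z)) * f u) \<partial>lborel \<partial>lborel)"
    by (simp add: nn_integral_cmult)
  also have "\<dots> = (\<integral>\<^sup>+u. \<integral>\<^sup>+z. ennreal (p z) * (ennreal (kern g (u - z)) * f u) \<partial>lborel \<partial>lborel)"
    by (rule lborel_pair.Fubini') measurable
  also have "\<dots> = (\<integral>\<^sup>+u. ennreal (q g u) * f u \<partial>lborel)"
  proof (rule nn_integral_cong)
    fix u
    have "(\<integral>\<^sup>+z. ennreal (p z) * (ennreal (kern g (u - z)) * f u) \<partial>lborel)
        = (\<integral>\<^sup>+z. ennreal (p z * (1 * kern g (u - z))) \<partial>lborel) * f u"
      by (subst nn_integral_multc[symmetric])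
        (auto simp: ennreal_mult kern_nonneg less_imp_le[OF p_pos] mult.assoc)
    also have "(\<integral>\<^sup>+z. ennreal (p z * (1 * kern g (u - z))) \<partial>lborel) = ennreal (q g u)"
      unfolding mom_def using mom_integrable[OF g egrow_const[of 1], of u]
      by (intro nn_integral_eq_integral AE_I2) (auto simp: kern_nonneg less_imp_le[OF p_pos])
    finally show "(\<integral>\<^sup>+z. ennreal (p z) * (ennreal (kern g (u - z)) * f u) \<partial>lborel) = ennreal (q g u) * f u" .
  qed
  finally show ?thesis .
qed

text \<open>Here the powers of \<open>g\<close> meet: \<open>dhess\<close> is
  \<open>g\<^sup>2\<close> times a Hessian form in \<open>y\<close>, so its square brings
  \<open>g ^ 4\<close>, and the factor \<open>1 / g\<^sup>2\<close> of the dissipation leaves the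
  weight \<open>g\<^sup>2\<close> of \<open>Gmat\<close>.\<close>

lemma dissipation_eq:
  assumes g: "0 < g"
  shows "ennreal (dissipation v g) = ennreal (g\<^sup>2) * (\<integral>\<^sup>+u. ennreal (q g u) * ennreal (energy v g u) \<partial>lborel)"
proof -
  have s: "(\<Sum>e\<in>Basis. (dhess v e g u)\<^sup>2) = g ^ 4 * (energy v g u)" for u
  proof -
    have "energy v g u = (\<Sum>e\<in>Basis. (e \<bullet> (hmat g u *v v))\<^sup>2)"
      by (subst euclidean_inner) (simp add: power2_eq_square inner_commute)
    also have "\<dots> = (\<Sum>e\<in>Basis. (dhess v e g u)\<^sup>2 / g ^ 4)"
      by (simp add: inner_hmat[OF g] dhess_sym[of v] power_divide flip: power_mult)
    also have "\<dots> = (\<Sum>e\<in>Basis. (dhess v e g u)\<^sup>2) / g ^ 4"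
      by (simp add: sum_divide_distrib)
    finally show ?thesis using g by simp
  qed
  have i: "integrable lborel (\<lambda>u. q g u * (energy v g u))"
    by (intro good_integrable good_intros g)
  have "dissipation v g = 1 / g\<^sup>2 * (LBINT u. g ^ 4 * (q g u * (energy v g u)))"
    unfolding dissipation_def s by (simp add: mult.left_commute)
  also have "\<dots> = g\<^sup>2 * (LBINT u. q g u * (energy v g u))"
    using g by (simp add: power2_eq_square power4_eq_xxxx)
  finally have "ennreal (dissipation v g) = ennreal (g\<^sup>2) * ennreal (LBINT u. q g u * (energy v g u))"
    by (simp add: ennreal_mult less_imp_le[OF q_pos[OF g]])
  also have "ennreal (LBINT u. q g u * (energy v g u))
      = (\<integral>\<^sup>+u. ennreal (q g u * (energy v g u)) \<partial>lborel)"
    using i less_imp_le[OF q_pos[OF g]] by (intro nn_integral_eq_integral[symmetric] AE_I2) auto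
  finally show ?thesis
    by (simp add: ennreal_mult less_imp_le[OF q_pos[OF g]])
qed

lemma Gmat_eq: "Gmat p x \<Gamma> = (LBINT s. indicator (gam_range \<Gamma>) s *\<^sub>R (s\<^sup>2 *\<^sub>R hsq s x))"
  unfolding Gmat_def
  by (intro Bochner_Integration.integral_cong refl) (auto simp: indicator_def gexp_hess_square dest: gam_range_pos)

lemma Gmat_eq_covariance:
  "Gmat p x \<Gamma> = (LBINT s. indicator (gam_range \<Gamma>) s *\<^sub>R
     gexp s (\<lambda>w. (mat 1 - s *\<^sub>R post_cov p s (s *\<^sub>R x + w)) **
                  (mat 1 - s *\<^sub>R post_cov p s (s *\<^sub>R x + w))))"
  unfolding Gmat_def
  by (intro Bochner_Integration.integral_cong refl)
    (auto simp: indicator_def covariance_form gexp_scaleR dest: gam_range_pos)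

lemma IEM_square: "(IEM p x (x + \<epsilon>) \<Gamma>)\<^sup>2 = (LBINT s. indicator (gam_range \<Gamma>) s * sdist s x \<epsilon>)"
proof -
  have "IEM p x (x + \<epsilon>) \<Gamma> = sqrt (LBINT s. indicator (gam_range \<Gamma>) s * sdist s x \<epsilon>)"
    unfolding IEM_def sdist_def
    by (intro arg_cong[of _ _ sqrt] Bochner_Integration.integral_cong refl)
      (auto simp: indicator_def score_shift dest: gam_range_pos)
  moreover have "0 \<le> (LBINT s. indicator (gam_range \<Gamma>) s * sdist s x \<epsilon>)"
    by (intro integral_nonneg_AE AE_I2) (simp add: sdist_nonneg)
  ultimately show ?thesis by simp
qed

lemma Gmat_form:
  assumes "integrable lborel (\<lambda>s. indicator (gam_range \<Gamma>) s *\<^sub>R (s\<^sup>2 *\<^sub>R hsq s x))"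
  shows "v \<bullet> (Gmat p x \<Gamma> *v w) = (LBINT s. indicator (gam_range \<Gamma>) s * (s\<^sup>2 * (v \<bullet> (hsq s x *v w))))"
    and "integrable lborel (\<lambda>s. indicator (gam_range \<Gamma>) s * (s\<^sup>2 * (v \<bullet> (hsq s x *v w))))"
proof -
  interpret bounded_linear "\<lambda>M::real^'n^'n. v \<bullet> (M *v w)" by (rule bounded_linear_quadratic_form)
  show "v \<bullet> (Gmat p x \<Gamma> *v w) = (LBINT s. indicator (gam_range \<Gamma>) s * (s\<^sup>2 * (v \<bullet> (hsq s x *v w))))"
    unfolding Gmat_eq integral_bounded_linear[OF bounded_linear_axioms assms, symmetric]
    by (simp add: scaleR_matrix_vector_assoc[symmetric] mult.assoc)
  show "integrable lborel (\<lambda>s. indicator (gam_range \<Gamma>) s * (s\<^sup>2 * (v \<bullet> (hsq s x *v w))))"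
    using integrable_bounded_linear[OF bounded_linear_axioms assms]
    by (simp add: scaleR_matrix_vector_assoc[symmetric] mult.assoc)
qed

lemma IEM_expansion:
  assumes r: "0 < r" and dom: "integrable lborel (\<lambda>s. indicator (gam_range \<Gamma>) s * g s)"
    and fin: "\<And>s z. s \<in> gam_range \<Gamma> \<Longrightarrow> dist z x < r \<Longrightarrow>
      integrable lborel (\<lambda>w. gauss_dens s w * (norm (hess_log p s (s *\<^sub>R z + w)))\<^sup>2)"
    and le: "\<And>s z. s \<in> gam_range \<Gamma> \<Longrightarrow> dist z x < r \<Longrightarrow>
      s\<^sup>2 * gexp s (\<lambda>w. (norm (hess_log p s (s *\<^sub>R z + w)))\<^sup>2) \<le> g s"
  shows "(\<lambda>\<epsilon>. (IEM p x (x + \<epsilon>) \<Gamma>)\<^sup>2 - \<epsilon> \<bullet> (Gmat p x \<Gamma> *v \<epsilon>)) \<in> o[at 0](\<lambda>\<epsilon>. (norm \<epsilon>)\<^sup>2)"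
proof -
  have fin': "integrable lborel (\<lambda>w. gauss_dens s w * (norm (hmat s (z + w /\<^sub>R s)))\<^sup>2)"
    and le': "s\<^sup>2 * gexp s (\<lambda>w. (norm (hmat s (z + w /\<^sub>R s)))\<^sup>2) \<le> g s"
    if "s \<in> gam_range \<Gamma>" "dist z x < r" for s z
    using fin[OF that] le[OF that] gam_range_pos[OF that(1)] by (simp_all add: hess_log_shift)
  have form_le: "\<bar>s\<^sup>2 * (v \<bullet> (hsq s x *v w))\<bar> \<le> norm v * norm w * g s" if "s \<in> gam_range \<Gamma>" for s v w
  proof -
    have "\<bar>s\<^sup>2 * (v \<bullet> (hsq s x *v w))\<bar> = s\<^sup>2 * \<bar>v \<bullet> (hsq s x *v w)\<bar>" by (simp add: abs_mult)
    also have "\<dots> \<le> s\<^sup>2 * (norm v * norm w * gexp s (\<lambda>w. (norm (hmat s (x + w /\<^sub>R s)))\<^sup>2))"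
      using that r by (intro mult_left_mono norm_square_expectation_le gam_range_pos[OF that] fin') auto
    also have "\<dots> = norm v * norm w * (s\<^sup>2 * gexp s (\<lambda>w. (norm (hmat s (x + w /\<^sub>R s)))\<^sup>2))" by simp
    also have "\<dots> \<le> norm v * norm w * g s"
      using that r by (intro mult_left_mono le') auto
    finally show ?thesis .
  qed
  have iG: "integrable lborel (\<lambda>s. indicator (gam_range \<Gamma>) s *\<^sub>R (s\<^sup>2 *\<^sub>R hsq s x))"
  proof (rule integrable_componentwise)
    fix b :: "real^'n^'n" assume "b \<in> Basis"
    then obtain i j where b: "b = axis i (axis j 1)" by (rule Basis_matrixE)
    show "integrable lborel (\<lambda>s. indicator (gam_range \<Gamma>) s *\<^sub>R (s\<^sup>2 *\<^sub>R hsq s x) \<bullet> b)"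
    proof (rule Bochner_Integration.integrable_bound[OF dom])
      show "(\<lambda>s. indicator (gam_range \<Gamma>) s *\<^sub>R (s\<^sup>2 *\<^sub>R hsq s x) \<bullet> b) \<in> borel_measurable lborel" by measurable
      show "AE s in lborel. norm (indicator (gam_range \<Gamma>) s *\<^sub>R (s\<^sup>2 *\<^sub>R hsq s x) \<bullet> b) \<le> norm (indicator (gam_range \<Gamma>) s * g s)"
      proof (rule AE_I2)
        fix s
        have "\<bar>s\<^sup>2 * (hsq s x $ i $ j)\<bar> \<le> g s" if "s \<in> gam_range \<Gamma>"
          using form_le[OF that, of "axis i 1" "axis j 1"] by (simp add: quadratic_form_axis)
        then show "norm (indicator (gam_range \<Gamma>) s *\<^sub>R (s\<^sup>2 *\<^sub>R hsq s x) \<bullet> b) \<le> norm (indicator (gam_range \<Gamma>) s * g s)"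
          unfolding b by (auto simp: indicator_def matrix_nth_eq_inner[symmetric])
      qed
    qed
  qed
  have sd_le: "sdist s x e \<le> (norm e)\<^sup>2 * g s" if "s \<in> gam_range \<Gamma>" "norm e < r" for s e
  proof (rule sdist_le[OF gam_range_pos[OF that(1)]])
    fix t :: real assume "t \<in> {0..1}"
    then have "dist (x + t *\<^sub>R e) x < r"
      using that(2) by (simp add: dist_norm) (meson le_less_trans mult_left_le_one_le norm_ge_zero)
    then show "integrable lborel (\<lambda>w. gauss_dens s w * (norm (hmat s (x + t *\<^sub>R e + w /\<^sub>R s)))\<^sup>2)"
      "s\<^sup>2 * gexp s (\<lambda>w. (norm (hmat s (x + t *\<^sub>R e + w /\<^sub>R s)))\<^sup>2) \<le> g s"
      using fin' le' that(1) by auto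
  qed
  have isd: "integrable lborel (\<lambda>s. indicator (gam_range \<Gamma>) s * sdist s x e)" if "norm e < r" for e
  proof (rule Bochner_Integration.integrable_bound)
    show "integrable lborel (\<lambda>s. (norm e)\<^sup>2 * (indicator (gam_range \<Gamma>) s * g s))" using dom by simp
    show "AE s in lborel. norm (indicator (gam_range \<Gamma>) s * sdist s x e) \<le> norm ((norm e)\<^sup>2 * (indicator (gam_range \<Gamma>) s * g s))"
      using sd_le[OF _ that] sdist_nonneg
      by (intro AE_I2) (auto simp: indicator_def intro: order_trans[OF _ abs_ge_self])
  qed measurable
  have "((\<lambda>\<epsilon>. ((IEM p x (x + \<epsilon>) \<Gamma>)\<^sup>2 - \<epsilon> \<bullet> (Gmat p x \<Gamma> *v \<epsilon>)) / (norm \<epsilon>)\<^sup>2) \<longlongrightarrow> 0) (at 0)"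
    unfolding tendsto_at_iff_sequentially
  proof (intro allI impI)
    fix X :: "nat \<Rightarrow> real^'n" assume X: "\<forall>i. X i \<in> UNIV - {0}" "X \<longlonglongrightarrow> 0"
    \<comment> \<open>The radius \<open>r\<close> is for the domination hypothesis, the radius 1 for
      \<open>sdist_difference_tendsto\<close>.\<close>
    have "0 < min 1 (r / 2)" using r by simp
    then obtain N where N: "\<And>n. n \<ge> N \<Longrightarrow> norm (X n) < min 1 (r / 2)"
      using X(2) unfolding LIMSEQ_def by (metis dist_0_norm dist_commute)
    define Y where "Y n = X (n + N)" for n
    have Y: "Y n \<noteq> 0" "norm (Y n) < r" "norm (Y n) \<le> 1" for n
      using X(1) N[of "n + N"] r by (auto simp: Y_def)
    have Y0: "Y \<longlonglongrightarrow> 0" unfolding Y_def using X(2) by (rule LIMSEQ_ignore_initial_segment)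
    let ?f = "\<lambda>n s. indicator (gam_range \<Gamma>) s * ((sdist s x (Y n) - s\<^sup>2 * (Y n \<bullet> (hsq s x *v Y n))) / (norm (Y n))\<^sup>2)"
    have eq: "((IEM p x (x + Y n) \<Gamma>)\<^sup>2 - Y n \<bullet> (Gmat p x \<Gamma> *v Y n)) / (norm (Y n))\<^sup>2 = (LBINT s. ?f n s)" for n
    proof -
      have "(LBINT s. ?f n s) = (LBINT s. (indicator (gam_range \<Gamma>) s * sdist s x (Y n)
          - indicator (gam_range \<Gamma>) s * (s\<^sup>2 * (Y n \<bullet> (hsq s x *v Y n)))) / (norm (Y n))\<^sup>2)"
        by (simp add: right_diff_distrib diff_divide_distrib)
      also have "\<dots> = ((IEM p x (x + Y n) \<Gamma>)\<^sup>2 - Y n \<bullet> (Gmat p x \<Gamma> *v Y n)) / (norm (Y n))\<^sup>2"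
        using isd[OF Y(2), of n] Gmat_form[OF iG, of "Y n" "Y n"] by (simp add: IEM_square)
      finally show ?thesis by (rule sym)
    qed
    have "(\<lambda>n. (LBINT s. ?f n s)) \<longlonglongrightarrow> (\<integral>s. 0 \<partial>(lborel :: real measure))"
    proof (rule integral_dominated_convergence[OF _ _ dom])
      show "(\<lambda>s. ?f n s) \<in> borel_measurable lborel" for n by measurable
      show "AE s in lborel. (\<lambda>n. ?f n s) \<longlonglongrightarrow> 0"
      proof (rule AE_I2)
        fix s
        show "(\<lambda>n. ?f n s) \<longlonglongrightarrow> 0"
        proof (cases "s \<in> gam_range \<Gamma>")
          case True
          show ?thesis
            by (rule tendsto_mult_right_zero[OF sdist_difference_tendsto[OF gam_range_pos[OF True] Y(1) Y(3) Y0]])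
        qed simp
      qed
      show "AE s in lborel. norm (?f n s) \<le> indicator (gam_range \<Gamma>) s * g s" for n
      proof (rule AE_I2)
        fix s
        show "norm (?f n s) \<le> indicator (gam_range \<Gamma>) s * g s"
        proof (cases "s \<in> gam_range \<Gamma>")
          case True
          let ?a = "sdist s x (Y n)" and ?b = "s\<^sup>2 * (Y n \<bullet> (hsq s x *v Y n))"
          have "0 \<le> ?b" using hsq_form_nonneg[OF gam_range_pos[OF True], of "Y n" x] by simp
          moreover have "?b \<le> (norm (Y n))\<^sup>2 * g s"
            using form_le[OF True, of "Y n" "Y n"] by (simp add: power2_eq_square)
          moreover have "0 \<le> ?a" "?a \<le> (norm (Y n))\<^sup>2 * g s"
            using sdist_nonneg sd_le[OF True Y(2)] by auto
          \<comment> \<open>Both terms lie in the same interval starting at 0, so their difference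
            costs no factor 2 and \<open>g\<close> itself dominates.\<close>
          ultimately have "\<bar>?a - ?b\<bar> \<le> (norm (Y n))\<^sup>2 * g s" by linarith
          then show ?thesis using True Y(1)[of n] by (simp add: abs_divide pos_divide_le_eq mult.commute)
        qed simp
      qed
    qed simp
    then have "(\<lambda>n. ((IEM p x (x + Y n) \<Gamma>)\<^sup>2 - Y n \<bullet> (Gmat p x \<Gamma> *v Y n)) / (norm (Y n))\<^sup>2) \<longlonglongrightarrow> 0"
      unfolding eq by simp
    then show "((\<lambda>\<epsilon>. ((IEM p x (x + \<epsilon>) \<Gamma>)\<^sup>2 - \<epsilon> \<bullet> (Gmat p x \<Gamma> *v \<epsilon>)) / (norm \<epsilon>)\<^sup>2) \<circ> X) \<longlonglongrightarrow> 0"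
      unfolding Y_def o_def by (rule LIMSEQ_offset)
  qed
  then show ?thesis
    by (rule smalloI_tendsto) (auto simp: eventually_at_filter)
qed

end

section \<open>Fisher information of \<open>p\<close> itself and the identities in (c)\<close>

locale smooth_density = pos_density p for p :: "real^'n \<Rightarrow> real" +
  assumes diff1: "\<And>z. p differentiable (at z)"
    and diff2: "\<And>z. gradient p differentiable (at z)"
    and fin_c2: "integrable lborel (\<lambda>z. p z *\<^sub>R hessian (\<lambda>u. ln (p u)) z)"
    and fin_c3: "integrable lborel (\<lambda>z. p z *\<^sub>R
          outer (gradient (\<lambda>u. ln (p u)) z) (gradient (\<lambda>u. ln (p u)) z))"
begin

lemma p_gderiv: "(p has_derivative (\<lambda>h. h \<bullet> gradient p z)) (at z)"
proof -
  obtain D where D: "(p has_derivative D) (at z)" using diff1[of z] by (auto simp: differentiable_def)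
  have "D = (\<lambda>h. h \<bullet> (\<Sum>b\<in>Basis. D b *\<^sub>R b))"
  proof
    fix h
    have "D h = D (\<Sum>b\<in>Basis. (h \<bullet> b) *\<^sub>R b)" by (simp add: euclidean_representation)
    also have "\<dots> = (\<Sum>b\<in>Basis. (h \<bullet> b) * D b)"
      using has_derivative_linear[OF D] by (simp add: linear_sum linear_scale)
    finally show "D h = h \<bullet> (\<Sum>b\<in>Basis. D b *\<^sub>R b)"
      by (simp add: inner_sum_right mult.commute)
  qed
  with D have *: "GDERIV p z :> (\<Sum>b\<in>Basis. D b *\<^sub>R b)" unfolding gderiv_def by simp
  then show ?thesis using gradient_eqI[OF *] unfolding gderiv_def by simp
qed

definition Hp :: "real^'n \<Rightarrow> real^'n^'n" where
  "Hp z = matrix (frechet_derivative (gradient p) (at z))"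

lemma gradient_has_derivative: "(gradient p has_derivative (\<lambda>h. Hp z *v h)) (at z)"
proof -
  have D: "(gradient p has_derivative frechet_derivative (gradient p) (at z)) (at z)"
    using diff2 by (simp add: frechet_derivative_works)
  have "(\<lambda>h. Hp z *v h) = frechet_derivative (gradient p) (at z)"
    using matrix_works[of "frechet_derivative (gradient p) (at z)"] has_derivative_linear[OF D]
    by (simp add: Hp_def fun_eq_iff)
  then show ?thesis using D by simp
qed

lemma gradient_ln: "gradient (\<lambda>u. ln (p u)) z = gradient p z /\<^sub>R p z"
proof (rule gradient_eqI)
  have "((\<lambda>u. ln (p u)) has_derivative (\<lambda>h. (h \<bullet> gradient p z) * inverse (p z))) (at z)"
    by (rule DERIV_compose_FDERIV[OF DERIV_ln[OF p_pos] p_gderiv])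
  then show "GDERIV (\<lambda>u. ln (p u)) z :> gradient p z /\<^sub>R p z"
    unfolding gderiv_def by (simp add: mult.commute)
qed

lemma hessian_ln:
  "hessian (\<lambda>u. ln (p u)) z = (1 / p z) *\<^sub>R Hp z - (1 / (p z)\<^sup>2) *\<^sub>R outer (gradient p z) (gradient p z)"
proof (rule hessian_eqI)
  have g: "gradient (\<lambda>u. ln (p u)) = (\<lambda>z. inverse (p z) *\<^sub>R gradient p z)"
    by (simp add: gradient_ln fun_eq_iff)
  have inv: "((\<lambda>z. inverse (p z)) has_derivative (\<lambda>h. - (inverse (p z) * (h \<bullet> gradient p z) * inverse (p z)))) (at z)"
    using p_pos[of z] by (intro Deriv.has_derivative_inverse p_gderiv) simp
  have o: "outer a a *v h = (h \<bullet> a) *\<^sub>R a" for a h :: "real^'n"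
    by (simp add: vec_eq_iff outer_def matrix_vector_mult_def inner_vec_def sum_distrib_left mult_ac)
  show "(gradient (\<lambda>u. ln (p u)) has_derivative
      (\<lambda>h. ((1 / p z) *\<^sub>R Hp z - (1 / (p z)\<^sup>2) *\<^sub>R outer (gradient p z) (gradient p z)) *v h)) (at z)"
    unfolding g
    by (rule has_derivative_eq_rhs[OF has_derivative_scaleR[OF inv gradient_has_derivative]])
      (simp add: fun_eq_iff matrix_vector_mult_diff_rdistrib scaleR_matrix_vector_assoc[symmetric] o
        power2_eq_square divide_inverse mult_ac)
qed

definition dp :: "real^'n \<Rightarrow> real^'n \<Rightarrow> real" where "dp v z = v \<bullet> gradient p z"

lemma dp_has_derivative: "(dp v has_derivative (\<lambda>h. v \<bullet> (Hp z *v h))) (at z)"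
  unfolding dp_def[abs_def] by (intro has_derivative_inner_right gradient_has_derivative)

lemma dp_isCont: "isCont (dp v) z"
  using dp_has_derivative has_derivative_continuous by blast

lemma p_isCont: "isCont p z"
  using p_gderiv has_derivative_continuous by blast

lemma outer_integrand: "v \<bullet> ((p z *\<^sub>R outer (gradient (\<lambda>u. ln (p u)) z) (gradient (\<lambda>u. ln (p u)) z)) *v w) = dp v z * dp w z / p z"
  using p_pos[of z]
  by (simp add: scaleR_matrix_vector_assoc[symmetric] outer_form gradient_ln dp_def field_simps)

lemma hessian_integrand: "v \<bullet> ((p z *\<^sub>R hessian (\<lambda>u. ln (p u)) z) *v w) = v \<bullet> (Hp z *v w) - dp v z * dp w z / p z"
  using p_pos[of z]
  by (simp add: hessian_ln scaleR_matrix_vector_assoc[symmetric] outer_form dp_def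
      matrix_vector_mult_diff_rdistrib inner_diff_right scaleR_right_diff_distrib power2_eq_square)

lemma fisher_integrable: "integrable lborel (\<lambda>z. dp v z * dp w z / p z)"
  using integrable_bounded_linear[OF bounded_linear_quadratic_form[of v w] fin_c3] by (simp only: outer_integrand)

text \<open>Total mass and finite Fisher information suffice, because
  \<open>\<bar>dp v z\<bar> \<le> p z + (dp v z)\<^sup>2 / p z\<close> by the arithmetic-geometric
  mean inequality.\<close>

lemma dp_integrable: "integrable lborel (dp v)"
proof (rule Bochner_Integration.integrable_bound)
  show "integrable lborel (\<lambda>z. p z + dp v z * dp v z / p z)" using p_int fisher_integrable by simp
  show "dp v \<in> borel_measurable lborel"
    using dp_isCont by (auto intro!: borel_measurable_continuous_onI continuous_at_imp_continuous_on)
  show "AE z in lborel. norm (dp v z) \<le> norm (p z + dp v z * dp v z / p z)"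
  proof (rule AE_I2)
    fix z
    have "\<bar>dp v z\<bar> * p z \<le> p z * p z + dp v z * dp v z"
    proof -
      have "2 * (\<bar>dp v z\<bar> * p z) \<le> (p z)\<^sup>2 + (dp v z)\<^sup>2"
        using zero_le_power2[of "p z - \<bar>dp v z\<bar>"] by (simp add: power2_diff mult_ac)
      moreover have "0 \<le> \<bar>dp v z\<bar> * p z" using p_pos[of z] by simp
      ultimately show ?thesis unfolding power2_eq_square by linarith
    qed
    then have "\<bar>dp v z\<bar> \<le> p z + dp v z * dp v z / p z"
      using p_pos[of z] by (simp add: field_simps)
    then show "norm (dp v z) \<le> norm (p z + dp v z * dp v z / p z)" by simp
  qed
qed

text \<open>Integrability comes from adding \<open>fin_c2\<close> and \<open>fin_c3\<close>, since
  the Hessian of \<open>ln p\<close> times \<open>p\<close> differs from \<open>Hp\<close> by the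
  outer product term. The integrand is the derivative of \<open>dp v\<close> along \<open>w\<close>,
  so its integral vanishes; this is the classical equality of the two forms of Fisher
  information.\<close>

lemma Hp_integral: "(LBINT z. v \<bullet> (Hp z *v w)) = 0" "integrable lborel (\<lambda>z. v \<bullet> (Hp z *v w))"
proof -
  have "integrable lborel (\<lambda>z. v \<bullet> (Hp z *v w) - dp v z * dp w z / p z)"
    using integrable_bounded_linear[OF bounded_linear_quadratic_form[of v w] fin_c2] by (simp only: hessian_integrand)
  from Bochner_Integration.integrable_add[OF this fisher_integrable[of v w]]
  show i: "integrable lborel (\<lambda>z. v \<bullet> (Hp z *v w))" by simp
  show "(LBINT z. v \<bullet> (Hp z *v w)) = 0"
    by (rule integral_directional_derivative_eq_0[OF dp_integrable[of v] i])
      (rule has_derivative_imp_directional[OF dp_has_derivative])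
qed

lemma integral_outer_form:
  "v \<bullet> ((LBINT z. p z *\<^sub>R outer (gradient (\<lambda>u. ln (p u)) z) (gradient (\<lambda>u. ln (p u)) z)) *v w)
    = (LBINT z. dp v z * dp w z / p z)"
  using integral_bounded_linear[OF bounded_linear_quadratic_form[of v w] fin_c3]
  by (simp only: outer_integrand)

lemma integral_hessian_eq_outer:
  "(LBINT z. p z *\<^sub>R (- hessian (\<lambda>u. ln (p u)) z))
    = (LBINT z. p z *\<^sub>R outer (gradient (\<lambda>u. ln (p u)) z) (gradient (\<lambda>u. ln (p u)) z))" (is "?A = ?B")
proof -
  let ?H = "(LBINT z. p z *\<^sub>R hessian (\<lambda>u. ln (p u)) z)"
  have "v \<bullet> (?H *v w) = (LBINT z. v \<bullet> (Hp z *v w) - dp v z * dp w z / p z)" for v w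
    using integral_bounded_linear[OF bounded_linear_quadratic_form[of v w] fin_c2]
    by (simp only: hessian_integrand)
  also have "\<dots> v w = - (v \<bullet> (?B *v w))" for v w
    using Hp_integral[of v w] fisher_integrable[of v w] by (simp add: integral_outer_form)
  finally have "axis i 1 \<bullet> (?H *v axis j 1) = - (axis i 1 \<bullet> (?B *v axis j 1))" for i j .
  then have "?H = - ?B" by (simp add: quadratic_form_axis vec_eq_iff)
  then show ?thesis by simp
qed

text \<open>For the diagonal forms, everything is moved to nonnegative integrals, where the
  integration over the precision can be taken outermost. At each precision the rest is the
  dissipation, and its integral over \<open>{0<..}\<close> is the Fisher information of
  \<open>p\<close>. The finiteness assumptions justify passing between these integrals and the
  matrix-valued ones.\<close>

lemma integral_Gmat_eq_outer:
  assumes fin_G: "\<And>z. integrable lborel (\<lambda>s. indicator (gam_range \<infinity>) s *\<^sub>R (s\<^sup>2 *\<^sub>R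
          gexp s (\<lambda>w. hess_log p s (s *\<^sub>R z + w) ** hess_log p s (s *\<^sub>R z + w))))"
    and fin_c1: "integrable lborel (\<lambda>z. p z *\<^sub>R Gmat p z \<infinity>)"
  shows "(LBINT z. p z *\<^sub>R Gmat p z \<infinity>)
    = (LBINT z. p z *\<^sub>R outer (gradient (\<lambda>u. ln (p u)) z) (gradient (\<lambda>u. ln (p u)) z))" (is "?A = ?B")
proof -
  have "(\<lambda>s. indicator (gam_range \<infinity>) s *\<^sub>R (s\<^sup>2 *\<^sub>R gexp s (\<lambda>w. hess_log p s (s *\<^sub>R z + w) ** hess_log p s (s *\<^sub>R z + w))))
      = (\<lambda>s. indicator (gam_range \<infinity>) s *\<^sub>R (s\<^sup>2 *\<^sub>R hsq s z))" for z
    by (auto simp: fun_eq_iff indicator_def gexp_hess_square dest: gam_range_pos)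
  with fin_G have iG: "integrable lborel (\<lambda>s. indicator (gam_range \<infinity>) s *\<^sub>R (s\<^sup>2 *\<^sub>R hsq s z))" for z
    by simp
  have A: "v \<bullet> (?A *v w) = (LBINT z. p z * (v \<bullet> (Gmat p z \<infinity> *v w)))"
    and iA: "integrable lborel (\<lambda>z. p z * (v \<bullet> (Gmat p z \<infinity> *v w)))" for v w
    using integral_bounded_linear[OF bounded_linear_quadratic_form[of v w] fin_c1]
      integrable_bounded_linear[OF bounded_linear_quadratic_form[of v w] fin_c1]
    by (simp_all add: scaleR_matrix_vector_assoc[symmetric])
  show ?thesis
  proof (rule matrix_eq_quadratic_form)
    show "v \<bullet> (?B *v w) = w \<bullet> (?B *v v)" for v w
      by (simp add: integral_outer_form mult.commute)
    have "v \<bullet> (Gmat p z \<infinity> *v w) = w \<bullet> (Gmat p z \<infinity> *v v)" for v w z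
      unfolding Gmat_form(1)[OF iG]
      by (intro Bochner_Integration.integral_cong refl)
        (auto simp: indicator_def hsq_form inner_commute dest: gam_range_pos)
    then show "v \<bullet> (?A *v w) = w \<bullet> (?A *v v)" for v w
      unfolding A by metis
    fix v
    let ?J = "(LBINT z. dp v z * dp v z / p z)"
    let ?I = "indicator {0<..} :: real \<Rightarrow> real"
    let ?h = "\<lambda>s u. ennreal (energy v s u)"
    let ?N = "\<lambda>s z. \<integral>\<^sup>+w. ennreal (gauss_dens s w) * ?h s (z + w /\<^sub>R s) \<partial>lborel"
    have G: "ennreal (v \<bullet> (Gmat p z \<infinity> *v v)) = (\<integral>\<^sup>+s. ennreal (?I s * s\<^sup>2) * ?N s z \<partial>lborel)"
      and G0: "0 \<le> v \<bullet> (Gmat p z \<infinity> *v v)" for z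
    proof -
      have n: "0 \<le> ?I s * (s\<^sup>2 * (v \<bullet> (hsq s z *v v)))" for s
        using hsq_form_nonneg[of s v z] by (simp add: indicator_def)
      note F = Gmat_form[OF iG[of z], of v v, unfolded gam_range_PInf]
      show "0 \<le> v \<bullet> (Gmat p z \<infinity> *v v)" unfolding F(1) by (intro integral_nonneg_AE AE_I2 n)
      have "ennreal (v \<bullet> (Gmat p z \<infinity> *v v)) = (\<integral>\<^sup>+s. ennreal (?I s * (s\<^sup>2 * (v \<bullet> (hsq s z *v v)))) \<partial>lborel)"
        unfolding F(1) by (intro nn_integral_eq_integral[symmetric] F(2) AE_I2 n)
      also have "\<dots> = (\<integral>\<^sup>+s. ennreal (?I s * s\<^sup>2) * ?N s z \<partial>lborel)"
      proof (rule nn_integral_cong)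
        fix s :: real
        show "ennreal (?I s * (s\<^sup>2 * (v \<bullet> (hsq s z *v v))))
            = ennreal (?I s * s\<^sup>2) * ?N s z"
        proof (cases "0 < s")
          case True
          have i: "integrable lborel (\<lambda>w. gauss_dens s w * (energy v s (z + w /\<^sub>R s)))"
            by (intro gauss_good_integrable[where f = "\<lambda>g u. energy v g u"] True good_intros)
          have "ennreal (v \<bullet> (hsq s z *v v)) = (\<integral>\<^sup>+w. ennreal (gauss_dens s w * (energy v s (z + w /\<^sub>R s))) \<partial>lborel)"
            unfolding hsq_form[OF True] gexp_def real_scaleR_def
            by (intro nn_integral_eq_integral[symmetric] i AE_I2) (simp add: gauss_dens_nonneg)
          also have "\<dots> = ?N s z"
            by (intro nn_integral_cong ennreal_mult) (simp_all add: gauss_dens_nonneg)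
          finally show ?thesis
            using True hsq_form_nonneg[OF True, of v z] by (simp add: ennreal_mult)
        qed simp
      qed
      finally show "ennreal (v \<bullet> (Gmat p z \<infinity> *v v)) = \<dots>" .
    qed
    have "ennreal (v \<bullet> (?A *v v)) = (\<integral>\<^sup>+z. ennreal (p z * (v \<bullet> (Gmat p z \<infinity> *v v))) \<partial>lborel)"
      unfolding A using iA G0 less_imp_le[OF p_pos] by (intro nn_integral_eq_integral[symmetric] AE_I2) auto
    also have "\<dots> = (\<integral>\<^sup>+z. ennreal (p z) * (\<integral>\<^sup>+s. ennreal (?I s * s\<^sup>2) * ?N s z \<partial>lborel) \<partial>lborel)"
      by (simp add: ennreal_mult G0 less_imp_le[OF p_pos] G)
    also have "\<dots> = (\<integral>\<^sup>+z. \<integral>\<^sup>+s. ennreal (?I s * s\<^sup>2) * (ennreal (p z) * ?N s z) \<partial>lborel \<partial>lborel)"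
    proof (rule nn_integral_cong)
      fix z
      show "ennreal (p z) * (\<integral>\<^sup>+s. ennreal (?I s * s\<^sup>2) * ?N s z \<partial>lborel)
          = (\<integral>\<^sup>+s. ennreal (?I s * s\<^sup>2) * (ennreal (p z) * ?N s z) \<partial>lborel)"
        unfolding mult.left_commute[of _ "ennreal (p z)"]
        by (rule nn_integral_cmult[symmetric]) measurable
    qed
    also have "\<dots> = (\<integral>\<^sup>+s. \<integral>\<^sup>+z. ennreal (?I s * s\<^sup>2) * (ennreal (p z) * ?N s z) \<partial>lborel \<partial>lborel)"
      by (rule lborel_pair.Fubini') measurable
    also have "\<dots> = (\<integral>\<^sup>+s. ennreal (?I s * dissipation v s) \<partial>lborel)"
    proof (rule nn_integral_cong)
      fix s :: real
      show "(\<integral>\<^sup>+z. ennreal (?I s * s\<^sup>2) * (ennreal (p z) * ?N s z) \<partial>lborel)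
          = ennreal (?I s * dissipation v s)"
      proof (cases "0 < s")
        case True
        have m: "?h s \<in> borel_measurable borel" by measurable
        show ?thesis
          using True by (subst nn_integral_cmult) (simp_all add: nn_integral_noisy_density[OF True m] dissipation_eq)
      qed simp
    qed
    also have "\<dots> = ennreal (LBINT z. (dp v z)\<^sup>2 / p z)"
    proof (rule dissipation_integral)
      show "((\<lambda>t. p (z + t *\<^sub>R v)) has_real_derivative dp v z) (at 0)" for z
        unfolding dp_def by (rule has_derivative_imp_directional[OF p_gderiv])
      show "integrable lborel (\<lambda>z. (dp v z)\<^sup>2 / p z)"
        using fisher_integrable[of v v] by (simp add: power2_eq_square)
    qed (rule dp_integrable p_isCont dp_isCont)+
    also have "\<dots> = ennreal (v \<bullet> (?B *v v))"
      by (simp add: integral_outer_form power2_eq_square)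
    finally have e: "ennreal (v \<bullet> (?A *v v)) = ennreal (v \<bullet> (?B *v v))" .
    have "0 \<le> v \<bullet> (?A *v v)" unfolding A
      using G0 less_imp_le[OF p_pos] by (intro integral_nonneg_AE AE_I2) simp
    moreover have "0 \<le> v \<bullet> (?B *v v)" unfolding integral_outer_form
      using less_imp_le[OF p_pos] by (intro integral_nonneg_AE AE_I2) simp
    ultimately show "v \<bullet> (?A *v v) = v \<bullet> (?B *v v)" using e by simp
  qed
qed

end

theorem theorem2:
  fixes p :: "real^'n \<Rightarrow> real" and x :: "real^'n" and \<Gamma> :: ereal
  assumes Gamma_pos: "\<Gamma> > 0"
    and pos: "\<And>z. p z > 0"
    and dens: "integrable lborel p" "(\<integral>z. p z \<partial>lborel) = 1"
    and diff1: "\<And>z. p differentiable (at z)"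
    and diff2: "\<And>z. (gradient p) differentiable (at z)"
    \<comment> \<open>finiteness of G(x,Gamma) and of the IEM near x (with domination, permitting the interchange
        of the limit eps -> 0 with expectation and gamma-integration)\<close>
    and fin_a: "\<exists>r>0. \<exists>g. integrable lborel (\<lambda>\<gamma>. indicator (gam_range \<Gamma>) \<gamma> * g \<gamma>) \<and>
        (\<forall>\<gamma>\<in>gam_range \<Gamma>. \<forall>z. dist z x < r \<longrightarrow>
            integrable lborel (\<lambda>w. gauss_dens \<gamma> w * (norm (hess_log p \<gamma> (\<gamma> *\<^sub>R z + w)))\<^sup>2) \<and>
            \<gamma>\<^sup>2 * gexp \<gamma> (\<lambda>w. (norm (hess_log p \<gamma> (\<gamma> *\<^sub>R z + w)))\<^sup>2) \<le> g \<gamma>)"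
    \<comment> \<open>finiteness of the quantities in (c)\<close>
    and fin_G: "\<And>z. integrable lborel (\<lambda>\<gamma>. indicator (gam_range \<infinity>) \<gamma> *\<^sub>R (\<gamma>\<^sup>2 *\<^sub>R
          gexp \<gamma> (\<lambda>w. hess_log p \<gamma> (\<gamma> *\<^sub>R z + w) ** hess_log p \<gamma> (\<gamma> *\<^sub>R z + w))))"
    and fin_c1: "integrable lborel (\<lambda>z. p z *\<^sub>R Gmat p z \<infinity>)"
    and fin_c2: "integrable lborel (\<lambda>z. p z *\<^sub>R hessian (\<lambda>u. ln (p u)) z)"
    and fin_c3: "integrable lborel (\<lambda>z. p z *\<^sub>R
          outer (gradient (\<lambda>u. ln (p u)) z) (gradient (\<lambda>u. ln (p u)) z))"
  shows "((\<lambda>\<epsilon>. (IEM p x (x + \<epsilon>) \<Gamma>)\<^sup>2 - \<epsilon> \<bullet> (Gmat p x \<Gamma> *v \<epsilon>))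
           \<in> o[at 0](\<lambda>\<epsilon>. (norm \<epsilon>)\<^sup>2)) \<and>
         (Gmat p x \<Gamma> = (\<integral>\<gamma>. indicator (gam_range \<Gamma>) \<gamma> *\<^sub>R
           gexp \<gamma> (\<lambda>w. (mat 1 - \<gamma> *\<^sub>R post_cov p \<gamma> (\<gamma> *\<^sub>R x + w)) **
                        (mat 1 - \<gamma> *\<^sub>R post_cov p \<gamma> (\<gamma> *\<^sub>R x + w))) \<partial>lborel)) \<and>
         ((\<integral>z. p z *\<^sub>R Gmat p z \<infinity> \<partial>lborel) =
           (\<integral>z. p z *\<^sub>R (- hessian (\<lambda>u. ln (p u)) z) \<partial>lborel)) \<and>
         ((\<integral>z. p z *\<^sub>R (- hessian (\<lambda>u. ln (p u)) z) \<partial>lborel) =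
           (\<integral>z. p z *\<^sub>R outer (gradient (\<lambda>u. ln (p u)) z) (gradient (\<lambda>u. ln (p u)) z) \<partial>lborel))"
proof -
  interpret smooth_density p
    using pos dens diff1 diff2 fin_c2 fin_c3 by unfold_locales
  obtain r g where r: "0 < r" "integrable lborel (\<lambda>\<gamma>. indicator (gam_range \<Gamma>) \<gamma> * g \<gamma>)"
    and dom: "\<And>\<gamma> z. \<gamma> \<in> gam_range \<Gamma> \<Longrightarrow> dist z x < r \<Longrightarrow>
            integrable lborel (\<lambda>w. gauss_dens \<gamma> w * (norm (hess_log p \<gamma> (\<gamma> *\<^sub>R z + w)))\<^sup>2) \<and>
            \<gamma>\<^sup>2 * gexp \<gamma> (\<lambda>w. (norm (hess_log p \<gamma> (\<gamma> *\<^sub>R z + w)))\<^sup>2) \<le> g \<gamma>"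
    using fin_a by blast
  have "(\<lambda>\<epsilon>. (IEM p x (x + \<epsilon>) \<Gamma>)\<^sup>2 - \<epsilon> \<bullet> (Gmat p x \<Gamma> *v \<epsilon>)) \<in> o[at 0](\<lambda>\<epsilon>. (norm \<epsilon>)\<^sup>2)"
    by (rule IEM_expansion[OF r conjunct1[OF dom] conjunct2[OF dom]])
  then show ?thesis
    using Gmat_eq_covariance integral_hessian_eq_outer integral_Gmat_eq_outer[OF fin_G fin_c1] by simp
qed


end
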